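(* Consider the severely ill-posed model $y=G(u)+\frac1{\sqrt n}\eta$ on a Hilbert space $\mathcal H$, with prior $\mu_n=\mathcal N(0,\mathcal C/R_n^2)$, operator $G=(\exp(\mathcal C^{-\beta'})+K_2)^{-1}$ and noise covariance $\zeta=(\mathcal C^{-r}+K_1)^{-2}$ as described in the context. Then the model is well-posed. Further, let $0<\sigma<\frac12$, $R_n=n^{\frac12-\sigma}$, $\gamma>0$ and $u_0\in\mathcal H^\gamma(\mathcal C_n)$. Then $$\xi_n=(\log n)^{-\gamma/\beta}$$ is a contraction rate at $u_0$, i.e. there is $M>0$ with $\mu_n^y(u:\|u-u_0\|>M\xi_n)\to0$ in $\mathbb Q_{u_0,n}$-probability as $n\to\infty$.
   Context: $\mathcal H$ is an infinite-dimensional separable Hilbert space. $\mathcal C$ is a self-adjoint positive definite operator with orthonormal eigenbasis $\{\varphi_j\}$ and eigenvalues $\lambda_j=j^{-1-2\delta}$, $\delta>0$; $\mathcal C_n=\mathcal C/R_n^2$. $\beta'>0$ and $\beta>0$ is defined by $\lambda_j^{-\beta'}=j^\beta$. $\exp(\mathcal C^{-\beta'})$ is the operator with eigenpairs $\{\varphi_j,\exp(\lambda_j^{-\beta'})\}$. $K_1,K_2$ are continuous self-adjoint positive operators on $\mathcal H$; $r\ge0$, and if $r=0$ then $K_1=0$ (white noise). $\eta$ is a centered Gaussian noise with covariance operator $\zeta$ (if $\zeta$ is not trace class it lives on a larger space and $\langle\eta,x\rangle$ are centered jointly Gaussian with covariance $\langle\zeta x,x'\rangle$); $u\sim\mu_n$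 is independent of $\eta$. $\mathcal H^\gamma(\mathcal C_n)=\{u:\sum_i i^{2\gamma}\langle u,\varphi_i\rangle^2<\infty\}$. With $\langle x,x'\rangle_\zeta=\langle\zeta^{-1/2}x,\zeta^{-1/2}x'\rangle$, the posterior $\mu_n^y$ (conditional law of $u$ given $y$) is $d\mu_n^y/d\mu_n(u)\propto\exp(-\frac n2\|G(u)\|_\zeta^2+n\langle y,G(u)\rangle_\zeta)$. $\mathbb Q_{u_0,n}$ is the law of $G(u_0)+\eta/\sqrt n$. Well-posed: (for each $n$) there is a Banach space $(Y,\|\cdot\|_Y)$ with $y\in Y$ almost surely such that $y\mapsto\mu_n^y$ is continuous from $Y$ to probability measures with the Hellinger distance $d_H(\mu,\mu')=\big(\frac12\int(\sqrt{d\mu/dm}-\sqrt{d\mu'/dm})^2dm\big)^{1/2}$ ($m$ any common dominating measure). *)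

theory Defs
  imports "HOL-Probability.Probability"
begin

section \<open>Operators on a real Hilbert space\<close>

definition orthonormal_basis :: "(nat \<Rightarrow> 'h::real_inner) \<Rightarrow> bool" where
  "orthonormal_basis \<phi> \<longleftrightarrow>
     (\<forall>i j. \<phi> i \<bullet> \<phi> j = (if i = j then 1 else 0)) \<and> closure (span (range \<phi>)) = UNIV"

definition self_adjoint :: "('h::real_inner \<Rightarrow> 'h) \<Rightarrow> bool" where
  "self_adjoint T \<longleftrightarrow> (\<forall>x y. T x \<bullet> y = x \<bullet> T y)"

definition positive_op :: "('h::real_inner \<Rightarrow> 'h) \<Rightarrow> bool" where
  "positive_op T \<longleftrightarrow> (\<forall>x. T x \<bullet> x \<ge> 0)"

definition positive_definite_op :: "('h::real_inner \<Rightarrow> 'h) \<Rightarrow> bool" where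
  "positive_definite_op T \<longleftrightarrow> (\<forall>x. x \<noteq> 0 \<longrightarrow> T x \<bullet> x > 0)"

text \<open>The (possibly unbounded) self-adjoint operator with eigenpairs \<open>(\<phi> j, a j)\<close>, given by its
  maximal domain and its action there. Bases are indexed from 0, so that \<open>\<phi> j\<close> is the
  \<open>(j+1)\<close>-st basis vector.\<close>

definition eig_dom :: "(nat \<Rightarrow> 'h::real_inner) \<Rightarrow> (nat \<Rightarrow> real) \<Rightarrow> 'h set" where
  "eig_dom \<phi> a = {x. summable (\<lambda>j. (a j * (x \<bullet> \<phi> j))\<^sup>2)}"

definition eig_op :: "(nat \<Rightarrow> 'h::real_inner) \<Rightarrow> (nat \<Rightarrow> real) \<Rightarrow> 'h \<Rightarrow> 'h" where
  "eig_op \<phi> a x = (\<Sum>j. (a j * (x \<bullet> \<phi> j)) *\<^sub>R \<phi> j)"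

definition eigval :: "real \<Rightarrow> nat \<Rightarrow> real" where
  "eigval \<delta> j = real (Suc j) powr (- 1 - 2 * \<delta>)"

text \<open>\<open>(exp (C^(-\<beta>')) + K2)^(-1)\<close>\<close>

definition forward_op ::
    "(nat \<Rightarrow> 'h::real_inner) \<Rightarrow> real \<Rightarrow> real \<Rightarrow> ('h \<Rightarrow> 'h) \<Rightarrow> 'h \<Rightarrow> 'h" where
  "forward_op \<phi> \<delta> \<beta>' K2 =
     (let a = (\<lambda>j. exp (eigval \<delta> j powr (- \<beta>')))
      in inv_into (eig_dom \<phi> a) (\<lambda>x. eig_op \<phi> a x + K2 x))"

text \<open>\<open>(C^(-r) + K1)^(-2)\<close>\<close>

definition noise_cov ::
    "(nat \<Rightarrow> 'h::real_inner) \<Rightarrow> real \<Rightarrow> real \<Rightarrow> ('h \<Rightarrow> 'h) \<Rightarrow> 'h \<Rightarrow> 'h" where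
  "noise_cov \<phi> \<delta> r K1 =
     (let a = (\<lambda>j. eigval \<delta> j powr (- r));
          B = inv_into (eig_dom \<phi> a) (\<lambda>x. eig_op \<phi> a x + K1 x)
      in B \<circ> B)"

definition op_sqrt :: "('h::real_inner \<Rightarrow> 'h) \<Rightarrow> 'h \<Rightarrow> 'h" where
  "op_sqrt Q = (THE S. bounded_linear S \<and> self_adjoint S \<and> positive_op S \<and> S \<circ> S = Q)"

text \<open>\<open>\<zeta>^(-1/2)\<close>; meaningful on its domain \<open>range (op_sqrt \<zeta>)\<close> only.\<close>

definition inv_sqrt :: "('h::real_inner \<Rightarrow> 'h) \<Rightarrow> 'h \<Rightarrow> 'h" where
  "inv_sqrt \<zeta> = inv (op_sqrt \<zeta>)"

definition zeta_inner :: "('h::real_inner \<Rightarrow> 'h) \<Rightarrow> 'h \<Rightarrow> 'h \<Rightarrow> real" where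
  "zeta_inner \<zeta> x x' = inv_sqrt \<zeta> x \<bullet> inv_sqrt \<zeta> x'"

definition smooth_space :: "(nat \<Rightarrow> 'h::real_inner) \<Rightarrow> real \<Rightarrow> 'h set" where
  "smooth_space \<phi> \<gamma> = {u. summable (\<lambda>i. real (Suc i) powr (2 * \<gamma>) * (u \<bullet> \<phi> i)\<^sup>2)}"


section \<open>Gaussian laws\<close>

definition gauss_law :: "real \<Rightarrow> real measure" where
  "gauss_law v = (if v = 0 then return borel 0 else density lborel (normal_density 0 (sqrt v)))"

definition centered_gaussian :: "('h::real_inner) measure \<Rightarrow> ('h \<Rightarrow> 'h) \<Rightarrow> bool" where
  "centered_gaussian \<mu> Q \<longleftrightarrow>
     prob_space \<mu> \<and> sets \<mu> = sets borel \<and>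
     (\<forall>x. distr \<mu> borel (\<lambda>u. u \<bullet> x) = gauss_law (Q x \<bullet> x))"

text \<open>A noise that need not take values in the Hilbert space: \<open>\<eta> x\<close> is the random variable
  written \<open>\<langle>\<eta>, x\<rangle>\<close>. Joint Gaussianity is expressed through finite linear combinations.\<close>

definition gaussian_noise ::
    "'w measure \<Rightarrow> ('h::real_inner \<Rightarrow> 'w \<Rightarrow> real) \<Rightarrow> ('h \<Rightarrow> 'h) \<Rightarrow> bool" where
  "gaussian_noise M \<eta> \<zeta> \<longleftrightarrow>
     (\<forall>x. \<eta> x \<in> borel_measurable M) \<and>
     (\<forall>A c. finite A \<longrightarrow>
        distr M borel (\<lambda>\<omega>. \<Sum>x\<in>A. c x * \<eta> x \<omega>) =
        gauss_law (\<Sum>x\<in>A. \<Sum>x'\<in>A. c x * c x' * (\<zeta> x \<bullet> x')))"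

definition independent_of_noise ::
    "'w measure \<Rightarrow> ('h::real_inner \<Rightarrow> 'w \<Rightarrow> real) \<Rightarrow> ('w \<Rightarrow> 'h) \<Rightarrow> bool" where
  "independent_of_noise M \<eta> U \<longleftrightarrow>
     prob_space.indep_set M
       {U -` A \<inter> space M | A. A \<in> sets borel}
       {(\<lambda>\<omega> x. \<eta> x \<omega>) -` B \<inter> space M | B. B \<in> sets (Pi\<^sub>M UNIV (\<lambda>_. borel))}"


section \<open>Data\<close>

text \<open>The process \<open>x \<mapsto> \<langle>y, x\<rangle>\<close> for \<open>y = g + \<eta> / sqrt n\<close>, where \<open>g\<close> is a random element of the
  Hilbert space.\<close>

definition data_process ::
    "('h::real_inner \<Rightarrow> 'w \<Rightarrow> real) \<Rightarrow> nat \<Rightarrow> ('w \<Rightarrow> 'h) \<Rightarrow> 'h \<Rightarrow> 'w \<Rightarrow> real" where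
  "data_process \<eta> n g x \<omega> = g \<omega> \<bullet> x + \<eta> x \<omega> / sqrt (real n)"

text \<open>\<open>Z\<close> is the random variable \<open>\<langle>y, x\<rangle>\<^sub>\<zeta> = \<langle>\<zeta>^(-1/2) y, \<zeta>^(-1/2) x\<rangle>\<close>. For \<open>h\<close> in the (dense) domain
  of \<open>\<zeta>^(-1/2)\<close> one has \<open>\<langle>\<zeta>^(-1/2) y, h\<rangle> = \<langle>y, \<zeta>^(-1/2) h\<rangle>\<close>; for other \<open>h\<close>, which do occur since
  \<open>\<zeta>^(-1/2) x\<close> need not lie in that domain, the pairing is the limit in probability.\<close>

definition is_zeta_pairing ::
    "'w measure \<Rightarrow> ('h::real_inner \<Rightarrow> 'h) \<Rightarrow> ('h \<Rightarrow> 'w \<Rightarrow> real) \<Rightarrow> 'h \<Rightarrow> ('w \<Rightarrow> real) \<Rightarrow> bool" where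
  "is_zeta_pairing M \<zeta> y x Z \<longleftrightarrow>
     Z \<in> borel_measurable M \<and>
     (\<forall>h. (\<forall>k. h k \<in> range (op_sqrt \<zeta>)) \<and> h \<longlonglongrightarrow> inv_sqrt \<zeta> x \<longrightarrow>
        (\<forall>\<epsilon>>0. (\<lambda>k. measure M {\<omega> \<in> space M. \<bar>y (inv_sqrt \<zeta> (h k)) \<omega> - Z \<omega>\<bar> > \<epsilon>}) \<longlonglongrightarrow> 0))"

text \<open>Data enter the posterior only through \<open>x \<mapsto> \<langle>y, x\<rangle>\<^sub>\<zeta>\<close> for \<open>x \<in> range G\<close>, and a data point \<open>y\<close> is
  represented by this functional. A realisation of a data process is a choice of such a functional
  for every \<open>\<omega>\<close>; by the joint measurability and Fubini, two realisations almost surely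
  give the same posterior.\<close>

definition is_realisation ::
    "'w measure \<Rightarrow> ('h::real_inner \<Rightarrow> 'h) \<Rightarrow> ('h \<Rightarrow> 'h) \<Rightarrow> ('h \<Rightarrow> 'w \<Rightarrow> real) \<Rightarrow>
      ('w \<Rightarrow> 'h \<Rightarrow> real) \<Rightarrow> bool" where
  "is_realisation M G \<zeta> y L \<longleftrightarrow>
     (\<lambda>(\<omega>, u). L \<omega> (G u)) \<in> borel_measurable (M \<Otimes>\<^sub>M borel) \<and>
     (\<forall>x\<in>range G. is_zeta_pairing M \<zeta> y x (\<lambda>\<omega>. L \<omega> x))"

text \<open>A Banach space \<open>(Y, N)\<close> whose elements are linear functionals on the subspace \<open>T\<close> (extended
  by 0 outside \<open>T\<close>), with pointwise operations and continuous evaluations.\<close>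

definition banach_space_of_functionals ::
    "'h::real_vector set \<Rightarrow> ('h \<Rightarrow> real) set \<Rightarrow> (('h \<Rightarrow> real) \<Rightarrow> real) \<Rightarrow> bool" where
  "banach_space_of_functionals T Y N \<longleftrightarrow>
     (\<forall>y\<in>Y. (\<forall>x\<in>T. \<forall>x'\<in>T. y (x + x') = y x + y x') \<and> (\<forall>x\<in>T. \<forall>c. y (c *\<^sub>R x) = c * y x) \<and>
             (\<forall>x. x \<notin> T \<longrightarrow> y x = 0)) \<and>
     (\<lambda>_. 0) \<in> Y \<and>
     (\<forall>y\<in>Y. \<forall>z\<in>Y. (\<lambda>x. y x + z x) \<in> Y) \<and>
     (\<forall>y\<in>Y. \<forall>c. (\<lambda>x. c * y x) \<in> Y) \<and>
     (\<forall>y\<in>Y. N y \<ge> 0 \<and> (N y = 0 \<longleftrightarrow> y = (\<lambda>_. 0))) \<and>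
     (\<forall>y\<in>Y. \<forall>c. N (\<lambda>x. c * y x) = \<bar>c\<bar> * N y) \<and>
     (\<forall>y\<in>Y. \<forall>z\<in>Y. N (\<lambda>x. y x + z x) \<le> N y + N z) \<and>
     (\<forall>s. (\<forall>k. s k \<in> Y) \<and> (\<forall>e>0. \<exists>k0. \<forall>i\<ge>k0. \<forall>j\<ge>k0. N (\<lambda>x. s i x - s j x) < e) \<longrightarrow>
        (\<exists>y\<in>Y. (\<lambda>k. N (\<lambda>x. s k x - y x)) \<longlonglongrightarrow> 0)) \<and>
     (\<forall>x\<in>T. \<exists>c. \<forall>y\<in>Y. \<bar>y x\<bar> \<le> c * N y)"

definition open_in_norm ::
    "('h \<Rightarrow> real) set \<Rightarrow> (('h \<Rightarrow> real) \<Rightarrow> real) \<Rightarrow> ('h \<Rightarrow> real) set \<Rightarrow> bool" where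
  "open_in_norm Y N V \<longleftrightarrow>
     V \<subseteq> Y \<and> (\<forall>y\<in>V. \<exists>e>0. \<forall>z\<in>Y. N (\<lambda>x. z x - y x) < e \<longrightarrow> z \<in> V)"


section \<open>Posterior, well-posedness and contraction\<close>

definition post_weight ::
    "('h::real_inner \<Rightarrow> 'h) \<Rightarrow> ('h \<Rightarrow> 'h) \<Rightarrow> nat \<Rightarrow> ('h \<Rightarrow> real) \<Rightarrow> 'h \<Rightarrow> real" where
  "post_weight G \<zeta> n y u =
     exp (- (real n / 2) * zeta_inner \<zeta> (G u) (G u) + real n * y (G u))"

definition posterior ::
    "'h::real_inner measure \<Rightarrow> ('h \<Rightarrow> 'h) \<Rightarrow> ('h \<Rightarrow> 'h) \<Rightarrow> nat \<Rightarrow> ('h \<Rightarrow> real) \<Rightarrow> 'h measure" where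
  "posterior \<mu> G \<zeta> n y =
     density \<mu> (\<lambda>u. ennreal (post_weight G \<zeta> n y u / (\<integral>v. post_weight G \<zeta> n y v \<partial>\<mu>)))"

definition hellinger_dist :: "'a measure \<Rightarrow> 'a measure \<Rightarrow> 'a measure \<Rightarrow> real" where
  "hellinger_dist m \<nu> \<nu>' =
     sqrt (1 / 2 * (\<integral>u. (sqrt (enn2real (RN_deriv m \<nu> u)) - sqrt (enn2real (RN_deriv m \<nu>' u)))\<^sup>2 \<partial>m))"

text \<open>Well-posedness for one \<open>n\<close>, with prior \<open>\<mu>\<close>, and \<open>U\<close> a \<open>\<mu>\<close>-distributed random element
  independent of \<open>\<eta>\<close>. The prior serves as the common dominating measure of the posteriors.\<close>

definition well_posed ::
    "'w measure \<Rightarrow> ('h::{real_inner,banach,second_countable_topology} \<Rightarrow> 'w \<Rightarrow> real) \<Rightarrow>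
      ('h \<Rightarrow> 'h) \<Rightarrow> ('h \<Rightarrow> 'h) \<Rightarrow> 'h measure \<Rightarrow> ('w \<Rightarrow> 'h) \<Rightarrow> nat \<Rightarrow> bool" where
  "well_posed M \<eta> \<zeta> G \<mu> U n \<longleftrightarrow>
     (\<exists>Y N. banach_space_of_functionals (range G) Y N \<and>
        (\<exists>L. is_realisation M G \<zeta> (data_process \<eta> n (\<lambda>\<omega>. G (U \<omega>))) L \<and>
             (AE \<omega> in M. L \<omega> \<in> Y) \<and>
             (\<forall>V. open_in_norm Y N V \<longrightarrow> {\<omega> \<in> space M. L \<omega> \<in> V} \<in> sets M)) \<and>
        (\<forall>y\<in>Y. integrable \<mu> (post_weight G \<zeta> n y) \<and> prob_space (posterior \<mu> G \<zeta> n y)) \<and>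
        (\<forall>y\<in>Y. \<forall>\<epsilon>>0. \<exists>d>0. \<forall>z\<in>Y. N (\<lambda>x. z x - y x) < d \<longrightarrow>
           hellinger_dist \<mu> (posterior \<mu> G \<zeta> n z) (posterior \<mu> G \<zeta> n y) < \<epsilon>))"

text \<open>\<open>y = G u0 + \<eta> / sqrt n\<close> has law \<open>Q\<^bsub>u0,n\<^esub>\<close>. The sequence \<open>L n\<close> runs over all realisations of
  these data; that one exists is part of the definition, so the limit is not vacuous.\<close>

definition contraction_rate ::
    "'w measure \<Rightarrow> ('h::{real_inner,banach,second_countable_topology} \<Rightarrow> 'w \<Rightarrow> real) \<Rightarrow>
      ('h \<Rightarrow> 'h) \<Rightarrow> ('h \<Rightarrow> 'h) \<Rightarrow> (nat \<Rightarrow> 'h measure) \<Rightarrow> 'h \<Rightarrow> (nat \<Rightarrow> real) \<Rightarrow> bool" where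
  "contraction_rate M \<eta> \<zeta> G \<mu> u0 \<xi> \<longleftrightarrow>
     (let data = (\<lambda>L. \<forall>n\<ge>1. is_realisation M G \<zeta> (data_process \<eta> n (\<lambda>_. G u0)) (L n))
      in (\<exists>L. data L) \<and>
         (\<exists>c>0. \<forall>L. data L \<longrightarrow>
            (\<forall>\<epsilon>>0. (\<lambda>n. measure M {\<omega> \<in> space M.
               measure (posterior (\<mu> n) G \<zeta> n (L n \<omega>)) {u. norm (u - u0) > c * \<xi> n} > \<epsilon>})
                 \<longlonglongrightarrow> 0)))"

end

theory Submission
  imports Defs "HOL-Complex_Analysis.Complex_Analysis" "HOL-Real_Asymp.Real_Asymp"
begin

text \<open>Put \<open>B = (C\<^sup>-\<^sup>r + K1)\<^sup>-\<^sup>1\<close>, so that \<open>\<zeta>\<^sup>1\<^sup>/\<^sup>2 = B\<close>, and \<open>T = B\<^sup>-\<^sup>1 G\<close>. Since \<open>T\<close> maps the basis to a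
  summable sequence, \<open>T* \<zeta>\<^sup>-\<^sup>1\<^sup>/\<^sup>2 \<eta>\<close> is an H-valued Gaussian variable \<open>V\<close> with covariance \<open>T* T\<close>. Hence
  the data live in a copy of H: \<open>\<langle>y, G u\<rangle>\<^sub>\<zeta> = v \<bullet> u\<close> with \<open>v = T* T u0 + n\<^sup>-\<^sup>1\<^sup>/\<^sup>2 V\<close>, and the posterior density
  \<open>exp (- n |T u|\<^sup>2 / 2 + n v \<bullet> u)\<close> depends continuously on \<open>v\<close>.

  The variance of the posterior around its mean \<open>m\<close> is at most that of the prior, \<open>trace C / R\<^sub>n\<^sup>2\<close>, and so
  is the mean square of the noise part of \<open>m\<close>; both are negligible against \<open>\<xi>\<^sub>n\<^sup>2\<close>. The bias of \<open>m\<close> is that of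
  Tikhonov regularisation. As \<open>|T z|\<close> is comparable to the norm of \<open>(\<lambda>\<^sub>j\<^sup>-\<^sup>r exp (- j\<^sup>\<beta>) z\<^sub>j)\<^sub>j\<close>, an energy
  estimate compares it with the bias of the diagonal problem, in which exactly the modes with \<open>j\<close> below
  a multiple of \<open>(ln n)\<^sup>1\<^sup>/\<^sup>\<beta>\<close> are recovered; the smoothness of \<open>u0\<close> then gives the rate.\<close>

section \<open>Orthonormal bases and diagonal operators\<close>

text \<open>The perturbations \<open>K1\<close> and \<open>K2\<close> need not commute with the
  covariance, so \<open>T\<close> and the prior have in general no common eigenbasis and nothing can
  be computed mode by mode. What survives is the two-sided norm bound \<open>T_bounds\<close>.
  Equivalence of norms says nothing about single coordinates of a regularised inverse; this forces
  the variational treatment of the bias.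

  The posterior is never identified as a Gaussian measure. Its characteristic functions are only
  bounded from below, and second moments are read off from them. Integrals of cosines are preferred
  throughout because cosines are bounded and Lipschitz: they pass through L1 limits and Fubini
  without moment conditions.

  Crude variance bounds are affordable because the prior is already narrow:
  \<open>R_n^2 = n^(1 - 2 sigma)\<close> makes its trace a negative power of n, while the rate is a
  power of ln n. The bias alone sets the rate. In mode i the ratio of data to prior precision is
  \<open>n^(2 sigma) i^q exp (-2 i^beta)\<close>, where \<open>n^(2 sigma) = n / R_n^2\<close>; it
  passes through 1 near \<open>i = (sigma ln n)^(1/beta)\<close>.

  The noise is only a family of real variables indexed by H, so an L1 extension precedes
  \<open>V\<close>.\<close>

definition proj :: "(nat \<Rightarrow> 'h::real_inner) \<Rightarrow> nat \<Rightarrow> 'h \<Rightarrow> 'h" where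
  "proj \<phi> N x = (\<Sum>j<N. (x \<bullet> \<phi> j) *\<^sub>R \<phi> j)"

lemma onb_inner: "orthonormal_basis \<phi> \<Longrightarrow> \<phi> i \<bullet> \<phi> j = (if i = j then 1 else 0)"
  by (simp add: orthonormal_basis_def)

lemma onb_norm [simp]: "orthonormal_basis \<phi> \<Longrightarrow> norm (\<phi> i) = 1"
  by (simp add: onb_inner norm_eq_sqrt_inner)

lemma inner_sum_onb:
  assumes "orthonormal_basis \<phi>" "finite A"
  shows "(\<Sum>j\<in>A. c j *\<^sub>R \<phi> j) \<bullet> \<phi> i = (if i \<in> A then c i else 0)"
proof -
  have "(\<Sum>j\<in>A. c j *\<^sub>R \<phi> j) \<bullet> \<phi> i = (\<Sum>j\<in>A. if j = i then c j else 0)"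
    by (simp add: inner_sum_left onb_inner[OF assms(1)] if_distrib cong: if_cong)
  then show ?thesis using assms(2) by simp
qed

lemma norm_sum_onb:
  assumes "orthonormal_basis \<phi>" "finite A"
  shows "(norm (\<Sum>j\<in>A. c j *\<^sub>R \<phi> j))\<^sup>2 = (\<Sum>j\<in>A. (c j)\<^sup>2)"
proof -
  have "(norm (\<Sum>j\<in>A. c j *\<^sub>R \<phi> j))\<^sup>2 = (\<Sum>i\<in>A. c i * ((\<Sum>j\<in>A. c j *\<^sub>R \<phi> j) \<bullet> \<phi> i))"
    by (simp only: power2_norm_eq_inner inner_sum_right inner_scaleR_right)
  also have "\<dots> = (\<Sum>i\<in>A. c i * c i)"
    by (intro sum.cong refl) (simp only: inner_sum_onb[OF assms], simp)
  finally show ?thesis by (simp add: power2_eq_square)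
qed

lemma proj_add: "proj \<phi> N (x + y) = proj \<phi> N x + proj \<phi> N y"
  by (simp add: proj_def inner_add_left scaleR_add_left sum.distrib)

lemma proj_diff: "proj \<phi> N (x - y) = proj \<phi> N x - proj \<phi> N y"
  by (simp add: proj_def inner_diff_left scaleR_diff_left sum_subtractf)

lemma proj_scaleR: "proj \<phi> N (c *\<^sub>R x) = c *\<^sub>R proj \<phi> N x"
  by (simp add: proj_def scaleR_sum_right)

lemma proj_orthogonal:
  assumes "orthonormal_basis \<phi>"
  shows "(x - proj \<phi> N x) \<bullet> proj \<phi> N x = 0"
proof -
  have "(x - proj \<phi> N x) \<bullet> \<phi> j = 0" if "j < N" for j
    using that by (simp add: inner_diff_left proj_def inner_sum_onb[OF assms])
  then show ?thesis by (subst (2) proj_def) (simp add: inner_sum_right)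
qed

lemma norm_diff_proj_le:
  assumes "orthonormal_basis \<phi>"
  shows "norm (x - proj \<phi> N x) \<le> norm x"
proof -
  have "(norm x)\<^sup>2 = (norm (x - proj \<phi> N x))\<^sup>2 + (norm (proj \<phi> N x))\<^sup>2"
    using proj_orthogonal[OF assms, of x N]
    by (simp add: power2_norm_eq_inner inner_diff_left inner_diff_right inner_commute)
  then have "(norm (x - proj \<phi> N x))\<^sup>2 \<le> (norm x)\<^sup>2" by simp
  then show ?thesis by (rule power2_le_imp_le) simp
qed

lemma proj_span:
  assumes "orthonormal_basis \<phi>" "y \<in> span (range \<phi>)"
  shows "\<exists>N0. \<forall>N\<ge>N0. proj \<phi> N y = y"
  using assms(2)
proof (induction rule: span_induct_alt)
  case base
  then show ?case by (simp add: proj_def)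
next
  case (step c x y)
  then obtain i N0 where i: "x = \<phi> i" and N0: "\<forall>N\<ge>N0. proj \<phi> N y = y" by auto
  have "proj \<phi> N x = x" if "N \<ge> Suc i" for N
  proof -
    have "proj \<phi> N x = (\<Sum>j<N. if j = i then \<phi> j else 0)"
      unfolding proj_def i by (intro sum.cong) (auto simp: onb_inner[OF assms(1)])
    then show ?thesis using that i by simp
  qed
  then have "\<forall>N\<ge>max N0 (Suc i). proj \<phi> N (c *\<^sub>R x + y) = c *\<^sub>R x + y"
    using N0 by (simp add: proj_add proj_scaleR)
  then show ?case by blast
qed

text \<open>Late projections fix any given element of the span, and \<open>1 - proj\<close> is a
  contraction; so the error at \<open>x\<close> is at most the distance from \<open>x\<close> to a
  nearby element of the span.\<close>

lemma proj_tendsto: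
  assumes "orthonormal_basis \<phi>"
  shows "(\<lambda>N. proj \<phi> N x) \<longlonglongrightarrow> x"
proof (rule LIMSEQ_I)
  fix e :: real assume e: "e > 0"
  have "x \<in> closure (span (range \<phi>))" using assms by (simp add: orthonormal_basis_def)
  then obtain y where y: "y \<in> span (range \<phi>)" "dist y x < e"
    using e by (auto simp: closure_approachable)
  obtain N0 where N0: "\<forall>N\<ge>N0. proj \<phi> N y = y" using proj_span[OF assms y(1)] by auto
  have "norm (proj \<phi> N x - x) < e" if "N \<ge> N0" for N
  proof -
    have "norm (proj \<phi> N x - x) = norm ((x - y) - proj \<phi> N (x - y))"
      using N0 that by (simp add: proj_diff norm_minus_commute)
    also have "\<dots> \<le> norm (x - y)" by (rule norm_diff_proj_le[OF assms])
    finally show ?thesis using y(2) by (simp add: dist_norm norm_minus_commute)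
  qed
  then show "\<exists>no. \<forall>n\<ge>no. norm (proj \<phi> n x - x) < e" by blast
qed

lemma onb_expansion:
  assumes "orthonormal_basis \<phi>"
  shows "(\<lambda>j. (x \<bullet> \<phi> j) *\<^sub>R \<phi> j) sums x"
  using proj_tendsto[OF assms, of x] by (simp add: sums_def proj_def)

lemma onb_inner_sums:
  assumes "orthonormal_basis \<phi>"
  shows "(\<lambda>j. (x \<bullet> \<phi> j) * (y \<bullet> \<phi> j)) sums (x \<bullet> y)"
  using bounded_linear.sums[OF bounded_linear_inner_left[of y] onb_expansion[OF assms, of x]]
  by (simp add: inner_commute)

lemma parseval:
  assumes "orthonormal_basis \<phi>"
  shows "(\<lambda>j. (x \<bullet> \<phi> j)\<^sup>2) sums (norm x)\<^sup>2"
  using onb_inner_sums[OF assms, of x x] by (simp add: power2_eq_square power2_norm_eq_inner[unfolded power2_eq_square])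

lemma norm_square_eq_suminf:
  assumes "orthonormal_basis \<phi>"
  shows "(norm x)\<^sup>2 = (\<Sum>j. (x \<bullet> \<phi> j)\<^sup>2)" "summable (\<lambda>j. (x \<bullet> \<phi> j)\<^sup>2)"
  using parseval[OF assms, of x] by (auto simp: sums_iff)

lemma onb_eqI:
  assumes "orthonormal_basis \<phi>" "\<And>j. x \<bullet> \<phi> j = y \<bullet> \<phi> j"
  shows "x = y"
  using onb_expansion[OF assms(1), of x] onb_expansion[OF assms(1), of y] assms(2)
  by (simp add: sums_unique2)

lemma norm_le_componentwise:
  assumes onb: "orthonormal_basis \<phi>" and le: "\<And>j. \<bar>x \<bullet> \<phi> j\<bar> \<le> \<bar>y \<bullet> \<phi> j\<bar>"
  shows "norm x \<le> norm y"
proof -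
  have "(norm x)\<^sup>2 \<le> (norm y)\<^sup>2"
    using sums_le[OF _ parseval[OF onb, of x] parseval[OF onb, of y]] le
    by (simp add: abs_le_square_iff)
  then show ?thesis by simp
qed

lemma riesz_fischer:
  fixes \<phi> :: "nat \<Rightarrow> 'h::{real_inner,banach}"
  assumes onb: "orthonormal_basis \<phi>" and c: "summable (\<lambda>j. (c j)\<^sup>2)"
  shows "summable (\<lambda>j. c j *\<^sub>R \<phi> j)" and "(\<Sum>j. c j *\<^sub>R \<phi> j) \<bullet> \<phi> i = c i"
proof -
  show s: "summable (\<lambda>j. c j *\<^sub>R \<phi> j)"
    unfolding summable_Cauchy
  proof (intro allI impI)
    fix e :: real assume e: "e > 0"
    then obtain N where N: "\<And>m n. m \<ge> N \<Longrightarrow> norm (\<Sum>j=m..<n. (c j)\<^sup>2) < e\<^sup>2"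
      using c[unfolded summable_Cauchy, rule_format, of "e\<^sup>2"] by auto
    have "norm (\<Sum>j=m..<n. c j *\<^sub>R \<phi> j) < e" if "m \<ge> N" for m n
    proof -
      have "(norm (\<Sum>j=m..<n. c j *\<^sub>R \<phi> j))\<^sup>2 < e\<^sup>2"
        using N[OF that, of n] by (subst norm_sum_onb[OF onb]) auto
      then show ?thesis using e by (simp add: power_less_imp_less_base)
    qed
    then show "\<exists>N. \<forall>m\<ge>N. \<forall>n. norm (\<Sum>j=m..<n. c j *\<^sub>R \<phi> j) < e" by blast
  qed
  have "(\<lambda>j. (c j *\<^sub>R \<phi> j) \<bullet> \<phi> i) sums ((\<Sum>j. c j *\<^sub>R \<phi> j) \<bullet> \<phi> i)"
    by (intro bounded_linear.sums[OF bounded_linear_inner_left] summable_sums s)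
  moreover have "(\<lambda>j. (c j *\<^sub>R \<phi> j) \<bullet> \<phi> i) = (\<lambda>j. if j = i then c j else 0)"
    by (auto simp: onb_inner[OF onb])
  moreover have "(\<lambda>j. if j = i then c j else 0) sums c i" by (rule sums_single)
  ultimately show "(\<Sum>j. c j *\<^sub>R \<phi> j) \<bullet> \<phi> i = c i" by (simp add: sums_unique2)
qed

text \<open>\<open>eig_op\<close> is a bare \<open>suminf\<close> and has the expected coefficients
  where the series converges; hence the domain condition that accompanies every unbounded
  \<open>a\<close>.\<close>

lemma eig_op_inner:
  fixes \<phi> :: "nat \<Rightarrow> 'h::{real_inner,banach}"
  assumes "orthonormal_basis \<phi>" "x \<in> eig_dom \<phi> a"
  shows "eig_op \<phi> a x \<bullet> \<phi> j = a j * (x \<bullet> \<phi> j)"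
  using riesz_fischer(2)[OF assms(1), of "\<lambda>j. a j * (x \<bullet> \<phi> j)"] assms(2)
  by (simp add: eig_op_def eig_dom_def)

lemma summable_square_add:
  fixes f g :: "nat \<Rightarrow> real"
  assumes "summable (\<lambda>j. (f j)\<^sup>2)" "summable (\<lambda>j. (g j)\<^sup>2)"
  shows "summable (\<lambda>j. (f j + g j)\<^sup>2)"
proof (rule summable_comparison_test')
  show "summable (\<lambda>j. 2 * (f j)\<^sup>2 + 2 * (g j)\<^sup>2)" by (intro summable_add summable_mult assms)
  show "norm ((f n + g n)\<^sup>2) \<le> 2 * (f n)\<^sup>2 + 2 * (g n)\<^sup>2" for n
    using sum_squares_bound[of "f n" "g n"] zero_le_power2[of "f n + g n"] by (simp add: power2_sum)
qed

lemma eig_dom_add: "x \<in> eig_dom \<phi> a \<Longrightarrow> y \<in> eig_dom \<phi> a \<Longrightarrow> x + y \<in> eig_dom \<phi> a"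
  unfolding eig_dom_def by (simp add: inner_add_left distrib_left summable_square_add)

lemma eig_dom_scaleR: "x \<in> eig_dom \<phi> a \<Longrightarrow> c *\<^sub>R x \<in> eig_dom \<phi> a"
  using summable_mult[of "\<lambda>j. (a j * (x \<bullet> \<phi> j))\<^sup>2" "c\<^sup>2"]
  unfolding eig_dom_def by (simp add: power_mult_distrib mult_ac)

lemma eig_dom_diff: "x \<in> eig_dom \<phi> a \<Longrightarrow> y \<in> eig_dom \<phi> a \<Longrightarrow> x - y \<in> eig_dom \<phi> a"
  using eig_dom_add[of x \<phi> a "(-1) *\<^sub>R y"] eig_dom_scaleR[of y \<phi> a "-1"] by simp

lemma eig_dom_mono:
  assumes "x \<in> eig_dom \<phi> a" "\<And>j. \<bar>b j\<bar> \<le> c * \<bar>a j\<bar>"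
  shows "x \<in> eig_dom \<phi> b"
  unfolding eig_dom_def
proof (safe, rule summable_comparison_test')
  show "summable (\<lambda>j. c\<^sup>2 * (a j * (x \<bullet> \<phi> j))\<^sup>2)"
    using assms(1) by (intro summable_mult) (simp add: eig_dom_def)
  have "(b n)\<^sup>2 \<le> (c * a n)\<^sup>2" for n
  proof -
    have "\<bar>b n\<bar>\<^sup>2 \<le> (c * \<bar>a n\<bar>)\<^sup>2" using assms(2)[of n] by (intro power_mono) auto
    then show ?thesis by (simp add: power_mult_distrib)
  qed
  then show "norm ((b n * (x \<bullet> \<phi> n))\<^sup>2) \<le> c\<^sup>2 * (a n * (x \<bullet> \<phi> n))\<^sup>2" for n
    by (simp add: power_mult_distrib mult_right_mono flip: mult.assoc)
qed

lemma eig_op_linear_on: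
  fixes \<phi> :: "nat \<Rightarrow> 'h::{real_inner,banach}"
  assumes onb: "orthonormal_basis \<phi>" and x: "x \<in> eig_dom \<phi> a" and y: "y \<in> eig_dom \<phi> a"
  shows "eig_op \<phi> a (x + y) = eig_op \<phi> a x + eig_op \<phi> a y"
    and "eig_op \<phi> a (x - y) = eig_op \<phi> a x - eig_op \<phi> a y"
    and "eig_op \<phi> a (c *\<^sub>R x) = c *\<^sub>R eig_op \<phi> a x"
  by (rule onb_eqI[OF onb];
      simp add: eig_op_inner[OF onb] eig_dom_add eig_dom_diff eig_dom_scaleR x y inner_add_left
        inner_diff_left distrib_left right_diff_distrib)+

lemma eig_dom_bounded:
  assumes onb: "orthonormal_basis \<phi>" and "\<And>j. \<bar>a j\<bar> \<le> c"
  shows "x \<in> eig_dom \<phi> a"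
proof -
  have "x \<in> eig_dom \<phi> (\<lambda>_. 1)" using norm_square_eq_suminf(2)[OF onb] by (simp add: eig_dom_def)
  then show ?thesis by (rule eig_dom_mono[where c = c]) (use assms(2) in auto)
qed

lemma eig_op_bounded_inner:
  fixes \<phi> :: "nat \<Rightarrow> 'h::{real_inner,banach}"
  assumes onb: "orthonormal_basis \<phi>" and a: "\<And>j. \<bar>a j\<bar> \<le> c"
  shows "eig_op \<phi> a x \<bullet> \<phi> j = a j * (x \<bullet> \<phi> j)"
  by (rule eig_op_inner[OF onb eig_dom_bounded[OF onb a]])

lemma eig_op_basis:
  fixes \<phi> :: "nat \<Rightarrow> 'h::{real_inner,banach}"
  assumes onb: "orthonormal_basis \<phi>"
  shows "\<phi> i \<in> eig_dom \<phi> a" "eig_op \<phi> a (\<phi> i) = a i *\<^sub>R \<phi> i"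
proof -
  have "(\<lambda>j. (a j * (\<phi> i \<bullet> \<phi> j))\<^sup>2) = (\<lambda>j. if j = i then (a j)\<^sup>2 else 0)"
    by (auto simp: onb_inner[OF onb])
  then show d: "\<phi> i \<in> eig_dom \<phi> a"
    using sums_summable[OF sums_single[of i "\<lambda>j. (a j)\<^sup>2"]] by (simp add: eig_dom_def)
  show "eig_op \<phi> a (\<phi> i) = a i *\<^sub>R \<phi> i"
    by (rule onb_eqI[OF onb]) (simp add: eig_op_inner[OF onb d] onb_inner[OF onb])
qed

lemma eig_op_bounded:
  fixes \<phi> :: "nat \<Rightarrow> 'h::{real_inner,banach}"
  assumes onb: "orthonormal_basis \<phi>" and a: "\<And>j. \<bar>a j\<bar> \<le> c"
  shows "bounded_linear (eig_op \<phi> a)" and "self_adjoint (eig_op \<phi> a)"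
    and "norm (eig_op \<phi> a x) \<le> c * norm x"
proof -
  note dom = eig_dom_bounded[OF onb a]
  have c: "c \<ge> 0" using a[of 0] by linarith
  have bd: "norm (eig_op \<phi> a x) \<le> c * norm x" for x
  proof -
    have "norm (eig_op \<phi> a x) \<le> norm (c *\<^sub>R x)"
      by (rule norm_le_componentwise[OF onb])
        (simp add: eig_op_inner[OF onb dom] abs_mult mult_right_mono a abs_of_nonneg[OF c])
    then show ?thesis using c by simp
  qed
  then show "norm (eig_op \<phi> a x) \<le> c * norm x" .
  show "bounded_linear (eig_op \<phi> a)"
    by (rule bounded_linear_intro[where K = c])
      (use bd in \<open>auto simp: eig_op_linear_on[OF onb dom dom] mult.commute\<close>)
  show "self_adjoint (eig_op \<phi> a)"
    unfolding self_adjoint_def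
  proof (intro allI)
    fix x y
    show "eig_op \<phi> a x \<bullet> y = x \<bullet> eig_op \<phi> a y"
      using onb_inner_sums[OF onb, of "eig_op \<phi> a x" y] onb_inner_sums[OF onb, of x "eig_op \<phi> a y"]
      by (simp add: eig_op_inner[OF onb dom] mult_ac sums_unique2)
  qed
qed

section \<open>Inverses of positive perturbations of diagonal operators\<close>

lemma self_adjointD: "self_adjoint T \<Longrightarrow> T x \<bullet> y = x \<bullet> T y"
  by (simp add: self_adjoint_def)

text \<open>The Lax-Milgram argument: the damped iteration \<open>x - t *\<^sub>R (T x - y)\<close>
  is a contraction for suitable \<open>t\<close>, and its fixed point solves the equation.\<close>

lemma coercive_surj:
  fixes T :: "'h::{real_inner,banach} \<Rightarrow> 'h"
  assumes T: "bounded_linear T" and c: "c > 0" and pos: "\<And>x. T x \<bullet> x \<ge> c * (norm x)\<^sup>2"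
  shows "\<exists>x. T x = y"
proof -
  interpret T: bounded_linear T by fact
  obtain L where L: "L > 0" "\<And>x. norm (T x) \<le> norm x * L" using T.pos_bounded by auto
  \<comment> \<open>The maximum with \<open>c\<close> forces \<open>c / L' \<le> 1\<close>, so that
    \<open>k\<close> below is the root of a nonnegative number.\<close>
  define L' where "L' = max L c"
  have L': "L' > 0" "L' \<ge> c" and L'b: "norm (T x) \<le> L' * norm x" for x
    using L c L(2)[of x] mult_right_mono[of L "max L c" "norm x"]
    by (auto simp: L'_def mult.commute less_max_iff_disj intro: order_trans)
  \<comment> \<open>This minimises \<open>1 - 2 * t * c + t^2 * L'^2\<close>, which bounds the
    squared contraction factor; the minimum is \<open>1 - (c / L')^2\<close>.\<close>
  define t where "t = c / L'\<^sup>2"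
  define k where "k = sqrt (1 - (c / L')\<^sup>2)"
  have cl: "0 < c / L'" "c / L' \<le> 1" using c L' by auto
  then have "0 < (c / L')\<^sup>2" "(c / L')\<^sup>2 \<le> 1" by (auto simp: power_le_one)
  then have k: "0 \<le> k" "k < 1" by (auto simp: k_def real_sqrt_lt_1_iff)
  have t: "t > 0" using c L' by (simp add: t_def)
  have contr: "norm (x - t *\<^sub>R T x) \<le> k * norm x" for x
  proof -
    have "(norm (x - t *\<^sub>R T x))\<^sup>2 = (norm x)\<^sup>2 - 2 * t * (T x \<bullet> x) + t\<^sup>2 * (norm (T x))\<^sup>2"
      unfolding power2_norm_eq_inner
      by (simp add: inner_diff_left inner_diff_right inner_commute power2_eq_square algebra_simps)
    also have "\<dots> \<le> (norm x)\<^sup>2 - 2 * t * (c * (norm x)\<^sup>2) + t\<^sup>2 * (L' * norm x)\<^sup>2"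
      using pos[of x] t L'b[of x] by (intro add_mono diff_mono mult_left_mono power_mono) auto
    also have "\<dots> = (1 - (c / L')\<^sup>2) * (norm x)\<^sup>2"
      using L' by (simp add: t_def field_simps power2_eq_square)
    also have "\<dots> = (k * norm x)\<^sup>2"
      using \<open>(c / L')\<^sup>2 \<le> 1\<close> by (simp add: k_def power_mult_distrib)
    finally show ?thesis using k by (simp add: power2_le_iff_abs_le)
  qed
  have "\<exists>!x. x - t *\<^sub>R (T x - y) = x"
  proof (rule banach_fix_type[OF k(1,2)], intro allI)
    fix x z
    have "dist (x - t *\<^sub>R (T x - y)) (z - t *\<^sub>R (T z - y)) = norm ((x - z) - t *\<^sub>R T (x - z))"
      by (simp add: dist_norm T.diff algebra_simps)
    also have "\<dots> \<le> k * dist x z" using contr by (simp add: dist_norm)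
    finally show "dist (x - t *\<^sub>R (T x - y)) (z - t *\<^sub>R (T z - y)) \<le> k * dist x z" .
  qed
  then obtain x where "x - t *\<^sub>R (T x - y) = x" by auto
  then have "T x = y" using t by simp
  then show ?thesis by blast
qed

text \<open>Serves both unbounded operators of the model, the one behind \<open>forward_op\<close>
  (with \<open>K2\<close>) and the one behind \<open>noise_cov\<close> (with \<open>K1\<close>).
  Eigenvalues at least 1 give coercivity with constant 1, so the inverse \<open>J\<close> is a
  contraction, as the square root argument requires.\<close>

locale perturbed_diagonal =
  fixes \<phi> :: "nat \<Rightarrow> 'h::{real_inner,banach}" and a :: "nat \<Rightarrow> real" and K :: "'h \<Rightarrow> 'h"
  assumes onb: "orthonormal_basis \<phi>"
    and a_ge1: "\<And>j. a j \<ge> 1"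
    and K_bl: "bounded_linear K" and K_sa: "self_adjoint K" and K_pos: "positive_op K"
begin

sublocale K: bounded_linear K by (rule K_bl)

definition Op :: "'h \<Rightarrow> 'h" where "Op x = eig_op \<phi> a x + K x"

definition J :: "'h \<Rightarrow> 'h" where "J = inv_into (eig_dom \<phi> a) Op"

lemma Op_add: "x \<in> eig_dom \<phi> a \<Longrightarrow> y \<in> eig_dom \<phi> a \<Longrightarrow> Op (x + y) = Op x + Op y"
  by (simp add: Op_def eig_op_linear_on[OF onb] K.add)

lemma Op_diff: "x \<in> eig_dom \<phi> a \<Longrightarrow> y \<in> eig_dom \<phi> a \<Longrightarrow> Op (x - y) = Op x - Op y"
  by (simp add: Op_def eig_op_linear_on[OF onb] K.diff)

lemma Op_scaleR: "x \<in> eig_dom \<phi> a \<Longrightarrow> Op (c *\<^sub>R x) = c *\<^sub>R Op x"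
  by (simp add: Op_def eig_op_linear_on[OF onb] K.scaleR scaleR_add_right)

lemma Op_sym:
  assumes "x \<in> eig_dom \<phi> a" "y \<in> eig_dom \<phi> a"
  shows "Op x \<bullet> y = x \<bullet> Op y"
proof -
  have "eig_op \<phi> a x \<bullet> y = x \<bullet> eig_op \<phi> a y"
    using onb_inner_sums[OF onb, of "eig_op \<phi> a x" y] onb_inner_sums[OF onb, of x "eig_op \<phi> a y"]
    by (simp add: eig_op_inner[OF onb] assms mult_ac sums_unique2)
  then show ?thesis using self_adjointD[OF K_sa] by (simp add: Op_def inner_add_left inner_add_right)
qed

lemma Op_coercive:
  assumes "x \<in> eig_dom \<phi> a"
  shows "Op x \<bullet> x \<ge> (norm x)\<^sup>2"
proof -
  have "(norm x)\<^sup>2 \<le> eig_op \<phi> a x \<bullet> x"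
  proof (rule sums_le[OF _ parseval[OF onb, of x] onb_inner_sums[OF onb]])
    fix j
    have "1 * (x \<bullet> \<phi> j)\<^sup>2 \<le> a j * (x \<bullet> \<phi> j)\<^sup>2" by (intro mult_right_mono a_ge1) auto
    then show "(x \<bullet> \<phi> j)\<^sup>2 \<le> (eig_op \<phi> a x \<bullet> \<phi> j) * (x \<bullet> \<phi> j)"
      by (simp add: eig_op_inner[OF onb assms] power2_eq_square)
  qed
  moreover have "K x \<bullet> x \<ge> 0" using K_pos by (simp add: positive_op_def)
  ultimately show ?thesis by (simp add: Op_def inner_add_left)
qed

lemma norm_le_Op: "x \<in> eig_dom \<phi> a \<Longrightarrow> norm x \<le> norm (Op x)"
proof -
  assume "x \<in> eig_dom \<phi> a"
  then have "norm x * norm x \<le> norm (Op x) * norm x"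
    using Op_coercive[of x] norm_cauchy_schwarz[of "Op x" x] by (simp add: power2_eq_square)
  then show ?thesis by (cases "norm x = 0") (auto simp: mult_le_cancel_right)
qed

lemma Op_inj: "inj_on Op (eig_dom \<phi> a)"
proof (rule inj_onI)
  fix x y assume xy: "x \<in> eig_dom \<phi> a" "y \<in> eig_dom \<phi> a" "Op x = Op y"
  have "norm (x - y) \<le> norm (Op (x - y))" by (intro norm_le_Op eig_dom_diff xy)
  then show "x = y" using xy by (simp add: Op_diff)
qed

text \<open>With \<open>S = a powr (-1/2)\<close> the equation \<open>Op x = y\<close> becomes \<open>(1 + S K S) w = S y\<close>, \<open>x = S w\<close>,
  whose operator is bounded and coercive.\<close>

lemma Op_surj: "\<exists>x\<in>eig_dom \<phi> a. Op x = y"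
proof -
  define s where "s j = 1 / sqrt (a j)" for j
  have a0: "a j > 0" for j using a_ge1[of j] by linarith
  have s: "\<bar>s j\<bar> \<le> 1" for j using a_ge1[of j] by (simp add: s_def divide_le_eq_1)
  have sa: "a j * s j * s j = 1" for j using a0[of j] by (simp add: s_def field_simps)
  let ?S = "eig_op \<phi> s"
  note S_bl = eig_op_bounded(1)[OF onb s] and S_sa = eig_op_bounded(2)[OF onb s]
  have S_inner: "?S x \<bullet> \<phi> j = s j * (x \<bullet> \<phi> j)" for x j by (rule eig_op_bounded_inner[OF onb s])
  interpret S: bounded_linear ?S by (rule S_bl)
  have "\<exists>w. w + ?S (K (?S w)) = ?S y"
  proof (rule coercive_surj[where c = 1])
    show "bounded_linear (\<lambda>w. w + ?S (K (?S w)))"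
      by (intro bounded_linear_add bounded_linear_ident bounded_linear_compose[OF S_bl]
        bounded_linear_compose[OF K_bl])
    show "1 * (norm x)\<^sup>2 \<le> (x + ?S (K (?S x))) \<bullet> x" for x
      using K_pos by (simp add: inner_add_left self_adjointD[OF S_sa] power2_norm_eq_inner positive_op_def)
  qed simp
  then obtain w where w: "w + ?S (K (?S w)) = ?S y" by blast
  \<comment> \<open>\<open>w\<close> is itself \<open>S\<close> applied to
    \<open>y - K (S w)\<close>, so \<open>S w\<close> carries two factors
    \<open>a powr (-1/2)\<close> and multiplication by the unbounded \<open>a\<close> merely removes
    them. This also puts \<open>S w\<close> into the domain.\<close>
  have coef: "a j * (?S w \<bullet> \<phi> j) = (y - K (?S w)) \<bullet> \<phi> j" for j
  proof -
    have "?S (y - K (?S w)) = w" by (simp only: S.diff flip: w) simp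
    then have eq: "w \<bullet> \<phi> j = s j * ((y - K (?S w)) \<bullet> \<phi> j)" using S_inner[of "y - K (?S w)" j] by simp
    have "a j * (?S w \<bullet> \<phi> j) = (a j * s j * s j) * ((y - K (?S w)) \<bullet> \<phi> j)"
      by (simp only: S_inner eq mult.assoc)
    then show ?thesis by (simp only: sa mult_1)
  qed
  have dom: "?S w \<in> eig_dom \<phi> a"
    using norm_square_eq_suminf(2)[OF onb, of "y - K (?S w)"] by (simp add: eig_dom_def coef)
  have "eig_op \<phi> a (?S w) = y - K (?S w)"
    by (rule onb_eqI[OF onb]) (simp add: eig_op_inner[OF onb dom] coef)
  then show ?thesis using dom by (auto simp: Op_def intro!: bexI[of _ "?S w"])
qed

lemma J_dom: "J y \<in> eig_dom \<phi> a" and Op_J [simp]: "Op (J y) = y"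
proof -
  have "y \<in> Op ` eig_dom \<phi> a" using Op_surj[of y] by auto
  then show "J y \<in> eig_dom \<phi> a" "Op (J y) = y"
    unfolding J_def by (auto intro: inv_into_into f_inv_into_f)
qed

lemma J_Op [simp]: "x \<in> eig_dom \<phi> a \<Longrightarrow> J (Op x) = x"
  unfolding J_def by (rule inv_into_f_f[OF Op_inj])

lemma J_eqI: "x \<in> eig_dom \<phi> a \<Longrightarrow> Op x = y \<Longrightarrow> J y = x"
  by auto

lemma norm_J_le: "norm (J y) \<le> norm y"
  using norm_le_Op[OF J_dom[of y]] by simp

lemma J_bl: "bounded_linear J"
  by (rule bounded_linear_intro[where K = 1])
    (auto intro!: J_eqI eig_dom_add eig_dom_scaleR J_dom simp: Op_add Op_scaleR J_dom norm_J_le)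

lemma J_sa: "self_adjoint J"
  unfolding self_adjoint_def
proof (intro allI)
  fix x y
  show "J x \<bullet> y = x \<bullet> J y" using Op_sym[OF J_dom[of x] J_dom[of y]] by simp
qed

lemma J_pos: "positive_op J"
  unfolding positive_op_def
proof
  fix x
  show "0 \<le> J x \<bullet> x"
    using order_trans[OF zero_le_power2 Op_coercive[OF J_dom[of x]]] by (simp add: inner_commute)
qed

lemma J_inj: "inj J"
  by (rule injI) (metis Op_J)

lemma range_J: "range J = eig_dom \<phi> a"
proof
  show "range J \<subseteq> eig_dom \<phi> a" using J_dom by auto
  show "eig_dom \<phi> a \<subseteq> range J" using J_Op by (metis rangeI subsetI)
qed

end

section \<open>Uniqueness of positive square roots\<close>

text \<open>Each step with \<open>Q = 1 - B\<close> loses at least \<open>|B x|^2\<close> of the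
  squared norm, so the squares \<open>|B (Q^i z)|^2\<close> are summable and \<open>Q^i\<close>
  tends to 0 on the range of \<open>B\<close>. Density of the range and contractivity of
  \<open>Q^i\<close> extend this to every \<open>x\<close>.\<close>

lemma contraction_iterates_vanish:
  fixes B :: "'h::{real_inner,banach} \<Rightarrow> 'h"
  assumes B: "bounded_linear B" and sa: "self_adjoint B" and pos: "positive_op B"
    and le: "\<And>x. norm (B x) \<le> norm x" and dense: "closure (range B) = UNIV"
  shows "(\<lambda>k. ((\<lambda>x. x - B x) ^^ k) x) \<longlonglongrightarrow> 0"
proof -
  interpret B: bounded_linear B by fact
  let ?Q = "\<lambda>x. x - B x"
  \<comment> \<open>Positivity is used at \<open>x - B x\<close>; it gives the operator inequality
    \<open>B^2 \<le> B\<close> without any root of \<open>B\<close>.\<close>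
  have B2: "(norm (B x))\<^sup>2 \<le> B x \<bullet> x" for x
  proof -
    have "0 \<le> B (x - B x) \<bullet> (x - B x)" using pos by (simp add: positive_op_def)
    then have "0 \<le> B x \<bullet> x - 2 * (norm (B x))\<^sup>2 + B (B x) \<bullet> B x"
      using self_adjointD[OF sa, of x x] self_adjointD[OF sa, of "B x" x]
      by (simp add: B.diff inner_diff_left inner_diff_right power2_norm_eq_inner inner_commute)
    moreover have "B (B x) \<bullet> B x \<le> (norm (B x))\<^sup>2"
      using norm_cauchy_schwarz[of "B (B x)" "B x"] mult_right_mono[OF le[of "B x"], of "norm (B x)"]
      by (simp add: power2_eq_square)
    ultimately show ?thesis by linarith
  qed
  have step: "(norm (?Q x))\<^sup>2 \<le> (norm x)\<^sup>2 - (norm (B x))\<^sup>2" for x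
    using B2[of x]
    by (simp add: power2_norm_eq_inner inner_diff_left inner_diff_right inner_commute)
  have Qle: "norm (?Q x) \<le> norm x" for x
  proof -
    have "(norm (?Q x))\<^sup>2 \<le> (norm x)\<^sup>2" using step[of x] zero_le_power2[of "norm (B x)"] by linarith
    then show ?thesis by (rule power2_le_imp_le) simp
  qed
  have QB: "B ((?Q ^^ k) x) = (?Q ^^ k) (B x)" for k x by (induction k) (auto simp: B.diff)
  have Qdiff: "(?Q ^^ k) (x - y) = (?Q ^^ k) x - (?Q ^^ k) y" for k x y
  proof (induction k)
    case (Suc k)
    show ?case by (simp only: funpow.simps o_apply Suc.IH B.diff) simp
  qed simp
  have Qkle: "norm ((?Q ^^ k) x) \<le> norm x" for k x
    by (induction k) (auto intro: order_trans[OF Qle])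
  have Bz: "(\<lambda>k. (?Q ^^ k) (B z)) \<longlonglongrightarrow> 0" for z
  proof -
    have tele: "(\<Sum>i<k. (norm (B ((?Q ^^ i) z)))\<^sup>2) \<le> (norm z)\<^sup>2 - (norm ((?Q ^^ k) z))\<^sup>2" for k
    proof (induction k)
      case (Suc k)
      then show ?case using step[of "(?Q ^^ k) z"] by simp
    qed simp
    have "(\<Sum>i<k. (norm (B ((?Q ^^ i) z)))\<^sup>2) \<le> (norm z)\<^sup>2" for k
      using tele[of k] zero_le_power2[of "norm ((?Q ^^ k) z)"] by linarith
    then have "summable (\<lambda>i. (norm (B ((?Q ^^ i) z)))\<^sup>2)"
      by (intro summableI_nonneg_bounded) auto
    then have "(\<lambda>i. (norm (B ((?Q ^^ i) z)))\<^sup>2) \<longlonglongrightarrow> 0" by (rule summable_LIMSEQ_zero)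
    then have "(\<lambda>i. sqrt ((norm (B ((?Q ^^ i) z)))\<^sup>2)) \<longlonglongrightarrow> sqrt 0" by (intro tendsto_intros)
    then have "(\<lambda>i. norm (B ((?Q ^^ i) z))) \<longlonglongrightarrow> 0" by simp
    then have "(\<lambda>i. B ((?Q ^^ i) z)) \<longlonglongrightarrow> 0" by (simp add: tendsto_norm_zero_iff)
    then show ?thesis by (simp add: QB)
  qed
  show ?thesis
  proof (rule LIMSEQ_I)
    fix e :: real assume e: "e > 0"
    have "x \<in> closure (range B)" using dense by simp
    then obtain z where z: "dist (B z) x < e / 2"
      using e half_gt_zero[OF e] unfolding closure_approachable by blast
    obtain k0 where k0: "\<And>k. k \<ge> k0 \<Longrightarrow> norm ((?Q ^^ k) (B z) - 0) < e / 2"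
      using LIMSEQ_D[OF Bz[of z], of "e / 2"] e by auto
    have "norm ((?Q ^^ k) x - 0) < e" if "k \<ge> k0" for k
    proof -
      have "norm ((?Q ^^ k) x) \<le> norm ((?Q ^^ k) (x - B z)) + norm ((?Q ^^ k) (B z))"
        unfolding Qdiff using norm_triangle_sub[of "(?Q ^^ k) x" "(?Q ^^ k) (B z)"] by linarith
      also have "\<dots> < e / 2 + e / 2"
        using Qkle[of k "x - B z"] z k0[OF that] by (intro add_le_less_mono) (auto simp: dist_norm norm_minus_commute)
      finally show ?thesis by simp
    qed
    then show "\<exists>no. \<forall>n\<ge>no. norm ((?Q ^^ n) x - 0) < e" by blast
  qed
qed

text \<open>For \<open>D = S - B\<close> one has \<open>(1 + S) D = D (1 - B)\<close>, so \<open>|D x| \<le> |D (1 - B)\<^sup>k x|\<close> for all \<open>k\<close>.\<close>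

lemma positive_sqrt_unique:
  fixes B S :: "'h::{real_inner,banach} \<Rightarrow> 'h"
  assumes B: "bounded_linear B" "self_adjoint B" "positive_op B"
    and le: "\<And>x. norm (B x) \<le> norm x" and dense: "closure (range B) = UNIV"
    and S: "bounded_linear S" "self_adjoint S" "positive_op S" and eq: "S \<circ> S = B \<circ> B"
  shows "S = B"
proof
  fix x
  interpret B: bounded_linear B by fact
  interpret S: bounded_linear S by fact
  let ?D = "\<lambda>x. S x - B x" and ?Q = "\<lambda>x. x - B x"
  have SS: "S (S x) = B (B x)" for x using fun_cong[OF eq, of x] by simp
  have D: "bounded_linear ?D" by (intro bounded_linear_sub S B)
  \<comment> \<open>Only \<open>S (S x) = B (B x)\<close> enters, so no commutation of
    \<open>S\<close> with \<open>B\<close> has to be established.\<close>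
  have id: "?D x + S (?D x) = ?D (?Q x)" for x
    by (simp add: S.diff B.diff SS)
  have step: "norm (?D x) \<le> norm (?D (?Q x))" for x
  proof -
    let ?y = "?D x"
    have "?y \<bullet> ?y \<le> (?y + S ?y) \<bullet> ?y" using S(3) by (simp add: positive_op_def inner_add_left)
    then have "norm ?y * norm ?y \<le> norm (?y + S ?y) * norm ?y"
      using norm_cauchy_schwarz[of "?y + S ?y" ?y]
      by (simp only: dot_square_norm power2_eq_square)
    then have "norm ?y \<le> norm (?y + S ?y)"
      by (cases "norm ?y = 0") (auto simp: mult_le_cancel_right)
    then show ?thesis unfolding id .
  qed
  have le: "norm (?D x) \<le> norm (?D ((?Q ^^ k) x))" for k
  proof (induction k)
    case (Suc k)
    show ?case using order_trans[OF Suc.IH step[of "(?Q ^^ k) x"]] by simp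
  qed simp
  have "(\<lambda>k. norm (?D ((?Q ^^ k) x))) \<longlonglongrightarrow> norm (?D 0)"
    by (rule tendsto_norm, rule bounded_linear.tendsto[OF D], rule contraction_iterates_vanish[OF assms(1-5)])
  then have "norm (?D x) \<le> norm (?D 0)"
    by (rule LIMSEQ_le_const) (intro exI allI impI le)
  then show "S x = B x" by simp
qed

text \<open>\<open>op_sqrt\<close> is a definite description, so its value is accessible only
  through uniqueness of the root. This identifies the square root of the noise covariance.\<close>

lemma op_sqrt_square:
  fixes B :: "'h::{real_inner,banach} \<Rightarrow> 'h"
  assumes "bounded_linear B" "self_adjoint B" "positive_op B"
    and "\<And>x. norm (B x) \<le> norm x" "closure (range B) = UNIV"
  shows "op_sqrt (B \<circ> B) = B"
  unfolding op_sqrt_def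
  by (rule the_equality) (use assms positive_sqrt_unique[OF assms] in auto)

section \<open>Gaussian integrals\<close>

lemma gauss_law_exp:
  assumes v: "v \<ge> 0"
  shows "integrable (gauss_law v) (\<lambda>x. exp (t * x))"
    and "(\<integral>x. exp (t * x) \<partial>gauss_law v) = exp (t\<^sup>2 * v / 2)"
proof -
  have *: "integrable (gauss_law v) (\<lambda>x. exp (t * x)) \<and>
    (\<integral>x. exp (t * x) \<partial>gauss_law v) = exp (t\<^sup>2 * v / 2)"
  proof (cases "v = 0")
    case True
    have "integrable (return borel (0::real)) (\<lambda>x. exp (t * x))"
      by (subst integrable_iff_bounded) (auto simp: nn_integral_return)
    then show ?thesis using True by (simp add: gauss_law_def integral_return)
  next
    case False
    define \<sigma> where "\<sigma> = sqrt v"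
    have \<sigma>: "\<sigma> > 0" "\<sigma>\<^sup>2 = v" using False v by (auto simp: \<sigma>_def)
    have shift: "normal_density 0 \<sigma> x * exp (t * x) = exp (t\<^sup>2 * v / 2) * normal_density (t * v) \<sigma> x" for x
    proof -
      have "- x\<^sup>2 / (2 * \<sigma>\<^sup>2) + t * x = t\<^sup>2 * v / 2 - (x - t * v)\<^sup>2 / (2 * \<sigma>\<^sup>2)"
        using False unfolding \<sigma>(2) by (simp add: field_simps power2_eq_square)
      then have "exp (- x\<^sup>2 / (2 * \<sigma>\<^sup>2)) * exp (t * x) = exp (t\<^sup>2 * v / 2) * exp (- (x - t * v)\<^sup>2 / (2 * \<sigma>\<^sup>2))"
        by (simp flip: exp_add)
      then show ?thesis by (simp add: normal_density_def)
    qed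
    have "integrable lborel (\<lambda>x. normal_density 0 \<sigma> x * exp (t * x))"
      unfolding shift using \<sigma> by (intro integrable_mult_right integrable_normal_density) auto
    moreover have "(\<integral>x. normal_density 0 \<sigma> x * exp (t * x) \<partial>lborel) = exp (t\<^sup>2 * v / 2)"
      unfolding shift using \<sigma> by (simp add: integral_normal_density)
    ultimately show ?thesis
      using False by (simp add: gauss_law_def integrable_density integral_density flip: \<sigma>_def)
  qed
  then show "integrable (gauss_law v) (\<lambda>x. exp (t * x))"
    and "(\<integral>x. exp (t * x) \<partial>gauss_law v) = exp (t\<^sup>2 * v / 2)" by auto
qed

text \<open>The exact constant \<open>sqrt (2 / pi)\<close> is rounded up to 1; the bound serves as
  a Lipschitz estimate for the noise in L1.\<close>

lemma gauss_law_abs_moment: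
  assumes v: "v \<ge> 0"
  shows "(\<integral>\<^sup>+x. ennreal \<bar>x\<bar> \<partial>gauss_law v) \<le> ennreal (sqrt v)"
proof (cases "v = 0")
  case True
  then show ?thesis by (simp add: gauss_law_def nn_integral_return)
next
  case False
  define \<sigma> where "\<sigma> = sqrt v"
  have \<sigma>: "\<sigma> > 0" using False v by (auto simp: \<sigma>_def)
  have hb: "has_bochner_integral lborel (\<lambda>x. normal_density 0 \<sigma> x * \<bar>x\<bar>) (\<sigma> * sqrt (2 / pi))"
    using normal_moment_abs_odd[OF \<sigma>, of 0 0] by simp
  have "sqrt (2 / pi) \<le> 1" using pi_gt3 by (simp add: field_simps)
  then have le: "\<sigma> * sqrt (2 / pi) \<le> \<sigma>" using \<sigma> by (simp add: mult_left_le)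
  have "(\<integral>\<^sup>+x. ennreal \<bar>x\<bar> \<partial>gauss_law v) = (\<integral>\<^sup>+x. ennreal (normal_density 0 \<sigma> x * \<bar>x\<bar>) \<partial>lborel)"
    using False by (simp add: gauss_law_def nn_integral_density ennreal_mult'' flip: \<sigma>_def)
  also have "\<dots> = ennreal (\<sigma> * sqrt (2 / pi))"
    using hb by (subst nn_integral_eq_integral) (auto simp: has_bochner_integral_iff)
  also have "\<dots> \<le> ennreal \<sigma>" using le by (rule ennreal_leI)
  finally show ?thesis by (simp add: \<sigma>_def)
qed

section \<open>From exponential to trigonometric moments by analytic continuation\<close>

lemma exp_abs_le: "exp \<bar>x\<bar> \<le> exp x + exp (- x)" for x :: real
  by (cases "x \<ge> 0") auto

lemma exp_partial_sum_le:
  fixes x :: real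
  assumes "x \<ge> 0"
  shows "(\<Sum>k<n. x ^ k / fact k) \<le> exp x"
proof -
  have "(\<lambda>k. x ^ k / fact k) sums exp x"
    using exp_converges[of x] by (simp add: field_simps)
  then show ?thesis using assms sum_le_suminf[of "\<lambda>k. x ^ k / fact k" "{..<n}"] by (simp add: sums_iff)
qed

text \<open>The weighted moment generating function is the sum of a power series in \<open>z\<close>
  and agrees with the exponential of a quadratic on the real axis. By the identity theorem they also
  agree at \<open>z = \<i>\<close>, where \<open>z^2 = -1\<close> turns \<open>\<alpha>\<close> into
  \<open>- \<alpha>\<close>. The weight \<open>exp (Y w)\<close> allows for exponentially tilted
  Gaussian laws.\<close>

lemma exp_moment_continuation:
  fixes X Y :: "'a \<Rightarrow> real"
  assumes [measurable]: "X \<in> borel_measurable M" "Y \<in> borel_measurable M"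
    and int: "\<And>t. integrable M (\<lambda>w. exp (t * X w + Y w))"
    and mgf: "\<And>t. (\<integral>w. exp (t * X w + Y w) \<partial>M) = exp (\<alpha> * t\<^sup>2 + b * t + \<kappa>)"
  shows "(\<integral>w. of_real (exp (Y w)) * cis (X w) \<partial>M) = exp (of_real (\<kappa> - \<alpha>) + \<i> * of_real b)"
    and "integrable M (\<lambda>w. of_real (exp (Y w)) * cis (X w))"
proof -
  define f where "f z k w = of_real (X w ^ k / fact k * exp (Y w)) * z ^ k"
    for z :: complex and k w
  define m where "m k = (\<integral>w. complex_of_real (X w ^ k / fact k * exp (Y w)) \<partial>M)" for k
  define F where "F z = (\<integral>w. exp (z * of_real (X w)) * of_real (exp (Y w)) \<partial>M)" for z :: complex
  \<comment> \<open>The bound is uniform in \<open>n\<close> and integrable, being two real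
    exponential moments; it licenses termwise integration of the exponential series.\<close>
  have bound: "(\<Sum>k<n. norm (f z k w)) \<le> exp (norm z * X w + Y w) + exp (- norm z * X w + Y w)" for z :: complex and n w
  proof -
    have "(\<Sum>k<n. norm (f z k w)) = (\<Sum>k<n. (norm z * \<bar>X w\<bar>) ^ k / fact k) * exp (Y w)"
      unfolding sum_distrib_right
      by (simp add: f_def norm_mult norm_power power_abs norm_divide power_mult_distrib mult_ac)
    also have "\<dots> \<le> exp (norm z * \<bar>X w\<bar>) * exp (Y w)"
      by (intro mult_right_mono exp_partial_sum_le) auto
    also have "\<dots> \<le> (exp (norm z * X w) + exp (- (norm z * X w))) * exp (Y w)"
      using exp_abs_le[of "norm z * X w"] by (intro mult_right_mono) (auto simp: abs_mult)
    also have "\<dots> = exp (norm z * X w + Y w) + exp (- norm z * X w + Y w)"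
      by (simp add: distrib_right flip: exp_add)
    finally show ?thesis .
  qed
  have fm [measurable]: "f z k \<in> borel_measurable M" for z k unfolding f_def by measurable
  have int_b: "integrable M (\<lambda>w. exp (norm z * X w + Y w) + exp (- norm z * X w + Y w))" for z :: complex
    by (intro Bochner_Integration.integrable_add int)
  have f_int: "integrable M (f z k)" for z k
  proof (rule Bochner_Integration.integrable_bound[OF int_b[of z]])
    show "AE w in M. norm (f z k w) \<le> norm (exp (norm z * X w + Y w) + exp (- norm z * X w + Y w))"
    proof (intro AE_I2)
      fix w
      have "norm (f z k w) \<le> (\<Sum>k<Suc k. norm (f z k w))" by (simp add: sum_nonneg)
      then show "norm (f z k w) \<le> norm (exp (norm z * X w + Y w) + exp (- norm z * X w + Y w))"
        using bound[of z w "Suc k"] by simp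
    qed
  qed simp
  have f_sums: "f z k w = of_real (exp (Y w)) * ((z * of_real (X w)) ^ k /\<^sub>R fact k)" for z k w
    by (simp add: f_def power_mult_distrib scaleR_conv_of_real field_simps)
  have f_suminf: "(\<Sum>k. f z k w) = exp (z * of_real (X w)) * of_real (exp (Y w))" for z w
    unfolding f_sums using sums_mult[OF exp_converges[of "z * of_real (X w)"], of "of_real (exp (Y w))"]
    by (simp add: sums_iff mult.commute)
  have f_summable: "summable (\<lambda>k. norm (f z k w))" for z w
    by (rule summableI_nonneg_bounded[OF _ bound]) simp
  have f_summable': "summable (\<lambda>k. \<integral>w. norm (f z k w) \<partial>M)" for z
  proof (rule summableI_nonneg_bounded)
    fix n
    have "(\<Sum>k<n. \<integral>w. norm (f z k w) \<partial>M) = (\<integral>w. (\<Sum>k<n. norm (f z k w)) \<partial>M)"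
      by (intro Bochner_Integration.integral_sum[symmetric] integrable_norm f_int)
    also have "\<dots> \<le> (\<integral>w. exp (norm z * X w + Y w) + exp (- norm z * X w + Y w) \<partial>M)"
      by (intro integral_mono Bochner_Integration.integrable_sum integrable_norm f_int int_b bound)
    finally show "(\<Sum>k<n. \<integral>w. norm (f z k w) \<partial>M) \<le> \<dots>" .
  qed simp
  have F_int: "integrable M (\<lambda>w. exp (z * of_real (X w)) * of_real (exp (Y w)))" for z :: complex
    using integrable_suminf[OF f_int _ f_summable', of z] f_summable by (simp add: f_suminf)
  have F_sums: "(\<lambda>k. m k * (z - 0) ^ k) sums F z" for z
  proof -
    have "integral\<^sup>L M (f z k) = m k * (z - 0) ^ k" for k
      unfolding m_def f_def[abs_def] diff_zero by (rule integral_mult_left_zero)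
    then show ?thesis
      using sums_integral[OF f_int _ f_summable', of z] f_summable[of z] by (simp add: f_suminf F_def)
  qed
  define H where "H z = F z - exp (of_real \<alpha> * z\<^sup>2 + of_real b * z + of_real \<kappa>)" for z
  \<comment> \<open>Radius 2 is chosen so that the point \<open>\<i>\<close> lies inside the
    disc.\<close>
  have "F holomorphic_on ball 0 2" by (rule power_series_holomorphic[OF F_sums])
  then have H_hol: "H holomorphic_on ball 0 2" unfolding H_def by (intro holomorphic_intros)
  have H_real: "H (of_real t) = 0" for t
  proof -
    have "F (of_real t) = (\<integral>w. of_real (exp (t * X w + Y w)) \<partial>M)"
      unfolding F_def by (intro Bochner_Integration.integral_cong) (simp_all add: exp_add exp_of_real flip: of_real_mult)
    also have "\<dots> = of_real (exp (\<alpha> * t\<^sup>2 + b * t + \<kappa>))" by (simp add: mgf)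
    finally show ?thesis by (simp add: H_def exp_of_real flip: of_real_mult of_real_add of_real_power)
  qed
  have "H \<i> = 0"
  proof (rule analytic_continuation[OF H_hol, of "of_real ` {0<..<1}" 0])
    show "(0::complex) islimpt of_real ` {0<..<1}"
      unfolding islimpt_approachable
    proof (intro allI impI)
      fix e :: real assume e: "e > 0"
      show "\<exists>x'\<in>complex_of_real ` {0<..<1}. x' \<noteq> 0 \<and> dist x' 0 < e"
        by (rule bexI[of _ "of_real (min (e / 2) (1 / 2))"]) (use e in auto)
    qed
  qed (auto simp: H_real dist_norm)
  moreover have "exp (of_real \<alpha> * \<i>\<^sup>2 + of_real b * \<i> + of_real \<kappa>) = exp (of_real (\<kappa> - \<alpha>) + \<i> * of_real b)"
    by (simp add: algebra_simps)
  moreover have *: "of_real (exp (Y w)) * cis (X w) = exp (\<i> * of_real (X w)) * of_real (exp (Y w))" for w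
    by (simp add: cis_conv_exp mult.commute)
  ultimately show "(\<integral>w. of_real (exp (Y w)) * cis (X w) \<partial>M) = exp (of_real (\<kappa> - \<alpha>) + \<i> * of_real b)"
    by (simp only: H_def F_def * right_minus_eq)
  show "integrable M (\<lambda>w. of_real (exp (Y w)) * cis (X w))"
    unfolding * by (rule F_int)
qed

text \<open>The phase \<open>\<theta>\<close> packs the real and imaginary parts of the continued
  moment into one real identity, so the rest of the development stays with real integrals.\<close>

lemma exp_cos_moment:
  fixes X Y :: "'a \<Rightarrow> real"
  assumes "X \<in> borel_measurable M" "Y \<in> borel_measurable M"
    and "\<And>t. integrable M (\<lambda>w. exp (t * X w + Y w))"
    and "\<And>t. (\<integral>w. exp (t * X w + Y w) \<partial>M) = exp (\<alpha> * t\<^sup>2 + b * t + \<kappa>)"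
  shows "(\<integral>w. exp (Y w) * cos (X w + \<theta>) \<partial>M) = exp (\<kappa> - \<alpha>) * cos (b + \<theta>)"
proof -
  note c = exp_moment_continuation[OF assms]
  have "(\<integral>w. exp (Y w) * cos (X w + \<theta>) \<partial>M) = (\<integral>w. Re (cis \<theta> * (of_real (exp (Y w)) * cis (X w))) \<partial>M)"
    by (intro Bochner_Integration.integral_cong) (simp_all add: cos_add algebra_simps)
  also have "\<dots> = Re (cis \<theta> * (\<integral>w. of_real (exp (Y w)) * cis (X w) \<partial>M))"
    using c(2) by (subst integral_Re) auto
  also have "\<dots> = exp (\<kappa> - \<alpha>) * cos (b + \<theta>)"
    unfolding c(1) exp_add exp_of_real cis_conv_exp[symmetric] by (simp add: cos_add algebra_simps)
  finally show ?thesis .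
qed

text \<open>Fatou's lemma applied to \<open>2 (1 - cos (s X)) / s\<^sup>2\<close> as \<open>s\<close> tends to 0.\<close>

lemma second_moment_le_of_cos:
  fixes X :: "'a \<Rightarrow> real"
  assumes "prob_space M" and X [measurable]: "X \<in> borel_measurable M"
    and cos: "\<And>s. (\<integral>w. cos (s * X w) \<partial>M) \<ge> exp (- (s\<^sup>2 * q / 2))"
  shows "(\<integral>\<^sup>+w. ennreal ((X w)\<^sup>2) \<partial>M) \<le> ennreal q"
proof -
  interpret prob_space M by fact
  define s where "s k = 1 / real (Suc k)" for k
  define f where "f k w = 2 * (1 - cos (s k * X w)) / (s k)\<^sup>2" for k w
  have s: "s k > 0" for k by (simp add: s_def)
  have f_nonneg: "f k w \<ge> 0" for k w by (simp add: f_def)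
  have lim: "(\<lambda>k. f k w) \<longlonglongrightarrow> (X w)\<^sup>2" for w
    unfolding f_def s_def power2_eq_square by real_asymp
  have [measurable]: "f k \<in> borel_measurable M" for k unfolding f_def by measurable
  have le: "(\<integral>\<^sup>+w. ennreal (f k w) \<partial>M) \<le> ennreal q" for k
  proof -
    have ci: "integrable M (\<lambda>w. cos (s k * X w))"
      by (rule integrable_const_bound[where B = 1]) auto
    then have int: "integrable M (f k)" unfolding f_def by auto
    have "(\<integral>\<^sup>+w. ennreal (f k w) \<partial>M) = ennreal (\<integral>w. f k w \<partial>M)"
      by (rule nn_integral_eq_integral[OF int]) (simp add: f_nonneg)
    also have "(\<integral>w. f k w \<partial>M) = 2 * (1 - (\<integral>w. cos (s k * X w) \<partial>M)) / (s k)\<^sup>2"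
      unfolding f_def using ci by (simp add: prob_space)
    also have "\<dots> \<le> 2 * (1 - exp (- ((s k)\<^sup>2 * q / 2))) / (s k)\<^sup>2"
      using cos[of "s k"] by (intro divide_right_mono) auto
    also have "\<dots> \<le> 2 * ((s k)\<^sup>2 * q / 2) / (s k)\<^sup>2"
      using exp_ge_add_one_self[of "- ((s k)\<^sup>2 * q / 2)"] by (intro divide_right_mono) auto
    also have "\<dots> = q" using s[of k] by simp
    finally show ?thesis by (simp add: ennreal_leI)
  qed
  have "(\<integral>\<^sup>+w. ennreal ((X w)\<^sup>2) \<partial>M) = (\<integral>\<^sup>+w. liminf (\<lambda>k. ennreal (f k w)) \<partial>M)"
    by (intro nn_integral_cong lim_imp_Liminf[symmetric] tendsto_ennrealI lim) simp
  also have "\<dots> \<le> liminf (\<lambda>k. \<integral>\<^sup>+w. ennreal (f k w) \<partial>M)"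
    by (intro nn_integral_liminf) simp
  also have "\<dots> \<le> ennreal q"
    by (rule order_trans[OF Liminf_mono[where g = "\<lambda>_. ennreal q"]]) (use le in \<open>auto simp: Liminf_const\<close>)
  finally show ?thesis .
qed

section \<open>Almost sure summability and tails of vector-valued variables\<close>

lemma AE_summable_norm:
  fixes f :: "nat \<Rightarrow> 'a \<Rightarrow> 'b::{banach,second_countable_topology}"
  assumes [measurable]: "\<And>k. f k \<in> borel_measurable M"
    and le: "\<And>k. (\<integral>\<^sup>+w. ennreal (norm (f k w)) \<partial>M) \<le> ennreal (c k)"
    and c: "\<And>k. c k \<ge> 0" "summable c"
  shows "AE w in M. summable (\<lambda>k. norm (f k w))"
proof -
  have "(\<integral>\<^sup>+w. (\<Sum>k. ennreal (norm (f k w))) \<partial>M) = (\<Sum>k. \<integral>\<^sup>+w. ennreal (norm (f k w)) \<partial>M)"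
    by (rule nn_integral_suminf) simp
  also have "\<dots> \<le> (\<Sum>k. ennreal (c k))" by (intro suminf_le le) auto
  also have "\<dots> = ennreal (\<Sum>k. c k)" by (rule suminf_ennreal2[OF c])
  also have "\<dots> < \<infinity>" by simp
  finally have "AE w in M. (\<Sum>k. ennreal (norm (f k w))) \<noteq> \<infinity>"
    by (intro nn_integral_PInf_AE) auto
  then show ?thesis
    by eventually_elim (auto intro!: summable_suminf_not_top)
qed


text \<open>Chebyshev's inequality after Parseval. The coordinatewise hypothesis suits both uses,
  the noise part of the posterior mean and the posterior spread around that mean.\<close>

lemma norm_tail_le:
  fixes X :: "'a \<Rightarrow> 'h::{real_inner,banach,second_countable_topology}"
  assumes "prob_space M" and [measurable]: "X \<in> borel_measurable M"
    and onb: "orthonormal_basis \<phi>" and c: "\<And>j. c j \<ge> 0" "summable c"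
    and le: "\<And>j. (\<integral>\<^sup>+w. ennreal ((X w \<bullet> \<phi> j)\<^sup>2) \<partial>M) \<le> ennreal (c j)" and e: "e > 0"
  shows "measure M {w\<in>space M. norm (X w) > e} \<le> (\<Sum>j. c j) / e\<^sup>2"
proof -
  interpret prob_space M by fact
  have "(\<integral>\<^sup>+w. ennreal ((norm (X w))\<^sup>2) \<partial>M) = (\<integral>\<^sup>+w. (\<Sum>j. ennreal ((X w \<bullet> \<phi> j)\<^sup>2)) \<partial>M)"
    by (intro nn_integral_cong) (simp add: norm_square_eq_suminf[OF onb] suminf_ennreal2)
  also have "\<dots> = (\<Sum>j. \<integral>\<^sup>+w. ennreal ((X w \<bullet> \<phi> j)\<^sup>2) \<partial>M)"
    by (rule nn_integral_suminf) simp
  also have "\<dots> \<le> (\<Sum>j. ennreal (c j))" by (intro suminf_le le) auto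
  also have "\<dots> = ennreal (\<Sum>j. c j)" by (rule suminf_ennreal2[OF c])
  finally have sm: "(\<integral>\<^sup>+w. ennreal ((norm (X w))\<^sup>2) \<partial>M) \<le> ennreal (\<Sum>j. c j)" .
  have "emeasure M {w\<in>space M. norm (X w) > e} \<le>
      emeasure M {w\<in>space M. 1 \<le> ennreal (1 / e\<^sup>2) * ennreal ((norm (X w))\<^sup>2)}"
  proof (rule emeasure_mono)
    show "{w\<in>space M. norm (X w) > e} \<subseteq> {w\<in>space M. 1 \<le> ennreal (1 / e\<^sup>2) * ennreal ((norm (X w))\<^sup>2)}"
      using e by (auto simp: field_simps power_mono simp flip: ennreal_mult)
  qed measurable
  also have "\<dots> \<le> ennreal (1 / e\<^sup>2) * (\<integral>\<^sup>+w. ennreal ((norm (X w))\<^sup>2) * indicator (space M) w \<partial>M)"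
    by (rule nn_integral_Markov_inequality) auto
  also have "(\<integral>\<^sup>+w. ennreal ((norm (X w))\<^sup>2) * indicator (space M) w \<partial>M) = (\<integral>\<^sup>+w. ennreal ((norm (X w))\<^sup>2) \<partial>M)"
    by (intro nn_integral_cong) simp
  also have "ennreal (1 / e\<^sup>2) * \<dots> \<le> ennreal (1 / e\<^sup>2) * ennreal (\<Sum>j. c j)"
    using sm by (intro mult_left_mono) auto
  also have "\<dots> = ennreal ((\<Sum>j. c j) / e\<^sup>2)"
    by (subst ennreal_mult[symmetric]) (auto intro: suminf_nonneg[OF c(2,1)])
  finally show ?thesis
    by (simp add: emeasure_eq_measure suminf_nonneg[OF c(2,1)])
qed

section \<open>Extension of the noise to a Hilbert space process\<close>

text \<open>\<open>B\<close> is the square root of the noise covariance, so \<open>\<eta> x\<close>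
  has variance \<open>|B x|^2\<close> and the noise depends on \<open>x\<close> only through
  \<open>B x\<close>, up to null sets.\<close>

locale noise = prob_space M
  for M :: "'w measure"
    and B :: "'h::{real_inner,banach,second_countable_topology} \<Rightarrow> 'h"
    and \<eta> :: "'h \<Rightarrow> 'w \<Rightarrow> real" +
  assumes B_bl: "bounded_linear B" and B_sa: "self_adjoint B"
    and B_dense: "closure (range B) = UNIV"
    and noise: "gaussian_noise M \<eta> (B \<circ> B)"
begin

sublocale B: bounded_linear B by (rule B_bl)

lemma noise_meas [measurable]: "\<eta> x \<in> borel_measurable M"
  using noise by (simp add: gaussian_noise_def)

text \<open>\<open>gaussian_noise\<close> speaks of finite sets of vectors, whereas a family may
  repeat a vector; coefficients of equal vectors are therefore collected first. Almost sure
  linearity of the noise is contained here, as the variance 0 case.\<close>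

lemma noise_combination:
  assumes I: "finite I"
  shows "distr M borel (\<lambda>w. \<Sum>i\<in>I. c i * \<eta> (x i) w) = gauss_law ((norm (B (\<Sum>i\<in>I. c i *\<^sub>R x i)))\<^sup>2)"
proof -
  define A where "A = x ` I"
  define d where "d y = (\<Sum>i | i \<in> I \<and> x i = y. c i)" for y
  have A: "finite A" using I by (simp add: A_def)
  have "(\<Sum>i\<in>I. c i * \<eta> (x i) w) = (\<Sum>y\<in>A. d y * \<eta> y w)" for w
  proof -
    have "(\<Sum>i\<in>I. c i * \<eta> (x i) w) = (\<Sum>y\<in>A. \<Sum>i | i \<in> I \<and> x i = y. c i * \<eta> (x i) w)"
      unfolding A_def by (rule sum.image_gen[OF I])
    also have "\<dots> = (\<Sum>y\<in>A. d y * \<eta> y w)"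
      unfolding d_def sum_distrib_right by (intro sum.cong) auto
    finally show ?thesis .
  qed
  moreover have "(\<Sum>i\<in>I. c i *\<^sub>R x i) = (\<Sum>y\<in>A. d y *\<^sub>R y)"
  proof -
    have "(\<Sum>i\<in>I. c i *\<^sub>R x i) = (\<Sum>y\<in>A. \<Sum>i | i \<in> I \<and> x i = y. c i *\<^sub>R x i)"
      unfolding A_def by (rule sum.image_gen[OF I])
    also have "\<dots> = (\<Sum>y\<in>A. d y *\<^sub>R y)"
      unfolding d_def scaleR_sum_left by (intro sum.cong) auto
    finally show ?thesis .
  qed
  moreover have "(norm (B (\<Sum>y\<in>A. d y *\<^sub>R y)))\<^sup>2 = (\<Sum>y\<in>A. \<Sum>y'\<in>A. d y * d y' * ((B \<circ> B) y \<bullet> y'))"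
  proof -
    let ?s = "\<Sum>y\<in>A. d y *\<^sub>R y"
    have "(norm (B ?s))\<^sup>2 = (\<Sum>y\<in>A. d y * (B y \<bullet> B ?s))"
      unfolding power2_norm_eq_inner by (subst (1) B.sum) (simp add: B.scaleR inner_sum_left)
    also have "\<dots> = (\<Sum>y\<in>A. d y * (\<Sum>y'\<in>A. d y' * ((B \<circ> B) y \<bullet> y')))"
      using self_adjointD[OF B_sa, of "B _" ?s] by (simp add: inner_sum_right)
    finally show ?thesis by (simp add: sum_distrib_left mult.assoc)
  qed
  ultimately show ?thesis
    using noise A unfolding gaussian_noise_def by simp
qed

lemma noise_combination_abs:
  assumes I: "finite I"
  shows "(\<integral>\<^sup>+w. ennreal \<bar>\<Sum>i\<in>I. c i * \<eta> (x i) w\<bar> \<partial>M) \<le> ennreal (norm (B (\<Sum>i\<in>I. c i *\<^sub>R x i)))"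
proof -
  have "(\<integral>\<^sup>+w. ennreal \<bar>\<Sum>i\<in>I. c i * \<eta> (x i) w\<bar> \<partial>M) =
      (\<integral>\<^sup>+t. ennreal \<bar>t\<bar> \<partial>distr M borel (\<lambda>w. \<Sum>i\<in>I. c i * \<eta> (x i) w))"
    by (subst nn_integral_distr) auto
  also have "\<dots> \<le> ennreal (sqrt ((norm (B (\<Sum>i\<in>I. c i *\<^sub>R x i)))\<^sup>2))"
    unfolding noise_combination[OF I] by (rule gauss_law_abs_moment) simp
  finally show ?thesis by simp
qed

text \<open>\<open>represents p Z\<close>: the random variable \<open>Z\<close> is the value at \<open>p\<close> of the \<open>L\<^sup>1\<close>-continuous extension
  of \<open>B x \<mapsto> \<eta> x\<close> from the range of \<open>B\<close> to the whole space.\<close>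

definition represents :: "'h \<Rightarrow> ('w \<Rightarrow> real) \<Rightarrow> bool" where
  "represents p Z \<longleftrightarrow> Z \<in> borel_measurable M \<and>
     (\<forall>x. (\<integral>\<^sup>+w. ennreal \<bar>\<eta> x w - Z w\<bar> \<partial>M) \<le> ennreal (norm (B x - p)))"

lemma representsD:
  assumes "represents p Z"
  shows "Z \<in> borel_measurable M" "(\<integral>\<^sup>+w. ennreal \<bar>\<eta> x w - Z w\<bar> \<partial>M) \<le> ennreal (norm (B x - p))"
  using assms by (auto simp: represents_def)

lemma represents_B: "represents (B x) (\<eta> x)"
  unfolding represents_def
proof (intro conjI allI)
  fix x'
  show "(\<integral>\<^sup>+w. ennreal \<bar>\<eta> x' w - \<eta> x w\<bar> \<partial>M) \<le> ennreal (norm (B x' - B x))"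
    \<comment> \<open>Indexing by booleans keeps the two terms apart even when
      \<open>x' = x\<close>.\<close>
    using noise_combination_abs[of "{False, True}" "\<lambda>b. if b then 1 else -1" "\<lambda>b. if b then x' else x"]
    by (simp add: B.diff)
qed simp

lemma dense_B:
  assumes "e > 0"
  shows "\<exists>x. norm (B x - p) < e"
proof -
  have "p \<in> closure (range B)" by (simp add: B_dense)
  then show ?thesis using assms by (auto simp: closure_approachable dist_norm)
qed

lemma represents_linear:
  assumes Z: "represents p Z" and Z': "represents p' Z'"
  shows "represents (p + c *\<^sub>R p') (\<lambda>w. Z w + c * Z' w)"
  unfolding represents_def
proof (intro conjI allI)
  note [measurable] = representsD(1)[OF Z] representsD(1)[OF Z']
  show "(\<lambda>w. Z w + c * Z' w) \<in> borel_measurable M" by simp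
  fix x
  show "(\<integral>\<^sup>+w. ennreal \<bar>\<eta> x w - (Z w + c * Z' w)\<bar> \<partial>M) \<le> ennreal (norm (B x - (p + c *\<^sub>R p')))"
  proof (rule ennreal_le_epsilon)
    fix e :: real assume e: "e > 0"
    \<comment> \<open>Each approximation error enters twice, once in replacing \<open>Z\<close> or
      \<open>Z'\<close> by a noise variable and once in comparing the norms; hence the factor
      2.\<close>
    define e' where "e' = e / (2 * (1 + \<bar>c\<bar>))"
    have e': "e' > 0" "2 * (1 + \<bar>c\<bar>) * e' = e" using e by (auto simp: e'_def add_pos_nonneg)
    obtain x1 where x1: "norm (B x1 - p) < e'" using dense_B[OF e'(1)] by blast
    obtain x2 where x2: "norm (B x2 - p') < e'" using dense_B[OF e'(1)] by blast
    let ?I = "\<lambda>f. \<integral>\<^sup>+w. ennreal \<bar>f w\<bar> \<partial>M"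
    have 1: "?I (\<lambda>w. \<eta> x w - \<eta> x1 w - c * \<eta> x2 w) \<le> ennreal (norm (B x - B x1 - c *\<^sub>R B x2))"
      using noise_combination_abs[of "{0,1,2::nat}"
          "\<lambda>i. if i = 0 then 1 else if i = 1 then -1 else - c" "\<lambda>i. if i = 0 then x else if i = 1 then x1 else x2"]
      by (simp add: B.diff B.add B.neg B.scaleR algebra_simps)
    have "?I (\<lambda>w. \<eta> x w - (Z w + c * Z' w)) \<le>
        (\<integral>\<^sup>+w. ennreal \<bar>\<eta> x w - \<eta> x1 w - c * \<eta> x2 w\<bar> + (ennreal \<bar>\<eta> x1 w - Z w\<bar> +
           ennreal \<bar>c\<bar> * ennreal \<bar>\<eta> x2 w - Z' w\<bar>) \<partial>M)"
    proof (rule nn_integral_mono)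
      fix w
      have "\<bar>\<eta> x w - (Z w + c * Z' w)\<bar> \<le> \<bar>\<eta> x w - \<eta> x1 w - c * \<eta> x2 w\<bar> + (\<bar>\<eta> x1 w - Z w\<bar> + \<bar>c * (\<eta> x2 w - Z' w)\<bar>)"
        by (simp add: right_diff_distrib)
      then show "ennreal \<bar>\<eta> x w - (Z w + c * Z' w)\<bar> \<le> ennreal \<bar>\<eta> x w - \<eta> x1 w - c * \<eta> x2 w\<bar> +
          (ennreal \<bar>\<eta> x1 w - Z w\<bar> + ennreal \<bar>c\<bar> * ennreal \<bar>\<eta> x2 w - Z' w\<bar>)"
        by (simp add: abs_mult flip: ennreal_plus ennreal_mult)
    qed
    also have "\<dots> = ?I (\<lambda>w. \<eta> x w - \<eta> x1 w - c * \<eta> x2 w) +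
        (?I (\<lambda>w. \<eta> x1 w - Z w) + ennreal \<bar>c\<bar> * ?I (\<lambda>w. \<eta> x2 w - Z' w))"
      by (simp add: nn_integral_add nn_integral_cmult)
    also have "\<dots> \<le> ennreal (norm (B x - B x1 - c *\<^sub>R B x2)) +
        (ennreal (norm (B x1 - p)) + ennreal \<bar>c\<bar> * ennreal (norm (B x2 - p')))"
      by (intro add_mono 1 mult_left_mono representsD(2)[OF Z] representsD(2)[OF Z']) simp
    also have "\<dots> = ennreal (norm (B x - B x1 - c *\<^sub>R B x2) + (norm (B x1 - p) + \<bar>c\<bar> * norm (B x2 - p')))"
      by (simp flip: ennreal_plus ennreal_mult)
    also have "\<dots> \<le> ennreal (norm (B x - (p + c *\<^sub>R p')) + e)"
    proof (rule ennreal_leI)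
      have eq: "(B x - (p + c *\<^sub>R p')) - (B x1 - p) - c *\<^sub>R (B x2 - p') = B x - B x1 - c *\<^sub>R B x2"
        by (simp add: algebra_simps)
      have "norm (a - b - d) \<le> norm a + norm b + norm d" for a b d :: 'h
        using norm_triangle_ineq4[of "a - b" d] norm_triangle_ineq4[of a b] by linarith
      from this[of "B x - (p + c *\<^sub>R p')" "B x1 - p" "c *\<^sub>R (B x2 - p')"]
      have "norm (B x - B x1 - c *\<^sub>R B x2) \<le> norm (B x - (p + c *\<^sub>R p')) + norm (B x1 - p) + \<bar>c\<bar> * norm (B x2 - p')"
        unfolding eq by simp
      moreover have "\<bar>c\<bar> * norm (B x2 - p') \<le> \<bar>c\<bar> * e'" using x2 by (intro mult_left_mono) auto
      ultimately show "norm (B x - B x1 - c *\<^sub>R B x2) + (norm (B x1 - p) + \<bar>c\<bar> * norm (B x2 - p')) \<le>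
          norm (B x - (p + c *\<^sub>R p')) + e"
        using x1 e'(2) by (simp add: algebra_simps)
    qed
    also have "\<dots> = ennreal (norm (B x - (p + c *\<^sub>R p'))) + ennreal e"
      using e by (simp add: ennreal_plus)
    finally show "?I (\<lambda>w. \<eta> x w - (Z w + c * Z' w)) \<le> ennreal (norm (B x - (p + c *\<^sub>R p'))) + ennreal e" .
  qed
qed

lemma represents_zero: "represents 0 (\<lambda>_. 0)"
  using represents_linear[OF represents_B[of 0] represents_B[of 0], of "-1"] by (simp add: B.zero)

lemma represents_sum:
  assumes "finite I" "\<And>i. represents (p i) (Z i)"
  shows "represents (\<Sum>i\<in>I. c i *\<^sub>R p i) (\<lambda>w. \<Sum>i\<in>I. c i * Z i w)"
  using assms(1)
proof induction
  case (insert i I)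
  then show ?case using represents_linear[OF insert.IH assms(2)[of i], of "c i"] by (simp add: add.commute)
qed (simp add: represents_zero)

text \<open>By Fatou's lemma the defining L1 bound survives an almost sure limit of the
  variables.\<close>

lemma represents_limit:
  assumes Zk: "\<And>k. represents (p k) (Z k)" and p: "p \<longlonglongrightarrow> q"
    and Y [measurable]: "Y \<in> borel_measurable M" and lim: "AE w in M. (\<lambda>k. Z k w) \<longlonglongrightarrow> Y w"
  shows "represents q Y"
  unfolding represents_def
proof (intro conjI allI Y)
  note [measurable] = representsD(1)[OF Zk]
  fix x
  have "(\<integral>\<^sup>+w. ennreal \<bar>\<eta> x w - Y w\<bar> \<partial>M) = (\<integral>\<^sup>+w. liminf (\<lambda>k. ennreal \<bar>\<eta> x w - Z k w\<bar>) \<partial>M)"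
  proof (rule nn_integral_cong_AE, use lim in eventually_elim)
    fix w assume "(\<lambda>k. Z k w) \<longlonglongrightarrow> Y w"
    then show "ennreal \<bar>\<eta> x w - Y w\<bar> = liminf (\<lambda>k. ennreal \<bar>\<eta> x w - Z k w\<bar>)"
      by (intro lim_imp_Liminf[symmetric] trivial_limit_sequentially tendsto_intros)
  qed
  also have "\<dots> \<le> liminf (\<lambda>k. \<integral>\<^sup>+w. ennreal \<bar>\<eta> x w - Z k w\<bar> \<partial>M)"
    by (intro nn_integral_liminf) simp
  also have "\<dots> \<le> liminf (\<lambda>k. ennreal (norm (B x - p k)))"
    by (intro Liminf_mono always_eventually allI representsD(2)[OF Zk])
  also have "\<dots> = ennreal (norm (B x - q))"
    by (intro lim_imp_Liminf tendsto_intros p) simp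
  finally show "(\<integral>\<^sup>+w. ennreal \<bar>\<eta> x w - Y w\<bar> \<partial>M) \<le> ennreal (norm (B x - q))" .
qed

lemma B_approximation:
  obtains x where "\<And>k. norm (B (x k) - p) < (1/2) ^ k" "(\<lambda>k. B (x k)) \<longlonglongrightarrow> p"
proof -
  have "\<exists>x. norm (B x - p) < (1/2) ^ k" for k by (rule dense_B) simp
  then obtain x where x: "\<And>k. norm (B (x k) - p) < (1/2) ^ k" by metis
  have "(\<lambda>k. B (x k) - p) \<longlonglongrightarrow> 0"
    by (rule Lim_null_comparison[OF _ LIMSEQ_power_zero[of "1/2 :: real"]])
      (auto intro!: always_eventually less_imp_le x)
  then show thesis using x by (intro that[of x]) (simp_all add: LIM_zero_iff)
qed

text \<open>As in the completeness proof for L1: a geometrically fast approximation of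
  \<open>p\<close> by \<open>B (x k)\<close> makes the increments of \<open>\<eta> (x k)\<close>
  summable in L1, hence summable almost surely, and the telescoping series supplies the
  limit.\<close>

lemma represents_exists: "\<exists>Z. represents p Z"
proof -
  obtain x where x: "\<And>k. norm (B (x k) - p) < (1/2) ^ k" and Bx: "(\<lambda>k. B (x k)) \<longlonglongrightarrow> p"
    by (rule B_approximation[of p]) blast
  define d where "d k w = \<eta> (x (Suc k)) w - \<eta> (x k) w" for k w
  have d_meas [measurable]: "d k \<in> borel_measurable M" for k unfolding d_def by simp
  have "AE w in M. summable (\<lambda>k. norm (d k w))"
  proof (rule AE_summable_norm[where c = "\<lambda>k. 2 * (1/2) ^ k"])
    show "summable (\<lambda>k. 2 * (1/2) ^ k :: real)" by (intro summable_mult summable_geometric) simp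
    show "d k \<in> borel_measurable M" for k by (rule d_meas)
    show "0 \<le> 2 * (1/2 :: real) ^ k" for k by simp
    fix k
    have "(\<integral>\<^sup>+w. ennreal (norm (d k w)) \<partial>M) \<le> ennreal (norm (B (x (Suc k)) - B (x k)))"
      unfolding d_def real_norm_def by (rule representsD(2)[OF represents_B])
    also have "\<dots> \<le> ennreal (2 * (1/2) ^ k)"
    proof (rule ennreal_leI)
      have "norm (B (x (Suc k)) - B (x k)) \<le> norm (B (x (Suc k)) - p) + norm (B (x k) - p)"
        using norm_triangle_ineq4[of "B (x (Suc k)) - p" "B (x k) - p"] by simp
      moreover have "(1/2) ^ Suc k \<le> (1/2 :: real) ^ k" by simp
      ultimately show "norm (B (x (Suc k)) - B (x k)) \<le> 2 * (1/2) ^ k"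
        using x[of k] x[of "Suc k"] by linarith
    qed
    finally show "(\<integral>\<^sup>+w. ennreal (norm (d k w)) \<partial>M) \<le> ennreal (2 * (1/2) ^ k)" .
  qed
  then have "AE w in M. (\<lambda>k. \<eta> (x k) w) \<longlonglongrightarrow> \<eta> (x 0) w + (\<Sum>k. d k w)"
  proof (rule AE_mp, intro AE_I2 impI)
    fix w assume "summable (\<lambda>k. norm (d k w))"
    then have "(\<lambda>n. \<Sum>k<n. d k w) \<longlonglongrightarrow> (\<Sum>k. d k w)"
      by (rule summable_LIMSEQ[OF summable_norm_cancel])
    moreover have "(\<Sum>k<n. d k w) = \<eta> (x n) w - \<eta> (x 0) w" for n
      unfolding d_def by (rule sum_lessThan_telescope)
    ultimately show "(\<lambda>k. \<eta> (x k) w) \<longlonglongrightarrow> \<eta> (x 0) w + (\<Sum>k. d k w)"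
      using tendsto_add[OF tendsto_const[of "\<eta> (x 0) w"], of "\<lambda>n. \<Sum>k<n. d k w"] by simp
  qed
  then have "represents p (\<lambda>w. \<eta> (x 0) w + (\<Sum>k. d k w))"
    by (intro represents_limit[OF represents_B[of "x _"] Bx]) auto
  then show ?thesis by blast
qed

text \<open>For \<open>p\<close> in the range of \<open>B\<close> this is the Gaussian
  characteristic function. The cosine is 1-Lipschitz, so the L1 bound in \<open>represents\<close>
  carries the formula over to the limit.\<close>

lemma represents_cos:
  assumes Z: "represents p Z"
  shows "(\<integral>w. cos (s * Z w + \<theta>) \<partial>M) = exp (- (s\<^sup>2 * (norm p)\<^sup>2 / 2)) * cos \<theta>"
proof -
  note [measurable] = representsD(1)[OF Z]
  have cos_eta: "(\<integral>w. cos (s * \<eta> x w + \<theta>) \<partial>M) = exp (- (s\<^sup>2 * (norm (B x))\<^sup>2 / 2)) * cos \<theta>" for x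
  proof -
    have law: "distr M borel (\<eta> x) = gauss_law ((norm (B x))\<^sup>2)"
      using noise_combination[of "{0::nat}" "\<lambda>_. 1" "\<lambda>_. x"] by simp
    have "integrable M (\<lambda>w. exp (t * (s * \<eta> x w) + 0))" for t
    proof -
      have "integrable (distr M borel (\<eta> x)) (\<lambda>y. exp ((t * s) * y))"
        unfolding law by (rule gauss_law_exp) simp
      then show ?thesis by (subst (asm) integrable_distr_eq) (auto simp: mult.assoc)
    qed
    moreover have "(\<integral>w. exp (t * (s * \<eta> x w) + 0) \<partial>M) = exp ((s\<^sup>2 * (norm (B x))\<^sup>2 / 2) * t\<^sup>2 + 0 * t + 0)" for t
    proof -
      have "(\<integral>w. exp (t * (s * \<eta> x w) + 0) \<partial>M) = (\<integral>y. exp ((t * s) * y) \<partial>distr M borel (\<eta> x))"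
        by (subst integral_distr) (auto simp: mult.assoc)
      also have "\<dots> = exp ((t * s)\<^sup>2 * (norm (B x))\<^sup>2 / 2)"
        unfolding law by (rule gauss_law_exp) simp
      finally show ?thesis by (simp add: power_mult_distrib mult_ac)
    qed
    ultimately show ?thesis
      using exp_cos_moment[of "\<lambda>w. s * \<eta> x w" M "\<lambda>_. 0" "s\<^sup>2 * (norm (B x))\<^sup>2 / 2" 0 0 \<theta>] by simp
  qed
  obtain x where Bx: "(\<lambda>k. B (x k)) \<longlonglongrightarrow> p" by (rule B_approximation[of p]) blast
  then have null: "(\<lambda>k. norm (B (x k) - p)) \<longlonglongrightarrow> 0" by (simp add: tendsto_norm_zero LIM_zero)
  have "(\<lambda>k. (\<integral>w. cos (s * \<eta> (x k) w + \<theta>) \<partial>M) - (\<integral>w. cos (s * Z w + \<theta>) \<partial>M)) \<longlonglongrightarrow> 0"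
  proof (rule Lim_null_comparison)
    have bd: "integrable M (\<lambda>w. cos (f w))" if [measurable]: "f \<in> borel_measurable M" for f :: "'w \<Rightarrow> real"
      by (rule integrable_const_bound[where B = 1]) auto
    have "norm ((\<integral>w. cos (s * \<eta> (x k) w + \<theta>) \<partial>M) - (\<integral>w. cos (s * Z w + \<theta>) \<partial>M)) \<le> \<bar>s\<bar> * norm (B (x k) - p)" for k
    proof -
      have nn: "(\<integral>\<^sup>+w. ennreal \<bar>\<eta> (x k) w - Z w\<bar> \<partial>M) \<le> ennreal (norm (B (x k) - p))"
        by (rule representsD(2)[OF Z])
      then have int: "integrable M (\<lambda>w. \<bar>\<eta> (x k) w - Z w\<bar>)"
        by (intro integrableI_bounded) (auto intro: le_less_trans)
      have L1: "(\<integral>w. \<bar>\<eta> (x k) w - Z w\<bar> \<partial>M) \<le> norm (B (x k) - p)"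
        using nn by (subst (asm) nn_integral_eq_integral[OF int]) auto
      have "norm ((\<integral>w. cos (s * \<eta> (x k) w + \<theta>) \<partial>M) - (\<integral>w. cos (s * Z w + \<theta>) \<partial>M)) =
          norm (\<integral>w. cos (s * \<eta> (x k) w + \<theta>) - cos (s * Z w + \<theta>) \<partial>M)"
        by (subst Bochner_Integration.integral_diff) (auto intro!: bd)
      also have "\<dots> \<le> (\<integral>w. \<bar>s\<bar> * \<bar>\<eta> (x k) w - Z w\<bar> \<partial>M)"
      proof (rule order_trans[OF integral_norm_bound], rule integral_mono,
          rule integrable_norm, rule Bochner_Integration.integrable_diff)
        fix w
        have "\<bar>cos a - cos b\<bar> \<le> \<bar>a - b\<bar>" for a b :: real
        proof -
          have "\<bar>cos a - cos b\<bar> = 2 * \<bar>sin ((a + b) / 2)\<bar> * \<bar>sin ((b - a) / 2)\<bar>"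
            by (simp add: cos_diff_cos abs_mult)
          also have "\<dots> \<le> 2 * 1 * \<bar>(b - a) / 2\<bar>"
            by (intro mult_mono abs_sin_x_le_abs_x) auto
          finally show ?thesis by simp
        qed
        from this[of "s * \<eta> (x k) w + \<theta>" "s * Z w + \<theta>"]
        show "norm (cos (s * \<eta> (x k) w + \<theta>) - cos (s * Z w + \<theta>)) \<le> \<bar>s\<bar> * \<bar>\<eta> (x k) w - Z w\<bar>"
          by (simp flip: abs_mult right_diff_distrib)
      qed (auto intro!: bd int)
      also have "\<dots> \<le> \<bar>s\<bar> * norm (B (x k) - p)" using L1 by (simp add: mult_left_mono)
      finally show ?thesis .
    qed
    then show "\<forall>\<^sub>F k in sequentially. norm ((\<integral>w. cos (s * \<eta> (x k) w + \<theta>) \<partial>M) - (\<integral>w. cos (s * Z w + \<theta>) \<partial>M))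
        \<le> \<bar>s\<bar> * norm (B (x k) - p)" by simp
    show "(\<lambda>k. \<bar>s\<bar> * norm (B (x k) - p)) \<longlonglongrightarrow> 0" using tendsto_mult_left[OF null, of "\<bar>s\<bar>"] by simp
  qed
  then have "(\<lambda>k. \<integral>w. cos (s * \<eta> (x k) w + \<theta>) \<partial>M) \<longlonglongrightarrow> (\<integral>w. cos (s * Z w + \<theta>) \<partial>M)"
    by (simp add: LIM_zero_iff)
  moreover have "(\<lambda>k. \<integral>w. cos (s * \<eta> (x k) w + \<theta>) \<partial>M) \<longlonglongrightarrow> exp (- (s\<^sup>2 * (norm p)\<^sup>2 / 2)) * cos \<theta>"
    unfolding cos_eta by (intro tendsto_intros Bx) simp
  ultimately show ?thesis by (rule LIMSEQ_unique)
qed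

text \<open>L1 closeness does not control squares; the variance is recovered from the characteristic
  function instead.\<close>

lemma represents_second_moment:
  assumes Z: "represents p Z"
  shows "(\<integral>\<^sup>+w. ennreal ((Z w)\<^sup>2) \<partial>M) \<le> ennreal ((norm p)\<^sup>2)"
  using represents_cos[OF Z, of _ 0] representsD(1)[OF Z]
  by (intro second_moment_le_of_cos) (auto intro: prob_space_axioms)

lemma represents_tail:
  assumes Z: "represents p Z" and e: "e > 0"
  shows "measure M {w \<in> space M. \<bar>\<eta> x w - Z w\<bar> > e} \<le> norm (B x - p) / e"
proof -
  note [measurable] = representsD(1)[OF Z]
  have "emeasure M {w \<in> space M. \<bar>\<eta> x w - Z w\<bar> > e} \<le> emeasure M {w \<in> space M. 1 \<le> ennreal (1 / e) * ennreal \<bar>\<eta> x w - Z w\<bar>}"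
    using e by (intro emeasure_mono) (auto simp: field_simps simp flip: ennreal_mult)
  also have "\<dots> \<le> ennreal (1 / e) * (\<integral>\<^sup>+w. ennreal \<bar>\<eta> x w - Z w\<bar> * indicator (space M) w \<partial>M)"
    using nn_integral_Markov_inequality[of "\<lambda>w. ennreal \<bar>\<eta> x w - Z w\<bar>" "space M" M "ennreal (1 / e)"] by simp
  also have "(\<integral>\<^sup>+w. ennreal \<bar>\<eta> x w - Z w\<bar> * indicator (space M) w \<partial>M) = (\<integral>\<^sup>+w. ennreal \<bar>\<eta> x w - Z w\<bar> \<partial>M)"
    by (intro nn_integral_cong) simp
  also have "ennreal (1 / e) * \<dots> \<le> ennreal (1 / e) * ennreal (norm (B x - p))"
    by (intro mult_left_mono representsD(2)[OF Z]) simp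
  also have "\<dots> = ennreal (norm (B x - p) / e)"
    using e by (simp flip: ennreal_mult)
  finally show ?thesis using e by (simp add: emeasure_eq_measure)
qed

text \<open>One random vector has to realise the whole family indexed by \<open>u\<close>. Its
  coefficients are variables \<open>Z j\<close> representing \<open>p j\<close>; summability of
  \<open>norm (p j)\<close> bounds the sum of their first absolute moments, so the orthogonal series
  converges almost surely.\<close>

lemma noise_vector_exists:
  fixes \<phi> p :: "nat \<Rightarrow> 'h"
  assumes onb: "orthonormal_basis \<phi>" and p: "summable (\<lambda>j. norm (p j))"
  shows "\<exists>V \<in> borel_measurable M. \<forall>u. represents (\<Sum>j. (u \<bullet> \<phi> j) *\<^sub>R p j) (\<lambda>w. V w \<bullet> u)"
proof -
  obtain Z where Z: "\<And>j. represents (p j) (Z j)"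
    using choice[of "\<lambda>j. represents (p j)"] represents_exists by auto
  note [measurable] = representsD(1)[OF Z]
  have sumZ: "AE w in M. summable (\<lambda>j. norm (Z j w))"
  proof (rule AE_summable_norm[OF _ _ _ p])
    show "(\<integral>\<^sup>+w. ennreal (norm (Z j w)) \<partial>M) \<le> ennreal (norm (p j))" for j
    proof -
      have "(\<integral>\<^sup>+w. ennreal (norm (Z j w)) \<partial>M) \<le> (\<integral>\<^sup>+w. ennreal \<bar>\<eta> 0 w\<bar> + ennreal \<bar>\<eta> 0 w - Z j w\<bar> \<partial>M)"
        by (intro nn_integral_mono) (simp flip: ennreal_plus)
      also have "\<dots> = (\<integral>\<^sup>+w. ennreal \<bar>\<eta> 0 w\<bar> \<partial>M) + (\<integral>\<^sup>+w. ennreal \<bar>\<eta> 0 w - Z j w\<bar> \<partial>M)"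
        by (rule nn_integral_add) auto
      also have "\<dots> \<le> 0 + ennreal (norm (B 0 - p j))"
        \<comment> \<open>\<open>\<eta> 0\<close> vanishes almost surely, its L1 distance to 0 being
          at most \<open>norm (B 0)\<close>.\<close>
        using representsD(2)[OF represents_zero, of 0]
        by (intro add_mono representsD(2)[OF Z]) (simp add: B.zero)
      finally show ?thesis by (simp add: B.zero)
    qed
  qed auto
  \<comment> \<open>A sum different from \<open>top\<close> is a measurable form of summability; on
    the exceptional null set the value is 0.\<close>
  define V where "V w = (if (\<Sum>j. ennreal (norm (Z j w))) \<noteq> top then \<Sum>j. Z j w *\<^sub>R \<phi> j else 0)" for w
  have sV: "summable (\<lambda>j. Z j w *\<^sub>R \<phi> j)" if "summable (\<lambda>j. norm (Z j w))" for w
    using that by (intro summable_norm_cancel[of "\<lambda>j. Z j w *\<^sub>R \<phi> j"]) (simp add: onb_norm[OF onb])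
  have [measurable]: "V \<in> borel_measurable M"
  proof (rule borel_measurable_LIMSEQ_metric)
    let ?f = "\<lambda>n w. if (\<Sum>j. ennreal (norm (Z j w))) \<noteq> top then \<Sum>j<n. Z j w *\<^sub>R \<phi> j else 0"
    show "?f n \<in> borel_measurable M" for n by measurable
    show "(\<lambda>n. ?f n w) \<longlonglongrightarrow> V w" for w
    proof (cases "(\<Sum>j. ennreal (norm (Z j w))) = top")
      case False
      then have "summable (\<lambda>j. norm (Z j w))" by (intro summable_suminf_not_top) auto
      then show ?thesis using False by (simp add: V_def summable_LIMSEQ sV)
    qed (simp add: V_def)
  qed
  have "represents (\<Sum>j. (u \<bullet> \<phi> j) *\<^sub>R p j) (\<lambda>w. V w \<bullet> u)" for u
  proof (rule represents_limit)
    show "represents (\<Sum>j<n. (u \<bullet> \<phi> j) *\<^sub>R p j) (\<lambda>w. \<Sum>j<n. (u \<bullet> \<phi> j) * Z j w)" for n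
      by (rule represents_sum[OF _ Z]) simp
    have "summable (\<lambda>j. (u \<bullet> \<phi> j) *\<^sub>R p j)"
    proof (rule summable_norm_cancel, rule summable_comparison_test')
      show "summable (\<lambda>j. norm u * norm (p j))" by (intro summable_mult p)
      show "norm (norm ((u \<bullet> \<phi> n) *\<^sub>R p n)) \<le> norm u * norm (p n)" for n
        using Cauchy_Schwarz_ineq2[of u "\<phi> n"] by (simp add: onb_norm[OF onb] mult_right_mono)
    qed
    then show "(\<lambda>n. \<Sum>j<n. (u \<bullet> \<phi> j) *\<^sub>R p j) \<longlonglongrightarrow> (\<Sum>j. (u \<bullet> \<phi> j) *\<^sub>R p j)"
      by (rule summable_LIMSEQ)
    show "AE w in M. (\<lambda>n. \<Sum>j<n. (u \<bullet> \<phi> j) * Z j w) \<longlonglongrightarrow> V w \<bullet> u"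
      using sumZ
    proof eventually_elim
      fix w assume s: "summable (\<lambda>j. norm (Z j w))"
      have V: "V w = (\<Sum>j. Z j w *\<^sub>R \<phi> j)"
        unfolding V_def by (rule if_P) (rule ennreal_suminf_neq_top[OF s norm_ge_zero])
      have "(\<lambda>n. (\<Sum>j<n. Z j w *\<^sub>R \<phi> j) \<bullet> u) \<longlonglongrightarrow> V w \<bullet> u"
        unfolding V by (rule tendsto_inner[OF summable_LIMSEQ[OF sV[OF s]] tendsto_const])
      moreover have "(\<Sum>j<n. Z j w *\<^sub>R \<phi> j) \<bullet> u = (\<Sum>j<n. (u \<bullet> \<phi> j) * Z j w)" for n
        unfolding inner_sum_left by (intro sum.cong refl) (simp add: inner_commute[of u])
      ultimately show "(\<lambda>n. \<Sum>j<n. (u \<bullet> \<phi> j) * Z j w) \<longlonglongrightarrow> V w \<bullet> u" by simp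
    qed
  qed simp
  then show ?thesis using \<open>V \<in> borel_measurable M\<close> by blast
qed

end

section \<open>Tilted Gaussian measures\<close>

text \<open>The inequality \<open>(sqrt a - sqrt b)^2 \<le> \<bar>a - b\<bar>\<close> reduces
  Hellinger continuity to L1 continuity of the densities. \<open>RN_deriv\<close> is known only
  almost everywhere, by uniqueness.\<close>

lemma hellinger_dist_density_le:
  fixes f g :: "'a \<Rightarrow> real"
  assumes "sigma_finite_measure \<mu>" and f: "integrable \<mu> f" "\<And>u. f u \<ge> 0" and g: "integrable \<mu> g" "\<And>u. g u \<ge> 0"
  shows "hellinger_dist \<mu> (density \<mu> (\<lambda>u. ennreal (f u))) (density \<mu> (\<lambda>u. ennreal (g u)))
      \<le> sqrt (1 / 2 * (\<integral>u. \<bar>f u - g u\<bar> \<partial>\<mu>))"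
proof -
  interpret sigma_finite_measure \<mu> by fact
  have [measurable]: "f \<in> borel_measurable \<mu>" "g \<in> borel_measurable \<mu>" using f g by auto
  let ?F = "RN_deriv \<mu> (density \<mu> (\<lambda>u. ennreal (f u)))" and ?G = "RN_deriv \<mu> (density \<mu> (\<lambda>u. ennreal (g u)))"
  have F: "AE u in \<mu>. ennreal (f u) = ?F u" and G: "AE u in \<mu>. ennreal (g u) = ?G u"
    by (intro RN_deriv_unique; simp)+
  have le: "(sqrt a - sqrt b)\<^sup>2 \<le> \<bar>a - b\<bar>" if "a \<ge> 0" "b \<ge> 0" for a b :: real
  proof -
    have "(sqrt a - sqrt b)\<^sup>2 = \<bar>sqrt a - sqrt b\<bar> * \<bar>sqrt a - sqrt b\<bar>" by (simp add: power2_eq_square)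
    also have "\<dots> \<le> \<bar>sqrt a - sqrt b\<bar> * \<bar>sqrt a + sqrt b\<bar>"
    proof (rule mult_left_mono)
      have "\<bar>x - y\<bar> \<le> \<bar>x + y\<bar>" if "x \<ge> 0" "y \<ge> 0" for x y :: real using that by auto
      then show "\<bar>sqrt a - sqrt b\<bar> \<le> \<bar>sqrt a + sqrt b\<bar>" using that by simp
    qed simp
    also have "\<dots> = \<bar>(sqrt a - sqrt b) * (sqrt a + sqrt b)\<bar>" by (simp add: abs_mult)
    also have "(sqrt a - sqrt b) * (sqrt a + sqrt b) = a - b" using that by (simp add: algebra_simps)
    finally show ?thesis .
  qed
  have int: "integrable \<mu> (\<lambda>u. (sqrt (f u) - sqrt (g u))\<^sup>2)"
  proof (rule Bochner_Integration.integrable_bound[of \<mu> "\<lambda>u. \<bar>f u - g u\<bar>"])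
    show "AE u in \<mu>. norm ((sqrt (f u) - sqrt (g u))\<^sup>2) \<le> norm \<bar>f u - g u\<bar>" using f g le by simp
  qed (use f g in auto)
  have "(\<integral>u. (sqrt (enn2real (?F u)) - sqrt (enn2real (?G u)))\<^sup>2 \<partial>\<mu>) = (\<integral>u. (sqrt (f u) - sqrt (g u))\<^sup>2 \<partial>\<mu>)"
  proof (rule integral_cong_AE)
    show "AE u in \<mu>. (sqrt (enn2real (?F u)) - sqrt (enn2real (?G u)))\<^sup>2 = (sqrt (f u) - sqrt (g u))\<^sup>2"
      using F G
    proof eventually_elim
      fix u assume "ennreal (f u) = ?F u" "ennreal (g u) = ?G u"
      then have "enn2real (?F u) = f u" "enn2real (?G u) = g u" using f g by (metis enn2real_ennreal)+
      then show "(sqrt (enn2real (?F u)) - sqrt (enn2real (?G u)))\<^sup>2 = (sqrt (f u) - sqrt (g u))\<^sup>2" by simp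
    qed
  qed auto
  also have "\<dots> \<le> (\<integral>u. \<bar>f u - g u\<bar> \<partial>\<mu>)"
    using f g by (intro integral_mono int) (auto intro: le)
  finally show ?thesis unfolding hellinger_dist_def by (intro real_sqrt_le_mono mult_left_mono) auto
qed

locale gaussian_prior = prob_space \<mu>
  for \<mu> :: "'h::{real_inner,banach,second_countable_topology} measure" and Q :: "'h \<Rightarrow> 'h" +
  assumes sets_prior: "sets \<mu> = sets borel"
    and Q_bl: "bounded_linear Q" and Q_sa: "self_adjoint Q" and Q_pos: "positive_op Q"
    and prior_law: "\<And>x. distr \<mu> borel (\<lambda>u. u \<bullet> x) = gauss_law (Q x \<bullet> x)"
begin

sublocale Q: bounded_linear Q by (rule Q_bl)

lemma prior_meas: "borel_measurable \<mu> = borel_measurable borel"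
  by (rule measurable_cong_sets) (simp_all add: sets_prior)

lemma inner_meas [measurable]: "(\<lambda>u. u \<bullet> x) \<in> borel_measurable \<mu>"
  unfolding prior_meas by measurable

lemma id_meas [measurable]: "(\<lambda>u. u) \<in> \<mu> \<rightarrow>\<^sub>M borel"
  by (rule measurable_ident_sets[OF sets_prior])

abbreviation q :: "'h \<Rightarrow> real" where "q x \<equiv> Q x \<bullet> x"

lemma q_nonneg: "q x \<ge> 0"
  using Q_pos by (simp add: positive_op_def)

lemma q_scaleR: "q (c *\<^sub>R x) = c\<^sup>2 * q x"
  by (simp add: Q.scaleR power2_eq_square)

lemma q_add: "q (x + y) = q x + q y + 2 * (Q x \<bullet> y)"
  using self_adjointD[OF Q_sa, of y x] by (simp add: Q.add inner_add_left inner_add_right inner_commute)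

lemma prior_exp:
  shows "integrable \<mu> (\<lambda>u. exp (u \<bullet> x))" and "(\<integral>u. exp (u \<bullet> x) \<partial>\<mu>) = exp (q x / 2)"
proof -
  have "integrable (distr \<mu> borel (\<lambda>u. u \<bullet> x)) (\<lambda>y. exp (1 * y))"
    unfolding prior_law by (rule gauss_law_exp[OF q_nonneg])
  then show "integrable \<mu> (\<lambda>u. exp (u \<bullet> x))" by (subst (asm) integrable_distr_eq) auto
  have "(\<integral>u. exp (u \<bullet> x) \<partial>\<mu>) = (\<integral>y. exp (1 * y) \<partial>distr \<mu> borel (\<lambda>u. u \<bullet> x))"
    by (subst integral_distr) auto
  also have "\<dots> = exp (1\<^sup>2 * q x / 2)" unfolding prior_law by (rule gauss_law_exp[OF q_nonneg])
  finally show "(\<integral>u. exp (u \<bullet> x) \<partial>\<mu>) = exp (q x / 2)" by simp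
qed

text \<open>An integrated Cameron-Martin formula: weighting by \<open>exp (u \<bullet> b)\<close>
  shifts the mean to \<open>Q b\<close>, which appears as the phase
  \<open>Q a \<bullet> b\<close>.\<close>

lemma prior_exp_cos:
  "(\<integral>u. exp (u \<bullet> b) * cos (u \<bullet> a + \<theta>) \<partial>\<mu>) = exp ((q b - q a) / 2) * cos (Q a \<bullet> b + \<theta>)"
proof -
  have eq: "t * (u \<bullet> a) + u \<bullet> b = u \<bullet> (t *\<^sub>R a + b)" for t u by (simp add: inner_add_right)
  have "(\<integral>u. exp (u \<bullet> b) * cos (u \<bullet> a + \<theta>) \<partial>\<mu>) = exp (q b / 2 - q a / 2) * cos (Q a \<bullet> b + \<theta>)"
  proof (rule exp_cos_moment)
    show "integrable \<mu> (\<lambda>u. exp (t * (u \<bullet> a) + u \<bullet> b))" for t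
      unfolding eq by (rule prior_exp)
    show "(\<integral>u. exp (t * (u \<bullet> a) + u \<bullet> b) \<partial>\<mu>) = exp (q a / 2 * t\<^sup>2 + (Q a \<bullet> b) * t + q b / 2)" for t
      unfolding eq prior_exp(2) q_add q_scaleR by (simp add: Q.scaleR add_divide_distrib mult_ac)
  qed measurable
  then show ?thesis by (simp add: diff_divide_distrib)
qed

end

section \<open>Unnormalised posterior densities and their dependence on the data vector\<close>

definition tilt :: "('h::real_inner \<Rightarrow> 'h) \<Rightarrow> real \<Rightarrow> 'h \<Rightarrow> 'h \<Rightarrow> real" where
  "tilt T t v u = exp (- (t / 2) * (norm (T u))\<^sup>2 + t * (v \<bullet> u))"

locale tilted_gaussian = gaussian_prior \<mu> Q
  for \<mu> :: "'h::{real_inner,banach,second_countable_topology} measure" and Q :: "'h \<Rightarrow> 'h" +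
  fixes T :: "'h \<Rightarrow> 'h" and t :: real
  assumes T_bl: "bounded_linear T" and t_pos: "t > 0"
begin

sublocale T: bounded_linear T by (rule T_bl)

lemma tilt_meas [measurable]: "tilt T t v \<in> borel_measurable \<mu>"
proof -
  have "T \<in> borel_measurable borel"
    by (intro borel_measurable_continuous_onI linear_continuous_on T_bl)
  then show ?thesis unfolding prior_meas tilt_def by measurable
qed

lemma tilt_pos: "tilt T t v u > 0"
  by (simp add: tilt_def)

lemma tilt_le: "tilt T t v u \<le> exp (u \<bullet> (t *\<^sub>R v))"
  using t_pos by (simp add: tilt_def inner_commute)

lemma tilt_integrable: "integrable \<mu> (tilt T t v)"
  by (rule Bochner_Integration.integrable_bound[OF prior_exp(1)[of "t *\<^sub>R v"]])
    (use tilt_le[of v] in \<open>auto intro!: AE_I2 simp: abs_of_pos[OF tilt_pos]\<close>)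

definition Z :: "'h \<Rightarrow> real" where "Z v = (\<integral>u. tilt T t v u \<partial>\<mu>)"

lemma Z_pos: "Z v > 0"
proof -
  have "0 \<le> Z v" unfolding Z_def by (intro integral_nonneg_AE AE_I2 less_imp_le tilt_pos)
  moreover have "Z v \<noteq> 0"
  proof
    assume "Z v = 0"
    then have "AE u in \<mu>. tilt T t v u = 0"
      unfolding Z_def
      by (subst (asm) integral_nonneg_eq_0_iff_AE[OF tilt_integrable]) (auto intro: less_imp_le[OF tilt_pos])
    then have "AE u in \<mu>. False" by eventually_elim (metis tilt_pos less_irrefl)
    then show False by simp
  qed
  ultimately show ?thesis by simp
qed

definition post :: "'h \<Rightarrow> 'h measure" where
  "post v = density \<mu> (\<lambda>u. ennreal (tilt T t v u / Z v))"

lemma post_prob_space: "prob_space (post v)"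
proof (rule prob_spaceI)
  have "emeasure (post v) (space (post v)) = (\<integral>\<^sup>+u. ennreal (tilt T t v u / Z v) \<partial>\<mu>)"
    unfolding post_def by (simp add: emeasure_density cong: nn_integral_cong)
  also have "\<dots> = ennreal (\<integral>u. tilt T t v u / Z v \<partial>\<mu>)"
    using tilt_integrable by (intro nn_integral_eq_integral) (auto intro!: AE_I2 divide_nonneg_pos less_imp_le[OF tilt_pos] Z_pos)
  also have "\<dots> = 1" using Z_pos[of v] by (simp flip: Z_def)
  finally show "emeasure (post v) (space (post v)) = 1" .
qed

lemma post_sets [simp, measurable_cong]: "sets (post v) = sets \<mu>"
  by (simp add: post_def)

lemma post_integral:
  fixes f :: "'h \<Rightarrow> real"
  assumes [measurable]: "f \<in> borel_measurable \<mu>"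
  shows "(\<integral>u. f u \<partial>post v) = (\<integral>u. tilt T t v u * f u \<partial>\<mu>) / Z v"
proof -
  have "(\<integral>u. f u \<partial>post v) = (\<integral>u. tilt T t v u / Z v * f u \<partial>\<mu>)"
    unfolding post_def
    by (subst integral_real_density) (auto intro!: AE_I2 divide_nonneg_pos less_imp_le[OF tilt_pos] Z_pos)
  then show ?thesis by simp
qed

text \<open>With \<open>x = z - y\<close> the difference is at most \<open>exp (u \<bullet> t y) *
  \<bar>exp (u \<bullet> t x) - 1\<bar>\<close>, since the quadratic factor is at most 1. Young's
  inequality with weight \<open>a\<close> splits the product into two squares whose prior integrals
  are known in closed form.\<close>

lemma tilt_continuous:
  assumes e: "e > 0"
  shows "\<exists>d>0. \<forall>z. norm (z - y) < d \<longrightarrow> (\<integral>u. \<bar>tilt T t z u - tilt T t y u\<bar> \<partial>\<mu>) < e"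
proof -
  define A where "A = exp (q ((2 * t) *\<^sub>R y) / 2)"
  \<comment> \<open>This weight makes the first half of Young's bound integrate to exactly
    \<open>e / 2\<close>; the increment must then make the second half smaller.\<close>
  define a where "a = e / A"
  have A: "A > 0" by (simp add: A_def)
  have a: "a > 0" "a * A = e" using e A by (auto simp: a_def)
  \<comment> \<open>The prior integral of \<open>(exp (u \<bullet> t d) - 1)^2\<close>,
    expanded.\<close>
  define k where "k d = exp (q ((2 * t) *\<^sub>R d) / 2) - 2 * exp (q (t *\<^sub>R d) / 2) + 1" for d
  have k0: "k 0 = 0" by (simp add: k_def)
  have "isCont k 0"
    unfolding k_def[abs_def] q_scaleR
    by (intro continuous_intros Q.continuous) simp_all
  then have "k \<midarrow>0\<rightarrow> 0" by (simp add: isCont_def k0)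
  then obtain d where d: "d > 0" "\<And>x. x \<noteq> 0 \<Longrightarrow> norm x < d \<Longrightarrow> \<bar>k x\<bar> < a * e"
    using LIM_D[of k 0 0 "a * e"] a e by auto
  have d': "\<bar>k x\<bar> < a * e" if "norm x < d" for x
    using d(2)[OF _ that] k0 a(1) e by (cases "x = 0") auto
  have "(\<integral>u. \<bar>tilt T t z u - tilt T t y u\<bar> \<partial>\<mu>) < e" if "norm (z - y) < d" for z
  proof -
    define x where "x = z - y"
    let ?g = "\<lambda>u. (a * exp (u \<bullet> ((2 * t) *\<^sub>R y)) + (exp (u \<bullet> ((2 * t) *\<^sub>R x)) - 2 * exp (u \<bullet> (t *\<^sub>R x)) + 1) / a) / 2"
    have g_int: "integrable \<mu> ?g" by (intro integrable_divide_zero Bochner_Integration.integrable_add Bochner_Integration.integrable_diff integrable_mult_right prior_exp integrable_const)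
    have le: "\<bar>tilt T t z u - tilt T t y u\<bar> \<le> ?g u" for u
    proof -
      let ?Y = "exp (u \<bullet> (t *\<^sub>R y))" and ?D = "exp (u \<bullet> (t *\<^sub>R x))"
      let ?b = "exp (- (t / 2) * (norm (T u))\<^sup>2)"
      have "tilt T t z u - tilt T t y u = ?b * (?Y * (?D - 1))"
        by (simp add: tilt_def x_def exp_add right_diff_distrib inner_diff_right inner_commute flip: exp_add)
      then have "\<bar>tilt T t z u - tilt T t y u\<bar> = ?b * \<bar>?Y * (?D - 1)\<bar>" by (simp add: abs_mult)
      also have "\<dots> \<le> 1 * \<bar>?Y * (?D - 1)\<bar>" using t_pos by (intro mult_right_mono) auto
      also have "\<dots> = ?Y * \<bar>?D - 1\<bar>" by (simp add: abs_mult)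
      also have "\<dots> \<le> (a * ?Y\<^sup>2 + (?D - 1)\<^sup>2 / a) / 2"
      proof -
        have "0 \<le> (a * ?Y - \<bar>?D - 1\<bar>)\<^sup>2 / a" using a by simp
        also have "\<dots> = a * ?Y\<^sup>2 + (?D - 1)\<^sup>2 / a - 2 * (?Y * \<bar>?D - 1\<bar>)"
          using a by (simp add: power2_diff field_simps power2_eq_square)
        finally show ?thesis by simp
      qed
      also have "\<dots> = ?g u"
      proof -
        have sq: "(exp (u \<bullet> (t *\<^sub>R p)))\<^sup>2 = exp (u \<bullet> ((2 * t) *\<^sub>R p))" for p
          by (simp add: power2_eq_square mult_exp_exp)
        show ?thesis unfolding power2_diff sq by simp
      qed
      finally show ?thesis .
    qed
    have "(\<integral>u. \<bar>tilt T t z u - tilt T t y u\<bar> \<partial>\<mu>) \<le> (\<integral>u. ?g u \<partial>\<mu>)"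
      by (intro integral_mono integrable_abs Bochner_Integration.integrable_diff tilt_integrable g_int le)
    also have "\<dots> = (a * A + k x / a) / 2"
      unfolding A_def k_def
      by (simp add: prior_exp prob_space del: inner_scaleR_right)
    also have "\<dots> < e"
    proof -
      have "k x / a < e" using d'[of x] that a(1) by (simp add: x_def field_simps)
      then show ?thesis using a(2) by simp
    qed
    finally show ?thesis .
  qed
  then show ?thesis using d by blast
qed

lemma hellinger_continuous:
  assumes e: "e > 0"
  shows "\<exists>d>0. \<forall>z. norm (z - y) < d \<longrightarrow> hellinger_dist \<mu> (post z) (post y) < e"
proof -
  \<comment> \<open>Numerator and normalising constant each contribute an L1 error over
    \<open>Z y\<close>, so the normalised densities differ by less than \<open>2 * e^2\<close>; the
    factor 1/2 in the Hellinger distance cancels the 2.\<close>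
  have "e\<^sup>2 * Z y > 0" using e Z_pos by simp
  from tilt_continuous[OF this, of y] obtain d where d: "d > 0"
    "\<And>z. norm (z - y) < d \<Longrightarrow> (\<integral>u. \<bar>tilt T t z u - tilt T t y u\<bar> \<partial>\<mu>) < e\<^sup>2 * Z y" by blast
  have "hellinger_dist \<mu> (post z) (post y) < e" if z: "norm (z - y) < d" for z
  proof -
    let ?I = "\<integral>u. \<bar>tilt T t z u - tilt T t y u\<bar> \<partial>\<mu>"
    note int = tilt_integrable[of z] tilt_integrable[of y]
    have Zd: "\<bar>Z z - Z y\<bar> \<le> ?I"
    proof -
      have "Z z - Z y = (\<integral>u. tilt T t z u - tilt T t y u \<partial>\<mu>)" unfolding Z_def by (rule Bochner_Integration.integral_diff[symmetric]; fact)
      then show ?thesis using integral_norm_bound[of \<mu> "\<lambda>u. tilt T t z u - tilt T t y u"] by simp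
    qed
    have le: "\<bar>tilt T t z u / Z z - tilt T t y u / Z y\<bar> \<le>
        \<bar>tilt T t z u - tilt T t y u\<bar> / Z y + tilt T t z u * (\<bar>Z z - Z y\<bar> / (Z z * Z y))" for u
    proof -
      have eq: "tilt T t z u / Z z - tilt T t y u / Z y =
          (tilt T t z u - tilt T t y u) / Z y - tilt T t z u * ((Z z - Z y) / (Z z * Z y))"
        using Z_pos[of z] Z_pos[of y] by (simp add: field_simps)
      show ?thesis
        using abs_triangle_ineq4[of "(tilt T t z u - tilt T t y u) / Z y" "tilt T t z u * ((Z z - Z y) / (Z z * Z y))"]
        by (simp only: eq abs_mult abs_divide abs_of_pos[OF tilt_pos] abs_of_pos[OF Z_pos])
    qed
    have "(\<integral>u. \<bar>tilt T t z u / Z z - tilt T t y u / Z y\<bar> \<partial>\<mu>) \<le>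
        (\<integral>u. \<bar>tilt T t z u - tilt T t y u\<bar> / Z y + tilt T t z u * (\<bar>Z z - Z y\<bar> / (Z z * Z y)) \<partial>\<mu>)"
      by (intro integral_mono integrable_abs Bochner_Integration.integrable_diff Bochner_Integration.integrable_add
          integrable_divide_zero integrable_mult_left int le)
    also have "\<dots> = ?I / Z y + Z z * (\<bar>Z z - Z y\<bar> / (Z z * Z y))"
    proof (subst Bochner_Integration.integral_add)
      show "integrable \<mu> (\<lambda>u. \<bar>tilt T t z u - tilt T t y u\<bar> / Z y)"
        by (intro integrable_divide_zero integrable_abs Bochner_Integration.integrable_diff int)
    qed (use int in \<open>auto simp: Z_def\<close>)
    also have "\<dots> \<le> 2 * ?I / Z y"
      using Zd Z_pos[of z] Z_pos[of y] by (simp add: field_simps)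
    also have "\<dots> < 2 * e\<^sup>2" using d(2)[OF z] Z_pos[of y] by (simp add: field_simps)
    finally have I: "(\<integral>u. \<bar>tilt T t z u / Z z - tilt T t y u / Z y\<bar> \<partial>\<mu>) < 2 * e\<^sup>2" .
    have "hellinger_dist \<mu> (post z) (post y) \<le> sqrt (1 / 2 * (\<integral>u. \<bar>tilt T t z u / Z z - tilt T t y u / Z y\<bar> \<partial>\<mu>))"
      unfolding post_def
      by (rule hellinger_dist_density_le)
        (use int in \<open>auto intro!: divide_nonneg_pos less_imp_le[OF tilt_pos] Z_pos sigma_finite_measure_axioms\<close>)
    also have "\<dots> < sqrt (e\<^sup>2)" using I by (intro real_sqrt_less_mono) simp
    finally show ?thesis using e by simp
  qed
  then show ?thesis using d(1) by blast
qed


text \<open>The factor \<open>exp (- t |T (u - m)|\<^sup>2 / 2)\<close> is the characteristic function of the Gaussian vector \<open>V\<close>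
  with covariance \<open>T* T\<close>. Integrating first over the prior shows that around its mean \<open>m\<close> the tilted
  measure has one-dimensional characteristic functions no smaller than those of the prior; hence its
  variances are no larger.\<close>

lemma post_variance_le:
  fixes V :: "'w \<Rightarrow> 'h"
  assumes M: "prob_space M" and V [measurable]: "V \<in> borel_measurable M"
    and V_cos: "\<And>u s \<theta>. (\<integral>w. cos (s * (V w \<bullet> u) + \<theta>) \<partial>M) = exp (- (s\<^sup>2 * (norm (T u))\<^sup>2 / 2)) * cos \<theta>"
    and g: "\<And>u. g \<bullet> u = t * (v \<bullet> u) - t * (T m \<bullet> T u)" and m: "Q g = m"
  shows "(\<integral>\<^sup>+u. ennreal (((u - m) \<bullet> x)\<^sup>2) \<partial>post v) \<le> ennreal (q x)"
proof (rule second_moment_le_of_cos[OF post_prob_space])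
  interpret M: prob_space M by fact
  interpret P: pair_prob_space \<mu> M ..
  define K where "K = exp (t / 2 * (norm (T m))\<^sup>2) * exp (q g / 2)"
  have K: "K > 0" by (simp add: K_def)
  \<comment> \<open>Total frequency: the random one, which encodes the quadratic factor, plus the
    frequency \<open>s *\<^sub>R x\<close> being tested.\<close>
  define a where "a s w = sqrt t *\<^sub>R V w + s *\<^sub>R x" for s w
  have [measurable]: "(\<lambda>u. u \<bullet> y) \<in> borel_measurable \<mu>" for y by (rule inner_meas)
  have Q_meas: "Q \<in> borel_measurable borel"
    by (intro borel_measurable_continuous_onI linear_continuous_on Q_bl)
  have [measurable]: "a s \<in> borel_measurable M" for s unfolding a_def by measurable
  have [measurable]: "(\<lambda>w. q (a s w)) \<in> borel_measurable M" for s
    using Q_meas by measurable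
  define h where "h s w = exp (- q (a s w) / 2)" for s w
  have [measurable]: "h s \<in> borel_measurable M" for s unfolding h_def by measurable
  \<comment> \<open>Completing the square at \<open>m\<close> leaves the linear term
    \<open>u \<bullet> g\<close>. The condition \<open>Q g = m\<close> makes \<open>m\<close> the
    right centre: it cancels the phase after the prior integration.\<close>
  have tilt_eq: "tilt T t v u = exp (t / 2 * (norm (T m))\<^sup>2) * (exp (u \<bullet> g) * exp (- (t / 2) * (norm (T (u - m)))\<^sup>2))" for u
  proof -
    have "(norm (T (u - m)))\<^sup>2 = (norm (T u))\<^sup>2 - 2 * (T m \<bullet> T u) + (norm (T m))\<^sup>2"
      unfolding power2_norm_eq_inner
      by (simp add: T.diff inner_diff_left inner_diff_right inner_commute)
    note n2 = this
    have "u \<bullet> g = t * (v \<bullet> u) - t * (T m \<bullet> T u)" using g[of u] by (simp add: inner_commute)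
    then have "- (t / 2) * (norm (T u))\<^sup>2 + t * (v \<bullet> u) =
        t / 2 * (norm (T m))\<^sup>2 + (u \<bullet> g + - (t / 2) * (norm (T (u - m)))\<^sup>2)"
      unfolding n2 by (simp add: field_simps)
    then show ?thesis by (simp only: tilt_def exp_add)
  qed
  have char: "(\<integral>u. tilt T t v u * cos (s * ((u - m) \<bullet> x)) \<partial>\<mu>) = K * (\<integral>w. h s w \<partial>M)" for s
  proof -
    let ?f = "\<lambda>u w. exp (u \<bullet> g) * cos (u \<bullet> a s w + - (m \<bullet> a s w))"
    have f_meas [measurable]: "case_prod ?f \<in> borel_measurable (\<mu> \<Otimes>\<^sub>M M)" by measurable
    have bd: "integrable (\<mu> \<Otimes>\<^sub>M M) (\<lambda>(u, w). exp (u \<bullet> g))"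
      by (rule P.Fubini_integrable) (auto simp: M.prob_space prior_exp)
    have int: "integrable (\<mu> \<Otimes>\<^sub>M M) (case_prod ?f)"
      by (rule Bochner_Integration.integrable_bound[OF bd]) (auto simp: abs_mult intro!: AE_I2 mult_left_le)
    have "tilt T t v u * cos (s * ((u - m) \<bullet> x)) = exp (t / 2 * (norm (T m))\<^sup>2) * (\<integral>w. ?f u w \<partial>M)" for u
    proof -
      have "(\<integral>w. ?f u w \<partial>M) = exp (u \<bullet> g) * (\<integral>w. cos (sqrt t * (V w \<bullet> (u - m)) + s * ((u - m) \<bullet> x)) \<partial>M)"
        by (simp add: a_def inner_add_right inner_diff_left inner_diff_right inner_commute algebra_simps)
      also have "\<dots> = exp (u \<bullet> g) * (exp (- (t / 2) * (norm (T (u - m)))\<^sup>2) * cos (s * ((u - m) \<bullet> x)))"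
        unfolding V_cos using t_pos by simp
      finally show ?thesis by (simp add: tilt_eq)
    qed
    then have "(\<integral>u. tilt T t v u * cos (s * ((u - m) \<bullet> x)) \<partial>\<mu>) =
        exp (t / 2 * (norm (T m))\<^sup>2) * (\<integral>u. (\<integral>w. ?f u w \<partial>M) \<partial>\<mu>)" by simp
    also have "(\<integral>u. (\<integral>w. ?f u w \<partial>M) \<partial>\<mu>) = (\<integral>w. (\<integral>u. ?f u w \<partial>\<mu>) \<partial>M)"
      by (rule P.Fubini_integral[OF int, symmetric])
    also have "\<dots> = (\<integral>w. exp (q g / 2) * h s w \<partial>M)"
    proof (rule Bochner_Integration.integral_cong[OF refl])
      fix w
      have "Q (a s w) \<bullet> g = m \<bullet> a s w"
        using self_adjointD[OF Q_sa, of "a s w" g] by (simp add: m inner_commute)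
      then show "(\<integral>u. ?f u w \<partial>\<mu>) = exp (q g / 2) * h s w"
        unfolding prior_exp_cos by (simp add: h_def diff_divide_distrib flip: exp_add)
    qed
    finally show ?thesis by (simp add: K_def)
  qed
  have exp_int: "integrable M (h s)" for s
    by (rule M.integrable_const_bound[where B = 1]) (auto simp: h_def q_nonneg intro!: AE_I2)
  define E where "E s = (\<integral>w. h s w \<partial>M)" for s
  \<comment> \<open>Evenness is inherited from the cosine through \<open>char\<close>.\<close>
  have E_sym: "E (- s) = E s" for s
  proof -
    have "K * E (- s) = K * E s" unfolding E_def char[symmetric] by simp
    then show ?thesis using K by simp
  qed
  \<comment> \<open>Averaging over \<open>s\<close> and \<open>- s\<close> removes the cross term
    between \<open>V w\<close> and \<open>x\<close>: the parallelogram identity gives the exponent,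
    and the exponential of a mean is at most the mean of the exponentials.\<close>
  have E_ge: "exp (- (s\<^sup>2 * q x / 2)) * E 0 \<le> E s" for s
  proof -
    have "exp (- (s\<^sup>2 * q x / 2)) * E 0 = (\<integral>w. exp (- (s\<^sup>2 * q x / 2)) * h 0 w \<partial>M)"
      by (simp add: E_def)
    also have "\<dots> \<le> (\<integral>w. (h s w + h (- s) w) / 2 \<partial>M)"
    proof (intro integral_mono)
      fix w
      have AM: "exp ((c + d) / 2) \<le> (exp c + exp d) / 2" for c d :: real
      proof -
        have "0 \<le> (exp (c / 2) - exp (d / 2))\<^sup>2" by simp
        then show ?thesis by (simp add: power2_eq_square algebra_simps add_divide_distrib flip: exp_add)
      qed
      have "q (a s w) + q (a (- s) w) = 2 * q (a 0 w) + 2 * (s\<^sup>2 * q x)"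
        unfolding a_def q_add q_scaleR by simp
      then have "exp (- (s\<^sup>2 * q x / 2)) * h 0 w = exp ((- q (a s w) / 2 + - q (a (- s) w) / 2) / 2)"
        by (simp add: h_def field_simps flip: exp_add)
      also have "\<dots> \<le> (h s w + h (- s) w) / 2" unfolding h_def by (rule AM)
      finally show "exp (- (s\<^sup>2 * q x / 2)) * h 0 w \<le> (h s w + h (- s) w) / 2" .
    qed (intro integrable_mult_right integrable_divide_zero Bochner_Integration.integrable_add exp_int)+
    also have "\<dots> = (E s + E (- s)) / 2"
      unfolding E_def using exp_int by simp
    finally show ?thesis by (simp add: E_sym)
  qed
  have Z_eq: "Z v = K * E 0"
    using char[of 0] by (simp add: Z_def E_def)
  show "(\<lambda>u. (u - m) \<bullet> x) \<in> borel_measurable (post v)" by (simp add: inner_diff_left)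
  fix s
  have "K * E 0 > 0" using Z_pos[of v] unfolding Z_eq .
  then have "exp (- (s\<^sup>2 * q x / 2)) = exp (- (s\<^sup>2 * q x / 2)) * (K * E 0) / Z v"
    unfolding Z_eq by (intro nonzero_mult_div_cancel_right[symmetric]) linarith
  also have "\<dots> \<le> K * E s / Z v"
    using E_ge[of s] K Z_pos[of v] by (intro divide_right_mono) (auto simp: mult_ac)
  also have "\<dots> = (\<integral>u. cos (s * ((u - m) \<bullet> x)) \<partial>post v)"
    by (subst post_integral) (auto simp: inner_diff_left char[unfolded inner_diff_left, folded E_def])
  finally show "exp (- (s\<^sup>2 * q x / 2)) \<le> (\<integral>u. cos (s * ((u - m) \<bullet> x)) \<partial>post v)" .
qed

lemma post_tail_le:
  assumes onb: "orthonormal_basis \<phi>" and tr: "summable (\<lambda>j. q (\<phi> j))" and e: "e > 0"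
    and var: "\<And>x. (\<integral>\<^sup>+u. ennreal (((u - m) \<bullet> x)\<^sup>2) \<partial>post v) \<le> ennreal (q x)"
  shows "measure (post v) {u. norm (u - m) > e} \<le> (\<Sum>j. q (\<phi> j)) / e\<^sup>2"
proof -
  have [measurable]: "(\<lambda>u. u - m) \<in> borel_measurable (post v)"
    unfolding measurable_cong_sets[OF post_sets refl] prior_meas by measurable
  have "space (post v) = UNIV" using sets_eq_imp_space_eq[OF sets_prior] by (simp add: post_def)
  then show ?thesis
    using norm_tail_le[OF post_prob_space _ onb q_nonneg tr var e] by simp
qed

end

section \<open>The posterior mean\<close>

definition adj :: "(nat \<Rightarrow> 'h::real_inner) \<Rightarrow> ('h \<Rightarrow> 'h) \<Rightarrow> 'h \<Rightarrow> 'h" where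
  "adj \<phi> T w = (\<Sum>j. (w \<bullet> T (\<phi> j)) *\<^sub>R \<phi> j)"

text \<open>Summability of \<open>norm (T (\<phi> j))\<close> makes the coefficients of
  \<open>adj\<close> square-summable, so its series converges; the adjoint identity then follows
  from the expansion of \<open>u\<close>.\<close>

lemma adj_inner:
  fixes \<phi> :: "nat \<Rightarrow> 'h::{real_inner,banach}"
  assumes onb: "orthonormal_basis \<phi>" and T: "bounded_linear T" and s: "summable (\<lambda>j. norm (T (\<phi> j)))"
  shows "adj \<phi> T w \<bullet> u = w \<bullet> T u"
proof -
  interpret T: bounded_linear T by fact
  have sq: "summable (\<lambda>j. (w \<bullet> T (\<phi> j))\<^sup>2)"
  proof (rule summable_comparison_test')
    \<comment> \<open>One factor \<open>norm (T (\<phi> j))\<close> of the square is replaced by the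
      whole sum; the other keeps the series summable.\<close>
    define b where "b = norm w * (norm w * (\<Sum>j. norm (T (\<phi> j))))"
    show "summable (\<lambda>j. b * norm (T (\<phi> j)))" by (intro summable_mult s)
    show "norm ((w \<bullet> T (\<phi> j))\<^sup>2) \<le> b * norm (T (\<phi> j))" for j
    proof -
      have "norm (T (\<phi> j)) \<le> (\<Sum>j. norm (T (\<phi> j)))"
        using sum_le_suminf[OF s, of "{j}"] by simp
      then have "norm w * norm (T (\<phi> j)) \<le> norm w * (\<Sum>j. norm (T (\<phi> j)))" by (intro mult_left_mono) auto
      moreover have "\<bar>w \<bullet> T (\<phi> j)\<bar> \<le> norm w * norm (T (\<phi> j))" by (rule Cauchy_Schwarz_ineq2)
      ultimately have "\<bar>w \<bullet> T (\<phi> j)\<bar> * \<bar>w \<bullet> T (\<phi> j)\<bar> \<le> (norm w * (\<Sum>j. norm (T (\<phi> j)))) * (norm w * norm (T (\<phi> j)))"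
        by (intro mult_mono) auto
      then show ?thesis by (simp add: b_def power2_eq_square mult_ac)
    qed
  qed
  have "(\<lambda>j. w \<bullet> T ((u \<bullet> \<phi> j) *\<^sub>R \<phi> j)) sums (w \<bullet> T u)"
    by (intro bounded_linear.sums[OF bounded_linear_inner_right] T.sums onb_expansion onb)
  moreover have "(\<lambda>j. (adj \<phi> T w \<bullet> \<phi> j) * (u \<bullet> \<phi> j)) sums (adj \<phi> T w \<bullet> u)"
    by (rule onb_inner_sums[OF onb])
  moreover have "adj \<phi> T w \<bullet> \<phi> j = w \<bullet> T (\<phi> j)" for j
    unfolding adj_def by (rule riesz_fischer(2)[OF onb sq])
  ultimately show ?thesis by (simp add: T.scaleR mult.commute sums_unique2)
qed

lemma inner_eqI: "(\<And>u. x \<bullet> u = y \<bullet> u) \<Longrightarrow> x = y" for x y :: "'h::real_inner"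
  by (metis inner_commute vector_eq_ldot)

lemma adj_bounded_linear:
  fixes \<phi> :: "nat \<Rightarrow> 'h::{real_inner,banach}"
  assumes onb: "orthonormal_basis \<phi>" and T: "bounded_linear T" and s: "summable (\<lambda>j. norm (T (\<phi> j)))"
  shows "bounded_linear (adj \<phi> T)"
proof -
  note adj = adj_inner[OF assms]
  interpret T: bounded_linear T by fact
  obtain K where K: "\<And>x. norm (T x) \<le> norm x * K" using T.bounded by blast
  show ?thesis
  proof (rule bounded_linear_intro[where K = K])
    fix w
    have "norm (adj \<phi> T w) * norm (adj \<phi> T w) = w \<bullet> T (adj \<phi> T w)"
      by (simp add: adj flip: power2_norm_eq_inner power2_eq_square)
        (simp add: power2_norm_eq_inner adj)
    also have "\<dots> \<le> norm w * (norm (adj \<phi> T w) * K)"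
      by (rule order_trans[OF norm_cauchy_schwarz]) (intro mult_left_mono K norm_ge_zero)
    finally show "norm (adj \<phi> T w) \<le> norm w * K"
    proof (cases "norm (adj \<phi> T w) = 0")
      case True
      have "0 \<le> norm w * K" using K[of w] norm_ge_zero[of "T w"] by linarith
      then show ?thesis using True by simp
    next
      case False
      assume "norm (adj \<phi> T w) * norm (adj \<phi> T w) \<le> norm w * (norm (adj \<phi> T w) * K)"
      then have "norm (adj \<phi> T w) * norm (adj \<phi> T w) \<le> (norm w * K) * norm (adj \<phi> T w)"
        by (simp add: mult_ac)
      then show ?thesis using False by (simp add: mult_le_cancel_right)
    qed
  qed (rule inner_eqI, simp add: adj inner_add_left)+
qed

text \<open>\<open>l\<close> are the eigenvalues of the prior covariance before scaling by \<open>1 / \<rho>\<close>, with \<open>\<rho> = R\<^sub>n\<^sup>2\<close>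
  and \<open>t = n\<close>; \<open>S\<close> is the square root of the covariance.\<close>

locale ridge =
  fixes \<phi> :: "nat \<Rightarrow> 'h::{real_inner,banach,second_countable_topology}"
    and l :: "nat \<Rightarrow> real" and lmax :: real and T :: "'h \<Rightarrow> 'h" and \<rho> t :: real
  assumes onb: "orthonormal_basis \<phi>"
    and l_pos: "\<And>j. l j > 0" and l_le: "\<And>j. l j \<le> lmax"
    and T_bl: "bounded_linear T" and T_summable: "summable (\<lambda>j. norm (T (\<phi> j)))"
    and \<rho>_pos: "\<rho> > 0" and t_pos: "t > 0"
begin

sublocale T: bounded_linear T by (rule T_bl)

abbreviation Ta :: "'h \<Rightarrow> 'h" where "Ta \<equiv> adj \<phi> T"

lemmas Ta_inner = adj_inner[OF onb T_bl T_summable]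

sublocale Ta: bounded_linear Ta by (rule adj_bounded_linear[OF onb T_bl T_summable])

definition S :: "'h \<Rightarrow> 'h" where "S = eig_op \<phi> (\<lambda>j. sqrt (l j))"

lemma sqrt_l: "\<bar>sqrt (l j)\<bar> \<le> sqrt lmax"
  using l_pos[of j] l_le[of j] by simp

lemma S_bl: "bounded_linear S" and S_sa: "self_adjoint S"
  unfolding S_def by (rule eig_op_bounded[OF onb sqrt_l])+

sublocale S: bounded_linear S by (rule S_bl)

lemma S_inner: "S x \<bullet> \<phi> j = sqrt (l j) * (x \<bullet> \<phi> j)"
  unfolding S_def by (rule eig_op_bounded_inner[OF onb sqrt_l])

lemma S_basis: "S (\<phi> j) = sqrt (l j) *\<^sub>R \<phi> j"
  unfolding S_def by (rule eig_op_basis(2)[OF onb])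

lemma S_sym: "S x \<bullet> y = x \<bullet> S y"
  by (rule self_adjointD[OF S_sa])

text \<open>The Tikhonov normal operator in the whitened variable \<open>u = S w\<close>. The
  penalty becomes \<open>\<rho> |w|^2\<close>, so the unbounded inverse of the covariance never
  appears and \<open>D\<close> is bounded and coercive.\<close>

definition D :: "'h \<Rightarrow> 'h" where "D w = \<rho> *\<^sub>R w + t *\<^sub>R S (Ta (T (S w)))"

lemma D_inner: "D w \<bullet> x = \<rho> * (w \<bullet> x) + t * (T (S w) \<bullet> T (S x))"
  by (simp add: D_def inner_add_left S_sym Ta_inner)

lemma D_bl: "bounded_linear D"
  unfolding D_def
  by (intro bounded_linear_add bounded_linear_scaleR_right bounded_linear_const_scaleR
      bounded_linear_compose[OF S_bl] bounded_linear_compose[OF Ta.bounded_linear_axioms]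
      bounded_linear_compose[OF T_bl] bounded_linear_ident S_bl)

sublocale D: bounded_linear D by (rule D_bl)

lemma D_coercive: "D x \<bullet> x \<ge> \<rho> * (norm x)\<^sup>2"
  unfolding D_inner using t_pos by (simp add: power2_norm_eq_inner)

lemma D_inj: "inj D"
proof (rule injI)
  fix x y assume "D x = D y"
  then have "\<rho> * (norm (x - y))\<^sup>2 \<le> 0" using D_coercive[of "x - y"] by (simp add: D.diff)
  then show "x = y" using \<rho>_pos by (simp add: mult_le_0_iff)
qed

definition W :: "'h \<Rightarrow> 'h" where "W = inv D"

lemma D_W [simp]: "D (W y) = y"
proof -
  have "surj D" using coercive_surj[OF D_bl \<rho>_pos D_coercive] by (metis surjI surj_def)
  then show ?thesis unfolding W_def by (rule surj_f_inv_f)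
qed

lemma W_eqI: "D x = y \<Longrightarrow> W y = x"
  unfolding W_def by (rule inv_f_eq[OF D_inj])

lemma norm_W_le: "\<rho> * norm (W y) \<le> norm y"
proof -
  have "\<rho> * norm (W y) * norm (W y) \<le> norm y * norm (W y)"
    using D_coercive[of "W y"] norm_cauchy_schwarz[of y "W y"] by (simp add: power2_eq_square)
  then show ?thesis by (cases "norm (W y) = 0") (auto simp: mult_le_cancel_right)
qed

lemma W_bl: "bounded_linear W"
proof (rule bounded_linear_intro[where K = "1 / \<rho>"])
  show "norm (W x) \<le> norm x * (1 / \<rho>)" for x
    using norm_W_le[of x] \<rho>_pos by (simp add: field_simps)
qed (auto intro!: W_eqI simp: D.add D.scaleR)

sublocale W: bounded_linear W by (rule W_bl)

lemma W_sym: "W x \<bullet> y = x \<bullet> W y"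
proof -
  have "D (W x) \<bullet> W y = W x \<bullet> D (W y)"
    using D_inner[of "W x" "W y"] D_inner[of "W y" "W x"] by (simp add: inner_commute)
  then show ?thesis by simp
qed

text \<open>Test \<open>D (W y) = y\<close> with \<open>W y\<close> and discard the penalty. This is
  what bounds the noise part of the posterior mean by the prior variance.\<close>

lemma W_energy: "t * (norm (T (S (W y))))\<^sup>2 \<le> (norm y)\<^sup>2 / \<rho>"
proof -
  have "t * (norm (T (S (W y))))\<^sup>2 \<le> D (W y) \<bullet> W y"
    unfolding D_inner using \<rho>_pos by (simp add: power2_norm_eq_inner)
  also have "\<dots> \<le> norm y * norm (W y)" using norm_cauchy_schwarz by simp
  also have "\<dots> \<le> norm y * (norm y / \<rho>)"
    using norm_W_le[of y] \<rho>_pos by (intro mult_left_mono) (auto simp: field_simps)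
  finally show ?thesis by (simp add: power2_eq_square)
qed

definition mean :: "'h \<Rightarrow> 'h" where "mean v = t *\<^sub>R S (W (S v))"

lemma mean_bl: "bounded_linear mean"
  unfolding mean_def[abs_def]
  by (intro bounded_linear_const_scaleR bounded_linear_compose[OF S_bl] bounded_linear_compose[OF W_bl] S_bl)

text \<open>Since \<open>S\<close> squared over \<open>\<rho>\<close> is the prior covariance, this
  is the condition \<open>Q g = m\<close> of \<open>post_variance_le\<close>.\<close>

lemma mean_fixpoint: "(1 / \<rho>) *\<^sub>R S (S (t *\<^sub>R (v - Ta (T (mean v))))) = mean v"
proof -
  have "\<rho> *\<^sub>R W (S v) = S v - t *\<^sub>R S (Ta (T (S (W (S v)))))"
    using D_W[of "S v"] unfolding D_def by (simp add: eq_diff_eq)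
  also have "\<dots> = S (v - Ta (T (mean v)))"
    by (simp add: mean_def S.diff T.scaleR Ta.scaleR S.scaleR)
  finally have "S (v - Ta (T (mean v))) = \<rho> *\<^sub>R W (S v)" ..
  then show ?thesis using \<rho>_pos by (simp add: S.scaleR mean_def)
qed

text \<open>Self-adjointness moves the operator from \<open>V\<close> to the basis vector;
  \<open>W_energy\<close> at \<open>S (\<phi> j)\<close> then bounds the variance.\<close>

lemma mean_coord_energy:
  assumes V: "\<And>u. (\<integral>\<^sup>+w. ennreal ((V w \<bullet> u)\<^sup>2) \<partial>M) \<le> ennreal ((norm (T u))\<^sup>2)"
    and [measurable]: "V \<in> borel_measurable M"
  shows "(\<integral>\<^sup>+w. ennreal ((mean ((1 / sqrt t) *\<^sub>R V w) \<bullet> \<phi> j)\<^sup>2) \<partial>M) \<le> ennreal (l j / \<rho>)"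
proof -
  have eq: "(mean ((1 / sqrt t) *\<^sub>R V w) \<bullet> \<phi> j)\<^sup>2 = t * (V w \<bullet> S (W (S (\<phi> j))))\<^sup>2" for w
  proof -
    have "mean ((1 / sqrt t) *\<^sub>R V w) \<bullet> \<phi> j = t / sqrt t * (V w \<bullet> S (W (S (\<phi> j))))"
      by (simp add: mean_def S.scaleR W.scaleR S_sym W_sym)
    also have "t / sqrt t = sqrt t" using t_pos by (simp add: real_div_sqrt)
    finally show ?thesis using t_pos by (simp add: power_mult_distrib)
  qed
  have "(\<integral>\<^sup>+w. ennreal ((mean ((1 / sqrt t) *\<^sub>R V w) \<bullet> \<phi> j)\<^sup>2) \<partial>M) =
      ennreal t * (\<integral>\<^sup>+w. ennreal ((V w \<bullet> S (W (S (\<phi> j))))\<^sup>2) \<partial>M)"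
    unfolding eq using t_pos by (subst nn_integral_cmult[symmetric]) (auto simp: ennreal_mult)
  also have "\<dots> \<le> ennreal t * ennreal ((norm (T (S (W (S (\<phi> j))))))\<^sup>2)"
    by (intro mult_left_mono V) simp
  also have "\<dots> = ennreal (t * (norm (T (S (W (S (\<phi> j))))))\<^sup>2)"
    using t_pos by (simp add: ennreal_mult)
  also have "\<dots> \<le> ennreal ((norm (S (\<phi> j)))\<^sup>2 / \<rho>)"
    by (intro ennreal_leI W_energy)
  also have "(norm (S (\<phi> j)))\<^sup>2 = l j"
    using l_pos[of j] by (simp add: S_basis onb_norm[OF onb] power_mult_distrib)
  finally show ?thesis .
qed

lemma mean_noise_tail:
  assumes V: "\<And>u. (\<integral>\<^sup>+w. ennreal ((V w \<bullet> u)\<^sup>2) \<partial>M) \<le> ennreal ((norm (T u))\<^sup>2)"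
    and V_meas [measurable]: "V \<in> borel_measurable M" and M: "prob_space M"
    and l_sum: "summable l" and e: "e > 0"
  shows "measure M {w\<in>space M. norm (mean ((1 / sqrt t) *\<^sub>R V w)) > e} \<le> (\<Sum>j. l j) / (\<rho> * e\<^sup>2)"
proof -
  have "mean \<in> borel_measurable borel"
    by (intro borel_measurable_continuous_onI linear_continuous_on mean_bl)
  then have "(\<lambda>w. mean ((1 / sqrt t) *\<^sub>R V w)) \<in> borel_measurable M" by measurable
  moreover have "0 \<le> l j / \<rho>" for j using l_pos[of j] \<rho>_pos by simp
  ultimately show ?thesis
    using norm_tail_le[OF M _ onb _ summable_divide[OF l_sum] mean_coord_energy[OF V V_meas] e]
    by (simp add: suminf_divide[OF l_sum])
qed

text \<open>The bias is compared with that of the diagonal filter \<open>u\<^sub>j \<mapsto> r\<^sub>j / (1 + r\<^sub>j) u\<^sub>j\<close>, which would be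
  the exact one if \<open>T\<close> were diagonal with entries \<open>\<kappa>\<^sub>j\<close>.\<close>

lemma bias_bound:
  fixes \<kappa> w :: "nat \<Rightarrow> real" and u0 :: 'h
  defines "r \<equiv> \<lambda>j. t * (\<kappa> j)\<^sup>2 * l j / \<rho>"
  assumes \<kappa>: "\<And>j. \<bar>\<kappa> j\<bar> \<le> kmax"
    and c1: "c1 > 0" "\<And>z. c1 * norm (eig_op \<phi> \<kappa> z) \<le> norm (T z)"
    and c2: "\<And>z. norm (T z) \<le> c2 * norm (eig_op \<phi> \<kappa> z)"
    and P: "\<And>j. l j / (1 + r j) \<le> P"
    and A: "\<And>j. r j / (l j * (1 + r j)\<^sup>2) \<le> A * w j"
    and A': "\<And>j. 1 / (1 + r j)\<^sup>2 \<le> A' * w j"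
    and w: "summable (\<lambda>j. w j * (u0 \<bullet> \<phi> j)\<^sup>2)"
  defines "U \<equiv> (\<Sum>j. w j * (u0 \<bullet> \<phi> j)\<^sup>2)"
    and "c \<equiv> (c2\<^sup>2 + 1)\<^sup>2 / (2 * c1\<^sup>2) / min 1 (c1\<^sup>2 / 2)"
  shows "norm (mean (Ta (T u0)) - u0) \<le> sqrt (c * P * A * U) + sqrt (A' * U)"
proof -
  let ?k = "eig_op \<phi> \<kappa>"
  note k_inner = eig_op_bounded_inner[OF onb \<kappa>]
  have k_in: "?k x \<bullet> \<phi> j = \<kappa> j * (x \<bullet> \<phi> j)" for x j by (rule k_inner)
  have r0: "r j \<ge> 0" for j
    using t_pos \<rho>_pos l_pos[of j] by (simp add: r_def)
  have r1: "1 + r j > 0" for j using r0[of j] by linarith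
  \<comment> \<open>\<open>S\<close> maps the vector with coefficients
    \<open>b j * (u0 \<bullet> \<phi> j)\<close> to the output of the diagonal filter; the bound on
    \<open>b\<close> makes it a vector of H.\<close>
  define b where "b j = t * (\<kappa> j)\<^sup>2 * sqrt (l j) / (\<rho> * (1 + r j))" for j
  have kmax: "kmax \<ge> 0" using \<kappa>[of 0] by linarith
  have b: "\<bar>b j\<bar> \<le> t * kmax\<^sup>2 * sqrt lmax / \<rho>" for j
  proof -
    have "(\<kappa> j)\<^sup>2 \<le> kmax\<^sup>2" using \<kappa>[of j] kmax by (simp add: abs_le_square_iff[symmetric])
    then have "t * (\<kappa> j)\<^sup>2 * sqrt (l j) \<le> t * kmax\<^sup>2 * sqrt lmax"
      using t_pos l_le[of j] l_pos[of j] by (intro mult_mono) auto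
    moreover have "\<rho> * (1 + r j) \<ge> \<rho>" using \<rho>_pos r0[of j] by simp
    moreover have "0 \<le> t * kmax\<^sup>2 * sqrt lmax"
    proof -
      have "0 \<le> lmax" using l_pos[of j] l_le[of j] by linarith
      then show ?thesis using t_pos by simp
    qed
    ultimately have "t * (\<kappa> j)\<^sup>2 * sqrt (l j) / (\<rho> * (1 + r j)) \<le> t * kmax\<^sup>2 * sqrt lmax / \<rho>"
      using \<rho>_pos by (intro frac_le) auto
    moreover have "b j \<ge> 0" using t_pos \<rho>_pos l_pos[of j] r1[of j] by (simp add: b_def)
    ultimately show ?thesis by (simp only: b_def abs_of_nonneg)
  qed
  have d: "\<bar>1 / (1 + r j)\<bar> \<le> 1" for j using r0[of j] by simp
  define x where "x = t *\<^sub>R W (S (Ta (T u0)))"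
  \<comment> \<open>\<open>x\<close> and \<open>y\<close> are the whitened solutions of the true and
    of the diagonal problem, \<open>e\<close> is the bias of the diagonal one up to sign, and
    \<open>z\<close> is the discrepancy to be estimated.\<close>
  define y where "y = eig_op \<phi> b u0"
  define e where "e = eig_op \<phi> (\<lambda>j. 1 / (1 + r j)) u0"
  define z where "z = x - y"
  have y_in: "y \<bullet> \<phi> j = b j * (u0 \<bullet> \<phi> j)" for j
    unfolding y_def by (rule eig_op_bounded_inner[OF onb b])
  have e_in: "e \<bullet> \<phi> j = 1 / (1 + r j) * (u0 \<bullet> \<phi> j)" for j
    unfolding e_def by (rule eig_op_bounded_inner[OF onb d])
  have mean_x: "mean (Ta (T u0)) = S x" by (simp add: mean_def x_def S.scaleR)
  have Dx: "\<rho> * (x \<bullet> h) + t * (T (S x) \<bullet> T (S h)) = t * (T u0 \<bullet> T (S h))" for h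
  proof -
    have "D x = t *\<^sub>R S (Ta (T u0))" by (simp add: x_def D.scaleR)
    then show ?thesis using D_inner[of x h] by (simp add: S_sym Ta_inner)
  qed
  have lj: "sqrt (l j) * sqrt (l j) = l j" for j using l_pos[of j] by simp
  have u_y: "u0 - S y = e"
  proof (rule onb_eqI[OF onb])
    fix j
    have "sqrt (l j) * b j = r j / (1 + r j)"
      using lj[of j] \<rho>_pos r1[of j] by (simp add: b_def r_def mult_ac)
    then have "sqrt (l j) * (b j * (u0 \<bullet> \<phi> j)) = r j / (1 + r j) * (u0 \<bullet> \<phi> j)"
      by (simp only: mult.assoc[symmetric])
    then have "(u0 - S y) \<bullet> \<phi> j = (1 - r j / (1 + r j)) * (u0 \<bullet> \<phi> j)"
      by (simp only: inner_diff_left S_inner y_in left_diff_distrib mult_1)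
    also have "1 - r j / (1 + r j) = 1 / (1 + r j)" using r1[of j] by (simp add: field_simps)
    finally show "(u0 - S y) \<bullet> \<phi> j = e \<bullet> \<phi> j" by (simp add: e_in)
  qed
  \<comment> \<open>The normal equation of the diagonal problem, tested with
    \<open>z\<close>.\<close>
  have cross: "\<rho> * (y \<bullet> z) = t * (?k e \<bullet> ?k (S z))"
  proof -
    have "(\<lambda>j. \<rho> * ((y \<bullet> \<phi> j) * (z \<bullet> \<phi> j))) sums (\<rho> * (y \<bullet> z))"
      by (intro sums_mult onb_inner_sums onb)
    moreover have "(\<lambda>j. t * ((?k e \<bullet> \<phi> j) * (?k (S z) \<bullet> \<phi> j))) sums (t * (?k e \<bullet> ?k (S z)))"
      by (intro sums_mult onb_inner_sums onb)
    moreover have "\<rho> * ((y \<bullet> \<phi> j) * (z \<bullet> \<phi> j)) = t * ((?k e \<bullet> \<phi> j) * (?k (S z) \<bullet> \<phi> j))" for j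
    proof -
      have "\<rho> * b j = t * (\<kappa> j)\<^sup>2 * sqrt (l j) * (1 / (1 + r j))"
        using \<rho>_pos by (simp add: b_def)
      then have "(\<rho> * b j) * ((u0 \<bullet> \<phi> j) * (z \<bullet> \<phi> j)) =
          t * (\<kappa> j)\<^sup>2 * sqrt (l j) * (1 / (1 + r j)) * ((u0 \<bullet> \<phi> j) * (z \<bullet> \<phi> j))" by simp
      then show ?thesis unfolding y_in k_in e_in S_inner power2_eq_square by (simp only: mult_ac)
    qed
    ultimately show ?thesis by (simp add: sums_unique2)
  qed
  define E where "E = norm (?k e)"
  define F where "F = norm (?k (S z))"
  \<comment> \<open>Both normal equations are subtracted and tested with \<open>z\<close>. The two
    inner products on the right need not cancel, as only norms are comparable; they are bounded
    separately, which yields \<open>c2^2 + 1\<close>.\<close>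
  have energy: "\<rho> * (norm z)\<^sup>2 + t * (norm (T (S z)))\<^sup>2 \<le> t * ((c2\<^sup>2 + 1) * (E * F))"
  proof -
    have "\<rho> * (norm z)\<^sup>2 + t * (norm (T (S z)))\<^sup>2 =
        \<rho> * (x \<bullet> z) + t * (T (S x) \<bullet> T (S z)) - \<rho> * (y \<bullet> z) - t * (T (S y) \<bullet> T (S z))"
      by (simp add: power2_norm_eq_inner z_def S.diff T.diff inner_diff_left algebra_simps)
    also have "\<dots> = t * (T e \<bullet> T (S z)) - t * (?k e \<bullet> ?k (S z))"
      unfolding Dx cross by (simp add: T.diff inner_diff_left algebra_simps flip: u_y)
    also have "\<dots> = t * (T e \<bullet> T (S z) - ?k e \<bullet> ?k (S z))" by (simp add: right_diff_distrib)
    also have "\<dots> \<le> t * ((c2\<^sup>2 + 1) * (E * F))"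
    proof (rule mult_left_mono)
      have "T e \<bullet> T (S z) \<le> norm (T e) * norm (T (S z))" by (rule norm_cauchy_schwarz)
      also have "\<dots> \<le> (c2 * E) * (c2 * F)"
        unfolding E_def F_def by (intro mult_mono c2 order_trans[OF norm_ge_zero c2] norm_ge_zero)
      finally have "T e \<bullet> T (S z) \<le> c2\<^sup>2 * (E * F)" by (simp add: power2_eq_square mult_ac)
      moreover have "- (?k e \<bullet> ?k (S z)) \<le> E * F"
        using Cauchy_Schwarz_ineq2[of "?k e" "?k (S z)"] by (simp add: E_def F_def)
      ultimately show "T e \<bullet> T (S z) - ?k e \<bullet> ?k (S z) \<le> (c2\<^sup>2 + 1) * (E * F)"
        by (simp add: distrib_right)
    qed (use t_pos in simp)
    finally show ?thesis .
  qed
  define c3 where "c3 = (c2\<^sup>2 + 1)\<^sup>2 / (2 * c1\<^sup>2)"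
  define c4 where "c4 = min 1 (c1\<^sup>2 / 2)"
  have c4: "c4 > 0" "c4 \<le> 1" "c4 \<le> c1\<^sup>2 / 2" using c1(1) by (auto simp: c4_def)
  \<comment> \<open>Young's inequality absorbs half of the lower bound \<open>c1^2 * F^2\<close>;
    \<open>c4\<close> is the smaller of the two coefficients left on the left-hand side.\<close>
  have zF: "\<rho> * (norm z)\<^sup>2 + t * F\<^sup>2 \<le> t * (c3 / c4 * E\<^sup>2)"
  proof -
    have "(c1 * F)\<^sup>2 \<le> (norm (T (S z)))\<^sup>2"
      unfolding F_def using c1 by (intro power_mono) auto
    then have "t * (c1\<^sup>2 * F\<^sup>2) \<le> t * (norm (T (S z)))\<^sup>2" using t_pos by (simp add: power_mult_distrib)
    moreover have "(c2\<^sup>2 + 1) * (E * F) \<le> c3 * E\<^sup>2 + c1\<^sup>2 / 2 * F\<^sup>2"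
    proof -
      have young: "k * (E * F) \<le> k\<^sup>2 / (2 * c1\<^sup>2) * E\<^sup>2 + c1\<^sup>2 / 2 * F\<^sup>2" for k
      proof -
        have "0 \<le> (k * E / c1 - c1 * F)\<^sup>2 / 2" by simp
        also have "\<dots> = k\<^sup>2 / (2 * c1\<^sup>2) * E\<^sup>2 + c1\<^sup>2 / 2 * F\<^sup>2 - k * (E * F)"
          using c1(1) by (simp add: power2_eq_square field_simps)
        finally show ?thesis by simp
      qed
      show ?thesis unfolding c3_def by (rule young)
    qed
    then have "t * ((c2\<^sup>2 + 1) * (E * F)) \<le> t * (c3 * E\<^sup>2 + c1\<^sup>2 / 2 * F\<^sup>2)"
      using t_pos by (intro mult_left_mono) auto
    ultimately have *: "\<rho> * (norm z)\<^sup>2 + c1\<^sup>2 / 2 * (t * F\<^sup>2) \<le> t * (c3 * E\<^sup>2)"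
      using energy by (simp add: algebra_simps)
    have "c4 * (\<rho> * (norm z)\<^sup>2 + t * F\<^sup>2) \<le> 1 * (\<rho> * (norm z)\<^sup>2) + c1\<^sup>2 / 2 * (t * F\<^sup>2)"
      unfolding distrib_left using c4 \<rho>_pos t_pos by (intro add_mono mult_right_mono) auto
    then have "c4 * (\<rho> * (norm z)\<^sup>2 + t * F\<^sup>2) \<le> t * (c3 * E\<^sup>2)" using * by linarith
    then show ?thesis using c4(1) by (simp add: field_simps)
  qed
  have P0: "P \<ge> 0" using P[of 0] l_pos[of 0] r1[of 0] by (meson divide_pos_pos less_imp_le order_trans)
  \<comment> \<open>Back to the norm of H: \<open>l j \<le> P * (1 + r j)\<close>, where the summand
    1 is paid by the penalty and \<open>r j\<close> by the data term of the energy.\<close>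
  have Sz: "(norm (S z))\<^sup>2 \<le> P * ((norm z)\<^sup>2 + t / \<rho> * F\<^sup>2)"
  proof (rule sums_le[OF _ parseval[OF onb, of "S z"]])
    show "(\<lambda>j. P * ((z \<bullet> \<phi> j)\<^sup>2 + t / \<rho> * (?k (S z) \<bullet> \<phi> j)\<^sup>2)) sums (P * ((norm z)\<^sup>2 + t / \<rho> * F\<^sup>2))"
      unfolding F_def by (intro sums_mult sums_add parseval onb)
    fix j
    have "l j \<le> P * (1 + r j)" using P[of j] r1[of j] by (simp add: divide_le_eq)
    then have "l j * (z \<bullet> \<phi> j)\<^sup>2 \<le> P * (1 + r j) * (z \<bullet> \<phi> j)\<^sup>2" by (rule mult_right_mono) simp
    also have "\<dots> = P * ((z \<bullet> \<phi> j)\<^sup>2 + t / \<rho> * (?k (S z) \<bullet> \<phi> j)\<^sup>2)"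
      using l_pos[of j] by (simp add: k_in S_inner r_def power_mult_distrib algebra_simps)
    finally show "(S z \<bullet> \<phi> j)\<^sup>2 \<le> P * ((z \<bullet> \<phi> j)\<^sup>2 + t / \<rho> * (?k (S z) \<bullet> \<phi> j)\<^sup>2)"
      using l_pos[of j] by (simp add: S_inner power_mult_distrib)
  qed
  have EU: "t / \<rho> * E\<^sup>2 \<le> A * U"
  proof (rule sums_le)
    show "(\<lambda>j. t / \<rho> * (?k e \<bullet> \<phi> j)\<^sup>2) sums (t / \<rho> * E\<^sup>2)"
      unfolding E_def by (intro sums_mult parseval onb)
    show "(\<lambda>j. A * (w j * (u0 \<bullet> \<phi> j)\<^sup>2)) sums (A * U)"
      unfolding U_def by (intro sums_mult summable_sums w)
    fix j
    have "t / \<rho> * (?k e \<bullet> \<phi> j)\<^sup>2 = r j / (l j * (1 + r j)\<^sup>2) * (u0 \<bullet> \<phi> j)\<^sup>2"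
      using l_pos[of j] by (simp add: k_in e_in r_def power_mult_distrib power_divide)
    also have "\<dots> \<le> A * w j * (u0 \<bullet> \<phi> j)\<^sup>2" by (rule mult_right_mono[OF A]) simp
    finally show "t / \<rho> * (?k e \<bullet> \<phi> j)\<^sup>2 \<le> A * (w j * (u0 \<bullet> \<phi> j)\<^sup>2)" by (simp add: mult.assoc)
  qed
  have eU: "(norm e)\<^sup>2 \<le> A' * U"
  proof (rule sums_le[OF _ parseval[OF onb, of e]])
    show "(\<lambda>j. A' * (w j * (u0 \<bullet> \<phi> j)\<^sup>2)) sums (A' * U)"
      unfolding U_def by (intro sums_mult summable_sums w)
    fix j
    have "(e \<bullet> \<phi> j)\<^sup>2 = 1 / (1 + r j)\<^sup>2 * (u0 \<bullet> \<phi> j)\<^sup>2"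
      by (simp add: e_in power_mult_distrib power_divide)
    also have "\<dots> \<le> A' * w j * (u0 \<bullet> \<phi> j)\<^sup>2" by (rule mult_right_mono[OF A']) simp
    finally show "(e \<bullet> \<phi> j)\<^sup>2 \<le> A' * (w j * (u0 \<bullet> \<phi> j)\<^sup>2)" by (simp add: mult.assoc)
  qed
  have "(norm (S z))\<^sup>2 \<le> c * P * A * U"
  proof -
    have "(norm z)\<^sup>2 + t / \<rho> * F\<^sup>2 = (\<rho> * (norm z)\<^sup>2 + t * F\<^sup>2) / \<rho>"
      using \<rho>_pos by (simp add: field_simps)
    also have "\<dots> \<le> t * (c3 / c4 * E\<^sup>2) / \<rho>" using zF \<rho>_pos by (intro divide_right_mono) auto
    also have "\<dots> = c3 / c4 * (t / \<rho> * E\<^sup>2)" by simp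
    also have "\<dots> \<le> c3 / c4 * (A * U)"
      using EU c4(1) by (intro mult_left_mono) (auto simp: c3_def)
    finally have "P * ((norm z)\<^sup>2 + t / \<rho> * F\<^sup>2) \<le> P * (c3 / c4 * (A * U))"
      using P0 by (rule mult_left_mono)
    then show ?thesis using Sz by (simp add: c_def c3_def c4_def mult_ac)
  qed
  then have "norm (S z) \<le> sqrt (c * P * A * U)" by (rule real_le_rsqrt)
  moreover have "norm e \<le> sqrt (A' * U)" using eU by (rule real_le_rsqrt)
  moreover have "mean (Ta (T u0)) - u0 = S z - e"
    by (simp add: mean_x z_def S.diff flip: u_y)
  ultimately show ?thesis using norm_triangle_ineq4[of "S z" e] by simp
qed

end

section \<open>The preconditioned forward operator\<close>

text \<open>\<open>ratio\<close> puts the range of \<open>G\<close>, which is the domain of the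
  operator with eigenvalues \<open>a\<close>, into the domain of the one with eigenvalues
  \<open>b\<close>. The composition \<open>T\<close> is thus defined everywhere.\<close>

locale smoothing = A: perturbed_diagonal \<phi> a K2 + Bp: perturbed_diagonal \<phi> b K1
  for \<phi> :: "nat \<Rightarrow> 'h::{real_inner,banach}" and a b :: "nat \<Rightarrow> real" and K1 K2 :: "'h \<Rightarrow> 'h" +
  fixes kmax :: real
  assumes ratio: "\<And>j. b j \<le> kmax * a j"
begin

abbreviation G :: "'h \<Rightarrow> 'h" where "G \<equiv> A.J"
abbreviation B :: "'h \<Rightarrow> 'h" where "B \<equiv> Bp.J"

lemma onb: "orthonormal_basis \<phi>"
  by (rule A.onb)

text \<open>\<open>T = \<zeta>\<^sup>-\<^sup>1\<^sup>/\<^sup>2 G\<close>, where \<open>\<zeta> = B\<^sup>2\<close>.\<close>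

definition T :: "'h \<Rightarrow> 'h" where "T u = Bp.Op (G u)"

definition \<kappa> :: "nat \<Rightarrow> real" where "\<kappa> j = b j / a j"

lemma a_pos: "a j > 0" and b_pos: "b j > 0"
  using A.a_ge1[of j] Bp.a_ge1[of j] by linarith+

lemma \<kappa>_pos: "\<kappa> j > 0"
  by (simp add: \<kappa>_def a_pos b_pos)

lemma \<kappa>_le: "\<bar>\<kappa> j\<bar> \<le> kmax"
  using ratio[of j] a_pos[of j] b_pos[of j] by (simp add: \<kappa>_def divide_le_eq)

lemma \<kappa>_inner: "eig_op \<phi> \<kappa> x \<bullet> \<phi> j = \<kappa> j * (x \<bullet> \<phi> j)"
  by (rule eig_op_bounded_inner[OF onb \<kappa>_le])

lemma \<kappa>_norm: "norm (eig_op \<phi> \<kappa> x) \<le> kmax * norm x"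
  by (rule eig_op_bounded(3)[OF onb \<kappa>_le])

lemma kmax_nonneg: "kmax \<ge> 0"
  using \<kappa>_le[of 0] by linarith

lemma G_dom_b: "G u \<in> eig_dom \<phi> b"
proof (rule eig_dom_mono[OF A.J_dom])
  show "\<bar>b j\<bar> \<le> kmax * \<bar>a j\<bar>" for j
    using ratio[of j] a_pos[of j] b_pos[of j] by simp
qed

lemma B_T: "B (T u) = G u"
  by (simp add: T_def G_dom_b)

lemma eig_b_G: "eig_op \<phi> b (G u) = eig_op \<phi> \<kappa> u - eig_op \<phi> \<kappa> (K2 (G u))"
proof (rule onb_eqI[OF onb])
  fix j
  have "A.Op (G u) \<bullet> \<phi> j = u \<bullet> \<phi> j" by simp
  then have "a j * (G u \<bullet> \<phi> j) = u \<bullet> \<phi> j - K2 (G u) \<bullet> \<phi> j"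
    by (simp add: A.Op_def inner_add_left eig_op_inner[OF onb A.J_dom] del: A.Op_J)
  then have "G u \<bullet> \<phi> j = (u \<bullet> \<phi> j - K2 (G u) \<bullet> \<phi> j) / a j"
    using a_pos[of j] by (simp add: field_simps)
  then show "eig_op \<phi> b (G u) \<bullet> \<phi> j = (eig_op \<phi> \<kappa> u - eig_op \<phi> \<kappa> (K2 (G u))) \<bullet> \<phi> j"
    by (simp add: eig_op_inner[OF onb G_dom_b] inner_diff_left \<kappa>_inner \<kappa>_def right_diff_distrib diff_divide_distrib)
qed

text \<open>With \<open>x\<close> the solution for \<open>K2 = 0\<close>, the resolvent identity
  \<open>G u = x - G (K2 x)\<close> reduces the claim to \<open>x\<close>, whose coefficients are
  dominated by those of \<open>eig_op \<phi> \<kappa> u\<close> because \<open>b j \<ge> 1\<close>.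
  The point is to control \<open>G u\<close> by this weak norm and not by
  \<open>norm u\<close>.\<close>

lemma norm_G_le:
  assumes L0: "L \<ge> 0" and L: "\<And>x. norm (K2 x) \<le> L * norm x"
  shows "norm (G u) \<le> (1 + L) * norm (eig_op \<phi> \<kappa> u)"
proof -
  define x where "x = eig_op \<phi> (\<lambda>j. 1 / a j) u"
  have inv_le: "\<bar>1 / a j\<bar> \<le> 1" for j using A.a_ge1[of j] by simp
  have x_in: "x \<bullet> \<phi> j = (u \<bullet> \<phi> j) / a j" for j
    unfolding x_def by (simp add: eig_op_bounded_inner[OF onb inv_le])
  have ax: "a j * (x \<bullet> \<phi> j) = u \<bullet> \<phi> j" for j
    using a_pos[of j] by (simp add: x_in)
  have dom: "x \<in> eig_dom \<phi> a"
    using norm_square_eq_suminf(2)[OF onb, of u] by (simp add: eig_dom_def ax)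
  have "eig_op \<phi> a x = u"
    by (rule onb_eqI[OF onb]) (simp add: eig_op_inner[OF onb dom] ax)
  then have "x = G (u + K2 x)" using A.J_Op[OF dom] by (simp add: A.Op_def)
  also have "\<dots> = G u + G (K2 x)" by (rule linear_simps(1)[OF A.J_bl])
  finally have Gu: "G u = x - G (K2 x)" by (simp add: algebra_simps)
  have "norm (G u) \<le> norm x + norm (G (K2 x))" unfolding Gu by (rule norm_triangle_ineq4)
  also have "norm (G (K2 x)) \<le> L * norm x" by (rule order_trans[OF A.norm_J_le L])
  also have "norm x + L * norm x = (1 + L) * norm x" by (simp add: distrib_right)
  also have "\<dots> \<le> (1 + L) * norm (eig_op \<phi> \<kappa> u)"
  proof (rule mult_left_mono)
    show "norm x \<le> norm (eig_op \<phi> \<kappa> u)"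
    proof (rule norm_le_componentwise[OF onb])
      fix j
      have "\<bar>u \<bullet> \<phi> j\<bar> * 1 \<le> \<bar>u \<bullet> \<phi> j\<bar> * b j" using Bp.a_ge1[of j] by (intro mult_left_mono) auto
      then show "\<bar>x \<bullet> \<phi> j\<bar> \<le> \<bar>eig_op \<phi> \<kappa> u \<bullet> \<phi> j\<bar>"
        using a_pos[of j] b_pos[of j]
        by (simp add: x_in \<kappa>_inner \<kappa>_def abs_mult divide_right_mono mult.commute)
    qed
  qed (use L0 in simp)
  finally show ?thesis by simp
qed

text \<open>\<open>T u\<close> differs from \<open>eig_op \<phi> \<kappa> u\<close> by bounded
  operators applied to \<open>G u\<close>. From above, \<open>norm_G_le\<close> controls
  \<open>G u\<close>; from below, \<open>G u = B (T u)\<close> and \<open>B\<close> is a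
  contraction.\<close>

lemma T_bounds:
  "\<exists>c1 c2. c1 > 0 \<and> c2 > 0 \<and> (\<forall>u. c1 * norm (eig_op \<phi> \<kappa> u) \<le> norm (T u)) \<and>
     (\<forall>u. norm (T u) \<le> c2 * norm (eig_op \<phi> \<kappa> u))"
proof -
  obtain L1 where L1: "L1 > 0" "\<And>x. norm (K1 x) \<le> norm x * L1" using Bp.K.pos_bounded by blast
  obtain L2 where L2: "L2 > 0" "\<And>x. norm (K2 x) \<le> norm x * L2" using A.K.pos_bounded by blast
  let ?k = "eig_op \<phi> \<kappa>"
  define h where "h = L1 + kmax * L2"
  have h: "h \<ge> 0" using L1 L2 kmax_nonneg by (simp add: h_def)
  have kK: "norm (?k (K2 x)) \<le> kmax * L2 * norm x" for x
  proof -
    have "norm (?k (K2 x)) \<le> kmax * norm (K2 x)" by (rule \<kappa>_norm)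
    also have "\<dots> \<le> kmax * (norm x * L2)" by (intro mult_left_mono L2 kmax_nonneg)
    finally show ?thesis by (simp add: mult_ac)
  qed
  have Gu: "norm (G u) \<le> (1 + L2) * norm (?k u)" for u
    using L2 by (intro norm_G_le) (auto simp: mult.commute)
  have T_eq: "T u = ?k u - ?k (K2 (G u)) + K1 (G u)" for u
    by (simp add: T_def Bp.Op_def eig_b_G)
  have upper: "norm (T u) \<le> (1 + h * (1 + L2)) * norm (?k u)" for u
  proof -
    have "norm (T u) \<le> norm (?k u) + norm (?k (K2 (G u))) + norm (K1 (G u))"
      unfolding T_eq
      using norm_triangle_ineq[of "?k u - ?k (K2 (G u))" "K1 (G u)"] norm_triangle_ineq4[of "?k u" "?k (K2 (G u))"]
      by linarith
    also have "\<dots> \<le> norm (?k u) + h * norm (G u)"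
      using kK[of "G u"] L1(2)[of "G u"] by (simp add: h_def algebra_simps)
    also have "\<dots> \<le> norm (?k u) + h * ((1 + L2) * norm (?k u))"
      by (intro add_left_mono mult_left_mono Gu h)
    finally show ?thesis by (simp add: algebra_simps)
  qed
  have lower: "norm (?k u) \<le> (1 + h) * norm (T u)" for u
  proof -
    have eq: "?k u = T u + ?k (K2 (G u)) - K1 (G u)" by (simp add: T_eq)
    have "norm (?k u) \<le> norm (T u) + norm (?k (K2 (G u))) + norm (K1 (G u))"
      unfolding eq using norm_triangle_ineq4[of "T u + ?k (K2 (G u))" "K1 (G u)"] norm_triangle_ineq[of "T u" "?k (K2 (G u))"]
      by linarith
    also have "\<dots> \<le> norm (T u) + h * norm (G u)"
      using kK[of "G u"] L1(2)[of "G u"] by (simp add: h_def algebra_simps)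
    also have "\<dots> \<le> norm (T u) + h * norm (T u)"
      using Bp.norm_J_le[of "T u"] h by (intro add_left_mono mult_left_mono) (simp_all add: B_T)
    finally show ?thesis by (simp add: algebra_simps)
  qed
  show ?thesis
  proof (intro exI conjI allI)
    show "1 / (1 + h) > 0" "1 + h * (1 + L2) > 0" using h L2 by (auto intro: add_pos_nonneg)
    show "1 / (1 + h) * norm (?k u) \<le> norm (T u)" for u
      using lower[of u] h by (simp add: field_simps)
    show "norm (T u) \<le> (1 + h * (1 + L2)) * norm (?k u)" for u by (rule upper)
  qed
qed

lemma T_bl: "bounded_linear T"
proof -
  obtain c2 where c2: "c2 > 0" "\<And>u. norm (T u) \<le> c2 * norm (eig_op \<phi> \<kappa> u)" using T_bounds by blast
  show ?thesis
  proof (rule bounded_linear_intro[where K = "c2 * kmax"])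
    fix x y
    show "T (x + y) = T x + T y"
      by (simp add: T_def linear_simps(1)[OF A.J_bl] Bp.Op_add G_dom_b)
    show "T (c *\<^sub>R x) = c *\<^sub>R T x" for c
      by (simp add: T_def linear_simps(5)[OF A.J_bl] Bp.Op_scaleR G_dom_b)
    have "norm (T x) \<le> c2 * (kmax * norm x)"
      by (rule order_trans[OF c2(2) mult_left_mono[OF \<kappa>_norm less_imp_le[OF c2(1)]]])
    then show "norm (T x) \<le> norm x * (c2 * kmax)" by (simp add: mult_ac)
  qed
qed

lemma T_summable:
  assumes "summable \<kappa>"
  shows "summable (\<lambda>j. norm (T (\<phi> j)))"
proof -
  obtain c2 where c2: "c2 > 0" "\<And>u. norm (T u) \<le> c2 * norm (eig_op \<phi> \<kappa> u)" using T_bounds by blast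
  show ?thesis
  proof (rule summable_comparison_test')
    show "summable (\<lambda>j. c2 * \<kappa> j)" by (intro summable_mult assms)
    show "norm (norm (T (\<phi> n))) \<le> c2 * \<kappa> n" for n
      using c2(2)[of "\<phi> n"] \<kappa>_pos[of n] by (simp add: eig_op_basis[OF onb] onb_norm[OF onb])
  qed
qed

lemma B_dense: "closure (range B) = UNIV"
proof -
  have "span (range \<phi>) \<subseteq> range B"
  proof (rule span_minimal)
    show "range \<phi> \<subseteq> range B" unfolding Bp.range_J by (auto simp: eig_op_basis(1)[OF onb])
    show "subspace (range B)"
      using linear_subspace_image[OF bounded_linear.linear[OF Bp.J_bl] subspace_UNIV] .
  qed
  then show ?thesis using closure_mono onb unfolding orthonormal_basis_def by blast
qed

lemma op_sqrt_B: "op_sqrt (B \<circ> B) = B"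
  by (rule op_sqrt_square[OF Bp.J_bl Bp.J_sa Bp.J_pos Bp.norm_J_le B_dense])

lemma inv_sqrt_G: "inv_sqrt (B \<circ> B) (G u) = T u"
  unfolding inv_sqrt_def op_sqrt_B B_T[symmetric] by (rule inv_f_f[OF Bp.J_inj])

end

section \<open>Asymptotics of the filter\<close>

lemma powr_exp_bound:
  fixes k a :: real
  assumes a: "a > 0"
  shows "\<exists>c>0. \<forall>x\<ge>1. x powr k * exp (- a * x) \<le> c"
proof -
  \<comment> \<open>For negative \<open>k\<close> the conversion \<open>nat\<close> gives
    \<open>m = 0\<close>, and \<open>k \<le> real m\<close> still holds.\<close>
  define m where "m = nat \<lceil>k\<rceil>"
  have m: "k \<le> real m" by (simp add: m_def) linarith
  have "x powr k * exp (- a * x) \<le> fact m / a ^ m" if x: "x \<ge> 1" for x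
  proof -
    have "x powr k \<le> x powr real m" using x m by (intro powr_mono) auto
    also have "\<dots> = x ^ m" using x by (simp add: powr_realpow)
    also have "\<dots> = fact m / a ^ m * ((a * x) ^ m / fact m)" using a by (simp add: power_mult_distrib)
    also have "\<dots> \<le> fact m / a ^ m * exp (a * x)"
    proof (rule mult_left_mono)
      have "(a * x) ^ m / fact m \<le> (\<Sum>k<Suc m. (a * x) ^ k / fact k)"
        using a x by (simp add: sum_nonneg)
      also have "\<dots> \<le> exp (a * x)" using a x by (intro exp_partial_sum_le) simp
      finally show "(a * x) ^ m / fact m \<le> exp (a * x)" .
    qed (use a in simp)
    finally have "x powr k * exp (- a * x) \<le> fact m / a ^ m * exp (a * x) * exp (- a * x)"
      by (rule mult_right_mono) simp
    then show ?thesis by (simp add: mult.assoc flip: exp_add)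
  qed
  moreover have "fact m / a ^ m > 0" using a by simp
  ultimately show ?thesis by blast
qed

text \<open>\<open>L\<close> plays the role of \<open>ln n\<close> and \<open>i\<close> that of the index; \<open>filt\<close> is the ratio of the data
  precision to the prior precision of the \<open>i\<close>-th mode. It is huge when \<open>i\<^sup>\<beta> \<le> \<sigma> L / 2\<close> and tiny when
  \<open>i\<^sup>\<beta> \<ge> 2 \<sigma> L\<close>; between these \<open>i\<close> is comparable to \<open>L\<^sup>1\<^sup>/\<^sup>\<beta>\<close>.\<close>

locale filter_asymptotics =
  fixes \<sigma> \<beta> q :: real
  assumes \<sigma>: "0 < \<sigma>" "\<sigma> < 1 / 2" and \<beta>: "\<beta> > 0"
begin

definition filt :: "real \<Rightarrow> real \<Rightarrow> real" where
  "filt L i = exp (2 * \<sigma> * L) * i powr q * exp (- 2 * i powr \<beta>)"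

definition J :: "real \<Rightarrow> real" where "J L = L powr (1 / \<beta>)"

lemma J_ge1: "L \<ge> 1 \<Longrightarrow> J L \<ge> 1"
  unfolding J_def using \<beta> by (intro ge_one_powr_ge_zero) auto

lemma filt_pos: "i \<ge> 1 \<Longrightarrow> filt L i > 0"
  by (simp add: filt_def)

lemma J_scale:
  assumes "L \<ge> 1" "c > 0"
  shows "(c * L) powr (1 / \<beta>) = c powr (1 / \<beta>) * J L"
  using assms by (simp add: J_def powr_mult)

lemma root_le: "i \<ge> 1 \<Longrightarrow> i powr \<beta> \<le> y \<Longrightarrow> i \<le> y powr (1 / \<beta>)"
  and le_root: "i \<ge> 1 \<Longrightarrow> 0 \<le> y \<Longrightarrow> y \<le> i powr \<beta> \<Longrightarrow> y powr (1 / \<beta>) \<le> i"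
proof -
  assume i: "i \<ge> 1"
  have eq: "(i powr \<beta>) powr (1 / \<beta>) = i" using i \<beta> by (simp add: powr_powr)
  show "i \<le> y powr (1 / \<beta>)" if "i powr \<beta> \<le> y"
    using powr_mono2[of "1 / \<beta>" "i powr \<beta>" y] that \<beta> eq by simp
  show "y powr (1 / \<beta>) \<le> i" if "0 \<le> y" "y \<le> i powr \<beta>"
    using powr_mono2[of "1 / \<beta>" y "i powr \<beta>"] that \<beta> eq by simp
qed

text \<open>Here \<open>filt\<close> is at least \<open>exp (\<sigma> * L) * i powr q\<close>. Since
  \<open>i \<le> J L\<close>, all powers of \<open>i\<close> cost at most a power of
  \<open>L\<close>, which the exponential absorbs; the exponent given to
  \<open>powr_exp_bound\<close> turns \<open>J L powr \<bar>s - q\<bar>\<close> into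
  \<open>J L powr s\<close>.\<close>

lemma low_modes:
  "\<exists>c>0. \<forall>L\<ge>1. \<forall>i\<ge>1. i powr \<beta> \<le> \<sigma> * L / 2 \<longrightarrow> i powr s / filt L i \<le> c * J L powr s"
proof -
  obtain c where c: "c > 0" "\<And>x. x \<ge> 1 \<Longrightarrow> x powr ((\<bar>s - q\<bar> - s) / \<beta>) * exp (- \<sigma> * x) \<le> c"
    using powr_exp_bound[OF \<sigma>(1), of "(\<bar>s - q\<bar> - s) / \<beta>"] by blast
  have "i powr s / filt L i \<le> c * J L powr s"
    if L: "L \<ge> 1" and i: "i \<ge> 1" and le: "i powr \<beta> \<le> \<sigma> * L / 2" for L i
  proof -
    have "exp (\<sigma> * L) * i powr q \<le> filt L i"
    proof -
      have "\<sigma> * L \<le> 2 * \<sigma> * L + - 2 * i powr \<beta>" using le by linarith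
      then have "exp (\<sigma> * L) \<le> exp (2 * \<sigma> * L + - 2 * i powr \<beta>)" by (subst exp_le_cancel_iff)
      then have "exp (\<sigma> * L) \<le> exp (2 * \<sigma> * L) * exp (- 2 * i powr \<beta>)" by (simp only: exp_add)
      then have "exp (\<sigma> * L) * i powr q \<le> exp (2 * \<sigma> * L) * exp (- 2 * i powr \<beta>) * i powr q"
        by (rule mult_right_mono) simp
      then show ?thesis by (simp add: filt_def mult_ac)
    qed
    then have "i powr s / filt L i \<le> i powr s / (exp (\<sigma> * L) * i powr q)"
      using i by (intro divide_left_mono) (auto intro!: mult_pos_pos filt_pos)
    also have "\<dots> = i powr (s - q) * exp (- \<sigma> * L)"
      by (simp add: powr_diff exp_minus field_simps)
    also have "\<dots> \<le> J L powr \<bar>s - q\<bar> * exp (- \<sigma> * L)"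
    proof (rule mult_right_mono)
      have "\<sigma> * L / 2 \<le> L" using \<sigma> L mult_right_mono[of \<sigma> 1 L] by simp
      then have "i \<le> J L" unfolding J_def using le by (intro root_le i) simp
      then have "i powr \<bar>s - q\<bar> \<le> J L powr \<bar>s - q\<bar>" using i by (intro powr_mono2) auto
      moreover have "i powr (s - q) \<le> i powr \<bar>s - q\<bar>" using i by (intro powr_mono) auto
      ultimately show "i powr (s - q) \<le> J L powr \<bar>s - q\<bar>" by linarith
    qed simp
    also have "\<dots> = J L powr s * (L powr ((\<bar>s - q\<bar> - s) / \<beta>) * exp (- \<sigma> * L))"
      using L by (simp add: J_def powr_powr diff_divide_distrib flip: powr_add)
    also have "\<dots> \<le> J L powr s * c" by (intro mult_left_mono c L) simp
    finally show ?thesis by (simp add: mult.commute)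
  qed
  then show ?thesis using c(1) by blast
qed

text \<open>Half of the decay \<open>exp (- 2 * i powr \<beta>)\<close> pays for
  \<open>exp (2 * \<sigma> * L)\<close>; the other half beats every power of \<open>i\<close>, even
  leaving a factor \<open>i powr (- \<bar>s\<bar>)\<close> that transfers to
  \<open>J L\<close>.\<close>

lemma high_modes:
  "\<exists>c>0. \<forall>L\<ge>1. \<forall>i\<ge>1. 2 * \<sigma> * L \<le> i powr \<beta> \<longrightarrow> i powr s * filt L i \<le> c * J L powr s"
proof -
  obtain c where c: "c > 0" "\<And>x. x \<ge> 1 \<Longrightarrow> x powr ((s + q + \<bar>s\<bar>) / \<beta>) * exp (- 1 * x) \<le> c"
    using powr_exp_bound[of 1 "(s + q + \<bar>s\<bar>) / \<beta>"] by auto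
  define h where "h = (2 * \<sigma>) powr (1 / \<beta>)"
  have h: "h > 0" using \<sigma> by (simp add: h_def)
  have "i powr s * filt L i \<le> (c * h powr (- \<bar>s\<bar>)) * J L powr s"
    if L: "L \<ge> 1" and i: "i \<ge> 1" and le: "2 * \<sigma> * L \<le> i powr \<beta>" for L i
  proof -
    have "exp (2 * \<sigma> * L) * exp (- 2 * i powr \<beta>) \<le> exp (- 1 * i powr \<beta>)"
      using le by (simp flip: exp_add)
    then have "i powr s * filt L i \<le> i powr s * (i powr q * exp (- 1 * i powr \<beta>))"
      unfolding filt_def by (intro mult_left_mono) (auto simp: mult.commute[of _ "i powr q"] mult.assoc intro!: mult_left_mono)
    also have "\<dots> = i powr (- \<bar>s\<bar>) * ((i powr \<beta>) powr ((s + q + \<bar>s\<bar>) / \<beta>) * exp (- 1 * i powr \<beta>))"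
      using \<beta> i by (simp add: powr_powr flip: powr_add mult.assoc)
    also have "\<dots> \<le> i powr (- \<bar>s\<bar>) * c"
      using i \<beta> by (intro mult_left_mono c ge_one_powr_ge_zero) auto
    also have "\<dots> \<le> (h * J L) powr (- \<bar>s\<bar>) * c"
    proof (intro mult_right_mono powr_mono2')
      have "(2 * \<sigma> * L) powr (1 / \<beta>) \<le> i" using \<sigma> L by (intro le_root i le) auto
      then show "h * J L \<le> i" using J_scale[OF L, of "2 * \<sigma>"] \<sigma> by (simp add: h_def)
    qed (use h J_ge1[OF L] c in auto)
    also have "\<dots> = h powr (- \<bar>s\<bar>) * J L powr (- \<bar>s\<bar>) * c"
      using h J_ge1[OF L] by (simp add: powr_mult)
    also have "\<dots> \<le> h powr (- \<bar>s\<bar>) * J L powr s * c"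
      using c(1) J_ge1[OF L] by (intro mult_right_mono mult_left_mono powr_mono) auto
    finally show ?thesis by (simp add: mult_ac)
  qed
  moreover have "c * h powr (- \<bar>s\<bar>) > 0" using c h by simp
  ultimately show ?thesis by blast
qed

text \<open>For modes that are not low, the filter is bounded trivially; \<open>s \<le> 0\<close>
  then lets \<open>i powr s\<close> decrease from its value at a multiple of
  \<open>J L\<close>.\<close>

lemma filter_bias:
  assumes s: "s \<le> 0"
  shows "\<exists>c>0. \<forall>L\<ge>1. \<forall>i\<ge>1. i powr s / (1 + filt L i) \<le> c * J L powr s"
proof -
  obtain c where c: "c > 0" "\<And>L i. L \<ge> 1 \<Longrightarrow> i \<ge> 1 \<Longrightarrow> i powr \<beta> \<le> \<sigma> * L / 2 \<Longrightarrow> i powr s / filt L i \<le> c * J L powr s"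
    using low_modes[of s] by blast
  define h where "h = (\<sigma> / 2) powr (1 / \<beta>)"
  have h: "h > 0" using \<sigma> by (simp add: h_def)
  have "i powr s / (1 + filt L i) \<le> (c + h powr s) * J L powr s" if L: "L \<ge> 1" and i: "i \<ge> 1" for L i
  proof (cases "i powr \<beta> \<le> \<sigma> * L / 2")
    case True
    have "i powr s / (1 + filt L i) \<le> i powr s / filt L i"
      using filt_pos[OF i, of L] by (intro divide_left_mono) auto
    also have "\<dots> \<le> c * J L powr s" by (rule c(2)[OF L i True])
    also have "\<dots> \<le> (c + h powr s) * J L powr s" by (intro mult_right_mono) auto
    finally show ?thesis .
  next
    case False
    have "i powr s / (1 + filt L i) \<le> i powr s / 1"
      using filt_pos[OF i, of L] by (intro divide_left_mono) auto
    also have "\<dots> \<le> (h * J L) powr s"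
    proof -
      have "(\<sigma> / 2 * L) powr (1 / \<beta>) \<le> i" using \<sigma> L False by (intro le_root i) auto
      then have "h * J L \<le> i" using J_scale[OF L, of "\<sigma> / 2"] \<sigma> by (simp add: h_def)
      then show ?thesis using h J_ge1[OF L] s by (auto intro!: powr_mono2')
    qed
    also have "\<dots> = h powr s * J L powr s" using h J_ge1[OF L] by (simp add: powr_mult)
    also have "\<dots> \<le> (c + h powr s) * J L powr s" using c(1) by (intro mult_right_mono) auto
    finally show ?thesis .
  qed
  moreover have "c + h powr s > 0" using c(1) by (simp add: add_pos_nonneg)
  ultimately show ?thesis by blast
qed

text \<open>The factor \<open>f / (1 + f)^2\<close> is small at both ends, so the sum over scales
  concentrates where \<open>i\<close> is comparable to \<open>J L\<close>. This is why
  \<open>s\<close> may have either sign, as it must for the later exponent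
  \<open>p - 2 * \<gamma>\<close>.\<close>

lemma filter_transition:
  "\<exists>c>0. \<forall>L\<ge>1. \<forall>i\<ge>1. i powr s * filt L i / (1 + filt L i)\<^sup>2 \<le> c * J L powr s"
proof -
  obtain c where c: "c > 0" "\<And>L i. L \<ge> 1 \<Longrightarrow> i \<ge> 1 \<Longrightarrow> i powr \<beta> \<le> \<sigma> * L / 2 \<Longrightarrow> i powr s / filt L i \<le> c * J L powr s"
    using low_modes[of s] by blast
  obtain d where d: "d > 0" "\<And>L i. L \<ge> 1 \<Longrightarrow> i \<ge> 1 \<Longrightarrow> 2 * \<sigma> * L \<le> i powr \<beta> \<Longrightarrow> i powr s * filt L i \<le> d * J L powr s"
    using high_modes[of s] by blast
  define h where "h = (\<sigma> / 2) powr (1 / \<beta>)"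
  define h' where "h' = (2 * \<sigma>) powr (1 / \<beta>)"
  have h: "h > 0" "h' > 0" using \<sigma> by (auto simp: h_def h'_def)
  define C where "C = c + d + h powr s + h' powr s"
  have "i powr s * filt L i / (1 + filt L i)\<^sup>2 \<le> C * J L powr s" if L: "L \<ge> 1" and i: "i \<ge> 1" for L i
  proof -
    define f where "f = filt L i"
    have f: "f > 0" using filt_pos[OF i] by (simp add: f_def)
    have f1: "f / (1 + f)\<^sup>2 \<le> 1 / f" "f / (1 + f)\<^sup>2 \<le> f" "f / (1 + f)\<^sup>2 \<le> 1"
    proof -
      have sq: "(1 + f)\<^sup>2 = 1 + 2 * f + f * f" by (simp add: power2_eq_square algebra_simps)
      have "f * f \<le> 1 * (1 + f)\<^sup>2" using f unfolding sq by simp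
      then show "f / (1 + f)\<^sup>2 \<le> 1 / f" using f by (simp add: frac_le_eq divide_le_0_iff field_simps)
      have "f * 1 \<le> f * (1 + f)\<^sup>2" using f unfolding sq by (intro mult_left_mono) auto
      then show "f / (1 + f)\<^sup>2 \<le> f" using f by (simp add: divide_le_eq)
      show "f / (1 + f)\<^sup>2 \<le> 1" using f unfolding sq by (simp add: divide_le_eq add_pos_pos)
    qed
    have le: "i powr s * f / (1 + f)\<^sup>2 \<le> i powr s * y" if "f / (1 + f)\<^sup>2 \<le> y" for y
      using mult_left_mono[OF that, of "i powr s"] by simp
    have weaken: "?thesis" if "i powr s * f / (1 + f)\<^sup>2 \<le> x * J L powr s" "x \<le> C" for x
      using that mult_right_mono[OF that(2), of "J L powr s"] by (simp add: f_def)
    consider "i powr \<beta> \<le> \<sigma> * L / 2" | "2 * \<sigma> * L \<le> i powr \<beta>"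
      | "\<sigma> * L / 2 \<le> i powr \<beta>" "i powr \<beta> \<le> 2 * \<sigma> * L" by linarith
    then show ?thesis
    proof cases
      case 1
      then have "i powr s * f / (1 + f)\<^sup>2 \<le> c * J L powr s"
        using le[OF f1(1)] c(2)[OF L i] by (simp add: f_def)
      then show ?thesis by (rule weaken) (use d h in \<open>simp add: C_def\<close>)
    next
      case 2
      then have "i powr s * f / (1 + f)\<^sup>2 \<le> d * J L powr s"
        using le[OF f1(2)] d(2)[OF L i] by (simp add: f_def)
      then show ?thesis by (rule weaken) (use c h in \<open>simp add: C_def\<close>)
    next
      case 3
      have "(\<sigma> / 2 * L) powr (1 / \<beta>) \<le> i" using \<sigma> L 3 by (intro le_root i) auto
      then have lo: "h * J L \<le> i" using J_scale[OF L, of "\<sigma> / 2"] \<sigma> by (simp add: h_def)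
      have "i \<le> (2 * \<sigma> * L) powr (1 / \<beta>)" using 3 by (intro root_le i) auto
      then have hi: "i \<le> h' * J L" using J_scale[OF L, of "2 * \<sigma>"] \<sigma> by (simp add: h'_def)
      have J0: "J L > 0" using J_ge1[OF L] by simp
      have "i powr s \<le> (h powr s + h' powr s) * J L powr s"
      proof (cases "s \<ge> 0")
        case True
        then have "i powr s \<le> (h' * J L) powr s" using hi i by (intro powr_mono2) auto
        also have "\<dots> = h' powr s * J L powr s" using h J0 by (simp add: powr_mult)
        finally show ?thesis by (simp add: distrib_right add_increasing)
      next
        case False
        then have "i powr s \<le> (h * J L) powr s" using lo h J0 by (intro powr_mono2') auto
        also have "\<dots> = h powr s * J L powr s" using h J0 by (simp add: powr_mult)
        finally show ?thesis by (simp add: distrib_right add_increasing2)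
      qed
      then have "i powr s * f / (1 + f)\<^sup>2 \<le> (h powr s + h' powr s) * J L powr s"
        using le[OF f1(3)] by simp
      then show ?thesis by (rule weaken) (use c d in \<open>simp add: C_def\<close>)
    qed
  qed
  moreover have "C > 0" using c d by (simp add: C_def add_pos_nonneg)
  ultimately show ?thesis by blast
qed

end

section \<open>The inverse problem\<close>

lemma tendsto_measure_zero:
  fixes X :: "nat \<Rightarrow> 'w \<Rightarrow> real"
  assumes "prob_space M" and [measurable]: "\<And>k. X k \<in> borel_measurable M"
    and X: "\<And>w. (\<lambda>k. X k w) \<longlonglongrightarrow> 0" and e: "e > 0"
  shows "(\<lambda>k. measure M {w\<in>space M. \<bar>X k w\<bar> > e}) \<longlonglongrightarrow> 0"
proof -
  interpret prob_space M by fact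
  let ?A = "\<lambda>k. {w\<in>space M. \<bar>X k w\<bar> > e}"
  have "(\<lambda>k. \<integral>w. indicat_real (?A k) w \<partial>M) \<longlonglongrightarrow> (\<integral>w. 0 \<partial>M)"
  proof (rule integral_dominated_convergence[where w = "\<lambda>_. 1"])
    show "AE w in M. (\<lambda>k. indicat_real (?A k) w) \<longlonglongrightarrow> 0"
    proof (intro AE_I2 tendsto_eventually)
      fix w
      show "\<forall>\<^sub>F k in sequentially. indicat_real (?A k) w = 0"
        using order_tendstoD(2)[OF tendsto_rabs_zero[OF X[of w]] e] by eventually_elim (auto simp: indicator_def)
    qed
  qed (auto simp: indicator_def)
  then show ?thesis by simp
qed

locale gaussian_model =
  smoothing \<phi> a b K1 K2 kmax + noise?: noise M "perturbed_diagonal.J \<phi> b K1" \<eta>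
  for \<phi> :: "nat \<Rightarrow> 'h::{real_inner,banach,second_countable_topology}" and a b K1 K2 kmax
    and M :: "'w measure" and \<eta> +
  assumes \<kappa>_summable: "summable \<kappa>"
begin

abbreviation \<zeta> :: "'h \<Rightarrow> 'h" where "\<zeta> \<equiv> B \<circ> B"

sublocale T: bounded_linear T by (rule T_bl)

lemmas T\<phi>_summable = T_summable[OF \<kappa>_summable]

abbreviation Ta :: "'h \<Rightarrow> 'h" where "Ta \<equiv> adj \<phi> T"

lemmas Ta_inner = adj_inner[OF onb T_bl T\<phi>_summable]
  and Ta_bl = adj_bounded_linear[OF onb T_bl T\<phi>_summable]

text \<open>\<open>V\<close> is the H-valued Gaussian variable written \<open>T* \<zeta>\<^sup>-\<^sup>1\<^sup>/\<^sup>2 \<eta>\<close>.\<close>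

definition V :: "'w \<Rightarrow> 'h" where
  "V = (SOME V. V \<in> borel_measurable M \<and> (\<forall>u. represents (T u) (\<lambda>w. V w \<bullet> u)))"

lemma V_meas [measurable]: "V \<in> borel_measurable M"
  and V_represents: "represents (T u) (\<lambda>w. V w \<bullet> u)"
proof -
  have "(\<Sum>j. (u \<bullet> \<phi> j) *\<^sub>R T (\<phi> j)) = T u" for u
    using T.sums[OF onb_expansion[OF onb, of u]] by (simp add: T.scaleR sums_iff)
  then have "\<exists>V. V \<in> borel_measurable M \<and> (\<forall>u. represents (T u) (\<lambda>w. V w \<bullet> u))"
    using noise_vector_exists[OF onb T\<phi>_summable] by auto
  from someI_ex[OF this] show "V \<in> borel_measurable M" "represents (T u) (\<lambda>w. V w \<bullet> u)"
    by (auto simp: V_def)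
qed

lemma T_meas [measurable]: "T \<in> borel_measurable borel"
  and Ta_meas [measurable]: "Ta \<in> borel_measurable borel"
  and G_meas [measurable]: "G \<in> borel_measurable borel"
  by (intro borel_measurable_continuous_onI linear_continuous_on T_bl Ta_bl A.J_bl)+

text \<open>Embeds H into the functionals on \<open>range G\<close>; the value 0 elsewhere is the
  normalisation demanded by \<open>banach_space_of_functionals\<close>.\<close>

definition functional :: "'h \<Rightarrow> 'h \<Rightarrow> real" where
  "functional v x = (if x \<in> range G then v \<bullet> inv G x else 0)"

lemma functional_G [simp]: "functional v (G u) = v \<bullet> u"
  by (simp add: functional_def inv_f_f[OF A.J_inj])

lemma functional_inj: "inj functional"
proof (rule injI)
  fix v w assume eq: "functional v = functional w"
  show "v = w"
  proof (rule inner_eqI)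
    fix u
    show "v \<bullet> u = w \<bullet> u" using fun_cong[OF eq, of "G u"] by (simp only: functional_G)
  qed
qed

lemma functional_add: "(\<lambda>x. functional v x + functional w x) = functional (v + w)"
  and functional_diff: "(\<lambda>x. functional v x - functional w x) = functional (v - w)"
  and functional_scaleR: "(\<lambda>x. c * functional v x) = functional (c *\<^sub>R v)"
  and functional_zero: "(\<lambda>_. 0) = functional 0"
  by (auto simp: functional_def inner_add_left inner_diff_left)

definition functional_norm :: "('h \<Rightarrow> real) \<Rightarrow> real" where
  "functional_norm y = norm (inv functional y)"

lemma functional_norm [simp]: "functional_norm (functional v) = norm v"
  by (simp add: functional_norm_def inv_f_f[OF functional_inj])

lemma banach_space_functional:
  "banach_space_of_functionals (range G) (range functional) functional_norm"
  unfolding banach_space_of_functionals_def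
proof (intro conjI ballI allI impI)
  fix y assume "y \<in> range functional"
  then obtain v where y: "y = functional v" by auto
  show "y (x + x') = y x + y x'" if x: "x \<in> range G" and x': "x' \<in> range G" for x x'
  proof -
    obtain u where u: "x = G u" using x by (rule rangeE)
    obtain u' where u': "x' = G u'" using x' by (rule rangeE)
    have "G u + G u' = G (u + u')" by (rule linear_simps(1)[OF A.J_bl, symmetric])
    then show ?thesis unfolding y u u' by (simp only: functional_G inner_add_right)
  qed
  show "y (c *\<^sub>R x) = c * y x" if x: "x \<in> range G" for x c
  proof -
    obtain u where u: "x = G u" using x by (rule rangeE)
    have "c *\<^sub>R G u = G (c *\<^sub>R u)" by (rule linear_simps(5)[OF A.J_bl, symmetric])
    then show ?thesis unfolding y u by (simp only: functional_G inner_scaleR_right)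
  qed
  show "y x = 0" if "x \<notin> range G" for x using that by (simp add: y functional_def)
  show "(\<lambda>x. c * y x) \<in> range functional" for c by (simp add: y functional_scaleR)
  show "functional_norm y \<ge> 0" by (simp add: y)
  show "functional_norm y = 0 \<longleftrightarrow> y = (\<lambda>_. 0)"
    using inj_eq[OF functional_inj, of v 0] by (simp add: y functional_zero)
  show "functional_norm (\<lambda>x. c * y x) = \<bar>c\<bar> * functional_norm y" for c
    by (simp add: y functional_scaleR)
  fix z assume "z \<in> range functional"
  then obtain w where z: "z = functional w" by auto
  show "(\<lambda>x. y x + z x) \<in> range functional" by (simp add: y z functional_add)
  show "functional_norm (\<lambda>x. y x + z x) \<le> functional_norm y + functional_norm z"
    by (simp add: y z functional_add norm_triangle_ineq)
next
  show "(\<lambda>_. 0) \<in> range functional" unfolding functional_zero by simp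
next
  fix s :: "nat \<Rightarrow> 'h \<Rightarrow> real"
  assume s: "(\<forall>k. s k \<in> range functional) \<and>
    (\<forall>e>0. \<exists>k0. \<forall>i\<ge>k0. \<forall>j\<ge>k0. functional_norm (\<lambda>x. s i x - s j x) < e)"
  then have "\<forall>k. \<exists>v. s k = functional v" by blast
  then obtain v where v: "\<And>k. s k = functional (v k)" by metis
  have "Cauchy v" using s by (simp add: v functional_diff Cauchy_def dist_norm)
  then obtain l where l: "v \<longlonglongrightarrow> l" using Cauchy_convergent_iff convergent_def by blast
  show "\<exists>y\<in>range functional. (\<lambda>k. functional_norm (\<lambda>x. s k x - y x)) \<longlonglongrightarrow> 0"
    using l by (intro bexI[of _ "functional l"]) (simp_all add: v functional_diff LIM_zero tendsto_norm_zero)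
next
  fix x assume "x \<in> range G"
  then obtain u where u: "x = G u" by auto
  show "\<exists>c. \<forall>y\<in>range functional. \<bar>y x\<bar> \<le> c * functional_norm y"
    by (rule exI[of _ "norm u"]) (auto simp: u mult.commute intro: Cauchy_Schwarz_ineq2)
qed

section \<open>Data and posterior in terms of vectors of H\<close>

lemma zeta_inner_G: "zeta_inner \<zeta> (G u) (G u) = (norm (T u))\<^sup>2"
  by (simp add: zeta_inner_def inv_sqrt_G power2_norm_eq_inner)

lemma post_weight_eq:
  "(\<And>u. y (G u) = v \<bullet> u) \<Longrightarrow> post_weight G \<zeta> n y u = tilt T (real n) v u"
  by (simp add: post_weight_def tilt_def zeta_inner_G)

text \<open>A random \<open>g\<close> serves well-posedness, where it is drawn from the prior; the
  constant \<open>u0\<close> serves contraction.\<close>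

definition data :: "nat \<Rightarrow> ('w \<Rightarrow> 'h) \<Rightarrow> 'w \<Rightarrow> 'h" where
  "data n g w = Ta (T (g w)) + (1 / sqrt (real n)) *\<^sub>R V w"

lemma V_scaled_meas [measurable]: "(\<lambda>w. c *\<^sub>R V w) \<in> borel_measurable M"
  by (rule borel_measurable_scaleR[OF borel_measurable_const V_meas])

lemma data_meas [measurable]: "g \<in> borel_measurable M \<Longrightarrow> data n g \<in> borel_measurable M"
  unfolding data_def[abs_def]
  by (intro borel_measurable_add V_scaled_meas measurable_compose[OF _ Ta_meas] measurable_compose[OF _ T_meas])

lemma process_eq:
  "data_process \<eta> n (\<lambda>w. G (g w)) (inv_sqrt \<zeta> (B x)) w = T (g w) \<bullet> B x + \<eta> x w / sqrt (real n)"
proof -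
  have "inv_sqrt \<zeta> (B x) = x" unfolding inv_sqrt_def op_sqrt_B by (rule inv_f_f[OF Bp.J_inj])
  then show ?thesis
    using self_adjointD[OF Bp.J_sa, of "T (g w)" x] by (simp add: data_process_def B_T)
qed

text \<open>Along any sequence \<open>h k = B (z k)\<close> tending to \<open>T u\<close> the error
  splits into a signal part, which vanishes pointwise, and a noise part, which
  \<open>represents_tail\<close> makes small in probability.\<close>

lemma data_realisation:
  assumes g [measurable]: "g \<in> borel_measurable M" and n: "n \<ge> 1"
  shows "is_realisation M G \<zeta> (data_process \<eta> n (\<lambda>w. G (g w))) (\<lambda>w. functional (data n g w))"
  unfolding is_realisation_def
proof (intro conjI ballI)
  show "(\<lambda>(w, u). functional (data n g w) (G u)) \<in> borel_measurable (M \<Otimes>\<^sub>M borel)"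
    unfolding functional_G by measurable
  fix x assume "x \<in> range G"
  then obtain u where x: "x = G u" by auto
  show "is_zeta_pairing M \<zeta> (data_process \<eta> n (\<lambda>w. G (g w))) x (\<lambda>w. functional (data n g w) x)"
    unfolding is_zeta_pairing_def x functional_G inv_sqrt_G op_sqrt_B
  proof (intro conjI allI impI)
    show "(\<lambda>w. data n g w \<bullet> u) \<in> borel_measurable M" by measurable
    fix h :: "nat \<Rightarrow> 'h" and e :: real
    assume h: "(\<forall>k. h k \<in> range B) \<and> h \<longlonglongrightarrow> T u" and e: "e > 0"
    from h have "\<forall>k. \<exists>z. h k = B z" by blast
    then obtain z where z: "\<And>k. h k = B (z k)" by metis
    have hz: "h = (\<lambda>k. B (z k))" by (rule ext) (rule z)
    have sn: "sqrt (real n) > 0" using n by simp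
    define X where "X k w = T (g w) \<bullet> (B (z k) - T u)" for k w
    have [measurable]: "X k \<in> borel_measurable M" for k unfolding X_def by measurable
    define W where "W k w = (\<eta> (z k) w - V w \<bullet> u)" for k w
    have [measurable]: "W k \<in> borel_measurable M" for k unfolding W_def by measurable
    let ?y = "data_process \<eta> n (\<lambda>w. G (g w))"
    let ?E = "\<lambda>k. {w\<in>space M. e < \<bar>?y (inv_sqrt \<zeta> (h k)) w - data n g w \<bullet> u\<bar>}"
    let ?X = "\<lambda>k. {w\<in>space M. \<bar>X k w\<bar> > e / 2}" and ?W = "\<lambda>k. {w\<in>space M. \<bar>W k w\<bar> > sqrt (real n) * e / 2}"
    let ?b = "\<lambda>k. norm (B (z k) - T u) / (sqrt (real n) * e / 2)"
    have Bz: "(\<lambda>k. B (z k) - T u) \<longlonglongrightarrow> 0" using h unfolding hz by (simp add: LIM_zero)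
    have "(\<lambda>k. X k w) \<longlonglongrightarrow> T (g w) \<bullet> 0" for w
      unfolding X_def by (intro tendsto_intros Bz)
    then have X0: "(\<lambda>k. measure M (?X k)) \<longlonglongrightarrow> 0"
      using e by (intro tendsto_measure_zero) (auto intro: prob_space_axioms)
    have W_le: "measure M (?W k) \<le> ?b k" for k
      unfolding W_def by (rule represents_tail[OF V_represents]) (use sn e in simp)
    show "(\<lambda>k. measure M (?E k)) \<longlonglongrightarrow> 0"
    proof (rule tendsto_sandwich[OF _ _ tendsto_const])
      show "(\<lambda>k. measure M (?X k) + ?b k) \<longlonglongrightarrow> 0"
        using tendsto_add[OF X0 tendsto_divide[OF tendsto_norm[OF Bz] tendsto_const, of "sqrt (real n) * e / 2"]] sn e
        by simp
      show "\<forall>\<^sub>F k in sequentially. measure M (?E k)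
          \<le> measure M (?X k) + ?b k"
      proof (intro always_eventually allI)
        fix k
        have eq: "?y (inv_sqrt \<zeta> (h k)) w - data n g w \<bullet> u = X k w + W k w / sqrt (real n)" for w
          unfolding z process_eq
          by (simp add: data_def X_def W_def inner_add_left Ta_inner inner_diff_right diff_divide_distrib)
        have "?E k \<subseteq>
            ?X k \<union> ?W k"
        proof
          fix w assume "w \<in> ?E k"
          then have w: "w \<in> space M" "e < \<bar>X k w + W k w / sqrt (real n)\<bar>" by (simp_all add: eq)
          have "e / 2 < \<bar>X k w\<bar> \<or> e / 2 < \<bar>W k w / sqrt (real n)\<bar>" using w(2) by linarith
          then show "w \<in> ?X k \<union> ?W k"
            using w(1) sn by (auto simp: field_simps abs_mult)
        qed
        then have "measure M (?E k) \<le>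
            measure M (?X k \<union> ?W k)"
          by (rule finite_measure_mono) measurable
        also have "\<dots> \<le> measure M (?X k) + measure M (?W k)"
          by (rule measure_Un_le) measurable
        finally show "measure M (?E k)
          \<le> measure M (?X k) + ?b k"
          using W_le[of k] by linarith
      qed
    qed simp
  qed
qed

text \<open>Limits in probability are unique; density of \<open>range B\<close> supplies an
  approximating sequence, without which the condition on pairings would be vacuous.\<close>

lemma pairing_unique:
  assumes g [measurable]: "g \<in> borel_measurable M"
    and Z: "is_zeta_pairing M \<zeta> (data_process \<eta> n (\<lambda>w. G (g w))) (G u) Z"
    and Z': "is_zeta_pairing M \<zeta> (data_process \<eta> n (\<lambda>w. G (g w))) (G u) Z'"
  shows "AE w in M. Z w = Z' w"
proof -
  let ?y = "data_process \<eta> n (\<lambda>w. G (g w))"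
  have [measurable]: "Z \<in> borel_measurable M" "Z' \<in> borel_measurable M"
    using Z Z' by (auto simp: is_zeta_pairing_def)
  have "T u \<in> closure (range B)" by (simp add: B_dense)
  then obtain h where h: "\<And>k. h k \<in> range B" "h \<longlonglongrightarrow> T u"
    unfolding closure_sequential by blast
  let ?Y = "\<lambda>k w. ?y (inv_sqrt \<zeta> (h k)) w"
  have [measurable]: "?Y k \<in> borel_measurable M" for k unfolding data_process_def by measurable
  have lim: "(\<lambda>k. measure M {w\<in>space M. \<bar>?Y k w - X w\<bar> > e}) \<longlonglongrightarrow> 0"
    if "is_zeta_pairing M \<zeta> ?y (G u) X" "e > 0" for X e
    using that h unfolding is_zeta_pairing_def op_sqrt_B inv_sqrt_G by blast
  have zero: "measure M {w\<in>space M. \<bar>Z w - Z' w\<bar> > e} = 0" if e: "e > 0" for e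
  proof -
    let ?A = "\<lambda>Z k. {w\<in>space M. \<bar>?Y k w - Z w\<bar> > e / 2}"
    have "measure M {w\<in>space M. \<bar>Z w - Z' w\<bar> > e} \<le>
        measure M (?A Z k) + measure M (?A Z' k)" for k
    proof -
      have "measure M {w\<in>space M. \<bar>Z w - Z' w\<bar> > e} \<le>
          measure M (?A Z k \<union> ?A Z' k)"
      proof (rule finite_measure_mono)
        have "e / 2 < \<bar>x - z\<bar> \<or> e / 2 < \<bar>x - z'\<bar>" if "e < \<bar>z - z'\<bar>" for x z z' :: real
          using that by linarith
        then show "{w\<in>space M. \<bar>Z w - Z' w\<bar> > e} \<subseteq> ?A Z k \<union> ?A Z' k" by blast
      qed measurable
      also have "\<dots> \<le> measure M (?A Z k) + measure M (?A Z' k)"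
        by (rule measure_Un_le) measurable
      finally show ?thesis .
    qed
    moreover have "(\<lambda>k. measure M (?A Z k) + measure M (?A Z' k)) \<longlonglongrightarrow> 0 + 0"
      using e by (intro tendsto_add lim Z Z') auto
    ultimately have "measure M {w\<in>space M. \<bar>Z w - Z' w\<bar> > e} \<le> 0 + 0"
      by (intro LIMSEQ_le_const) auto
    then show ?thesis by (simp add: measure_le_0_iff)
  qed
  have "AE w in M. \<not> \<bar>Z w - Z' w\<bar> > 1 / real (Suc m)" for m
    by (subst AE_iff_measurable[OF _ refl]) (auto simp: emeasure_eq_measure zero simp del: of_nat_Suc)
  then have "AE w in M. \<forall>m. \<not> \<bar>Z w - Z' w\<bar> > 1 / real (Suc m)" by (simp add: AE_all_countable)
  then show ?thesis
  proof eventually_elim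
    fix w assume small: "\<forall>m. \<not> \<bar>Z w - Z' w\<bar> > 1 / real (Suc m)"
    show "Z w = Z' w"
    proof (rule ccontr)
      assume "Z w \<noteq> Z' w"
      then obtain m where "inverse (real (Suc m)) < \<bar>Z w - Z' w\<bar>"
        using reals_Archimedean[of "\<bar>Z w - Z' w\<bar>"] by auto
      then show False using small by (simp add: inverse_eq_divide)
    qed
  qed
qed

section \<open>Well-posedness and contraction of the posterior\<close>

lemma posterior_eq:
  assumes "tilted_gaussian \<mu> Q T (real n)" and y: "\<And>u. y (G u) = v \<bullet> u"
  shows "posterior \<mu> G \<zeta> n y = tilted_gaussian.post \<mu> T (real n) v"
proof -
  interpret tilted_gaussian \<mu> Q T "real n" by fact
  show ?thesis unfolding posterior_def post_def Z_def post_weight_eq[OF y] ..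
qed

lemma tilted:
  assumes "gaussian_prior \<mu> Q" "n \<ge> 1"
  shows "tilted_gaussian \<mu> Q T (real n)"
  using assms T_bl by (simp add: tilted_gaussian_def tilted_gaussian_axioms_def)

lemma model_well_posed:
  assumes prior: "gaussian_prior \<mu> Q" and n: "n \<ge> 1" and U [measurable]: "U \<in> borel_measurable M"
  shows "well_posed M \<eta> \<zeta> G \<mu> U n"
proof -
  interpret P: tilted_gaussian \<mu> Q T "real n" by (rule tilted[OF prior n])
  have post: "posterior \<mu> G \<zeta> n (functional v) = P.post v" for v
    by (rule posterior_eq[OF P.tilted_gaussian_axioms functional_G])
  show ?thesis
    unfolding well_posed_def
  proof (rule exI[of _ "range functional"], rule exI[of _ functional_norm], intro conjI)
    show "banach_space_of_functionals (range G) (range functional) functional_norm"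
      by (rule banach_space_functional)
    show "\<exists>L. is_realisation M G \<zeta> (data_process \<eta> n (\<lambda>w. G (U w))) L \<and>
        (AE w in M. L w \<in> range functional) \<and>
        (\<forall>W. open_in_norm (range functional) functional_norm W \<longrightarrow> {w\<in>space M. L w \<in> W} \<in> sets M)"
    proof (intro exI[of _ "\<lambda>w. functional (data n U w)"] conjI allI impI)
      show "is_realisation M G \<zeta> (data_process \<eta> n (\<lambda>w. G (U w))) (\<lambda>w. functional (data n U w))"
        by (rule data_realisation[OF U n])
      fix W assume W: "open_in_norm (range functional) functional_norm W"
      \<comment> \<open>\<open>functional\<close> is an isometry, so norm-open sets of functionals
        pull back to open sets of H and measurability reduces to that of
        \<open>data\<close>.\<close>
      have "open {v. functional v \<in> W}"
        unfolding open_dist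
      proof
        fix v assume "v \<in> {v. functional v \<in> W}"
        then obtain e where e: "e > 0"
          "\<forall>z\<in>range functional. functional_norm (\<lambda>x. z x - functional v x) < e \<longrightarrow> z \<in> W"
          using W unfolding open_in_norm_def by blast
        then show "\<exists>e>0. \<forall>w. dist w v < e \<longrightarrow> w \<in> {v. functional v \<in> W}"
          by (intro exI[of _ e]) (auto simp: functional_diff dist_norm)
      qed
      then have "data n U -` {v. functional v \<in> W} \<inter> space M \<in> sets M"
        by (intro measurable_sets[OF data_meas[OF U]]) simp
      then show "{w\<in>space M. functional (data n U w) \<in> W} \<in> sets M"
        by (simp add: vimage_def Int_def conj_commute)
    qed simp
    show "\<forall>y\<in>range functional. integrable \<mu> (post_weight G \<zeta> n y) \<and> prob_space (posterior \<mu> G \<zeta> n y)"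
    proof
      fix y assume "y \<in> range functional"
      then obtain v where v: "y = functional v" by auto
      have "post_weight G \<zeta> n y = tilt T (real n) v" by (rule ext) (simp add: v post_weight_eq)
      then show "integrable \<mu> (post_weight G \<zeta> n y) \<and> prob_space (posterior \<mu> G \<zeta> n y)"
        using P.tilt_integrable P.post_prob_space by (simp add: v post)
    qed
    show "\<forall>y\<in>range functional. \<forall>\<epsilon>>0. \<exists>d>0. \<forall>z\<in>range functional. functional_norm (\<lambda>x. z x - y x) < d \<longrightarrow>
        hellinger_dist \<mu> (posterior \<mu> G \<zeta> n z) (posterior \<mu> G \<zeta> n y) < \<epsilon>"
      using P.hellinger_continuous by (auto simp: functional_diff post)
  qed
qed

text \<open>For each \<open>u\<close> the realisation agrees with \<open>data\<close> off a null set
  depending on \<open>u\<close>. Fubini exchanges the quantifiers, and agreement for almost every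
  \<open>u\<close> determines the density.\<close>

lemma realisation_posterior:
  assumes prior: "gaussian_prior \<mu> Q" and n: "n \<ge> 1"
    and L: "is_realisation M G \<zeta> (data_process \<eta> n (\<lambda>_. G u0)) L"
  shows "AE w in M. posterior \<mu> G \<zeta> n (L w) = tilted_gaussian.post \<mu> T (real n) (data n (\<lambda>_. u0) w)"
proof -
  interpret P: tilted_gaussian \<mu> Q T "real n" by (rule tilted[OF prior n])
  interpret MP: pair_prob_space M \<mu> ..
  let ?v = "data n (\<lambda>_. u0)"
  have sets_M\<mu>: "sets (M \<Otimes>\<^sub>M \<mu>) = sets (M \<Otimes>\<^sub>M borel)"
    by (rule sets_pair_measure_cong[OF refl P.sets_prior])
  have L_meas [measurable]: "(\<lambda>p. L (fst p) (G (snd p))) \<in> borel_measurable (M \<Otimes>\<^sub>M \<mu>)"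
    using L unfolding is_realisation_def measurable_cong_sets[OF sets_M\<mu> refl] by (simp add: split_def)
  have v_meas [measurable]: "?v \<in> borel_measurable M" by measurable
  have L0: "is_realisation M G \<zeta> (data_process \<eta> n (\<lambda>_. G u0)) (\<lambda>w. functional (?v w))"
    using data_realisation[of "\<lambda>_. u0" n] n by simp
  have pt: "AE w in M. L w (G u) = ?v w \<bullet> u" for u
  proof -
    have "AE w in M. L w (G u) = functional (?v w) (G u)"
      using L L0 unfolding is_realisation_def by (intro pairing_unique[of "\<lambda>_. u0" n]) auto
    then show ?thesis by simp
  qed
  have "AE w in M. AE u in \<mu>. L w (G u) = ?v w \<bullet> u"
  proof (subst MP.AE_commute)
    show "{x \<in> space (M \<Otimes>\<^sub>M \<mu>). L (fst x) (G (snd x)) = ?v (fst x) \<bullet> snd x} \<in> sets (M \<Otimes>\<^sub>M \<mu>)"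
      by measurable
  qed (simp add: pt)
  then show ?thesis
    using AE_space
  proof eventually_elim
    fix w assume AE: "AE u in \<mu>. L w (G u) = ?v w \<bullet> u" and w: "w \<in> space M"
    have [measurable]: "(\<lambda>u. L w (G u)) \<in> borel_measurable \<mu>"
      using measurable_Pair2[OF L_meas w] by simp
    have pw_meas [measurable]: "post_weight G \<zeta> n (L w) \<in> borel_measurable \<mu>"
    proof -
      have "(\<lambda>u. (norm (T u))\<^sup>2) \<in> borel_measurable \<mu>" unfolding P.prior_meas by measurable
      then show ?thesis unfolding post_weight_def zeta_inner_G by measurable
    qed
    have eq: "AE u in \<mu>. post_weight G \<zeta> n (L w) u = tilt T (real n) (?v w) u"
      using AE by eventually_elim (simp add: post_weight_def tilt_def zeta_inner_G)
    have int: "(\<integral>u. post_weight G \<zeta> n (L w) u \<partial>\<mu>) = P.Z (?v w)"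
      unfolding P.Z_def using eq by (intro integral_cong_AE) auto
    show "posterior \<mu> G \<zeta> n (L w) = P.post (?v w)"
      unfolding posterior_def P.post_def int
      by (rule density_cong) (use eq in auto)
  qed
qed

text \<open>The radius \<open>4 * c * \<xi> n\<close> is shared out: one \<open>c\<close> for the
  bias, one for the noise part of the mean and two for the posterior spread around the mean.\<close>

lemma model_contraction:
  fixes \<mu> :: "nat \<Rightarrow> 'h measure" and C :: "'h \<Rightarrow> 'h" and \<rho> \<xi> :: "nat \<Rightarrow> real"
  assumes prior: "\<And>n. n \<ge> 1 \<Longrightarrow> gaussian_prior (\<mu> n) (\<lambda>x. (1 / \<rho> n) *\<^sub>R C x)"
    and ridge: "\<And>n. n \<ge> 1 \<Longrightarrow> ridge \<phi> l lmax T (\<rho> n) (real n)"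
    and l: "summable l" and C: "\<And>x. C x = eig_op \<phi> l x"
    and bias: "\<forall>\<^sub>F n in sequentially. norm (ridge.mean \<phi> l T (\<rho> n) (real n) (Ta (T u0)) - u0) \<le> c * \<xi> n"
    and c: "c > 0" and \<xi>: "\<forall>\<^sub>F n in sequentially. \<xi> n > 0"
    and rate: "(\<lambda>n. 1 / (\<rho> n * (\<xi> n)\<^sup>2)) \<longlonglongrightarrow> 0"
  shows "contraction_rate M \<eta> \<zeta> G \<mu> u0 \<xi>"
proof -
  let ?data = "\<lambda>L. \<forall>n\<ge>1. is_realisation M G \<zeta> (data_process \<eta> n (\<lambda>_. G u0)) (L n)"
  define tr where "tr = (\<Sum>j. l j)"
  have rate': "(\<lambda>n. tr / (\<rho> n * (k * \<xi> n)\<^sup>2)) \<longlonglongrightarrow> 0" for k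
    using tendsto_mult_left[OF rate, of "tr / k\<^sup>2"] by (simp add: power_mult_distrib mult_ac)
  have ex: "\<exists>L. ?data L"
    using data_realisation[of "\<lambda>_. u0"]
    by (intro exI[of _ "\<lambda>n w. functional (data n (\<lambda>_. u0) w)"]) simp
  have "(\<lambda>n. measure M {w\<in>space M. measure (posterior (\<mu> n) G \<zeta> n (L n w)) {u. norm (u - u0) > 4 * c * \<xi> n} > \<epsilon>}) \<longlonglongrightarrow> 0"
    if L: "?data L" and e: "\<epsilon> > 0" for L \<epsilon>
  proof (rule tendsto_sandwich[OF _ _ tendsto_const rate'[of c]])
    show "\<forall>\<^sub>F n in sequentially. measure M {w\<in>space M. measure (posterior (\<mu> n) G \<zeta> n (L n w)) {u. norm (u - u0) > 4 * c * \<xi> n} > \<epsilon>}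
        \<le> tr / (\<rho> n * (c * \<xi> n)\<^sup>2)"
      using bias \<xi> order_tendstoD(2)[OF rate'[of "2 * c"] e] eventually_ge_at_top[of 1]
    proof eventually_elim
      case (elim n)
      interpret P: tilted_gaussian "\<mu> n" "\<lambda>x. (1 / \<rho> n) *\<^sub>R C x" T "real n"
        by (rule tilted[OF prior]) (use elim in auto)
      interpret R: ridge \<phi> l lmax T "\<rho> n" "real n" by (rule ridge) (use elim in auto)
      have SS: "R.S (R.S x) = C x" for x
      proof (rule onb_eqI[OF onb])
        fix j
        have "\<bar>l j\<bar> \<le> lmax" for j using R.l_pos[of j] R.l_le[of j] by simp
        then have "eig_op \<phi> l x \<bullet> \<phi> j = l j * (x \<bullet> \<phi> j)" by (rule eig_op_bounded_inner[OF onb])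
        then show "R.S (R.S x) \<bullet> \<phi> j = C x \<bullet> \<phi> j"
          using R.l_pos[of j] by (simp add: R.S_inner C flip: mult.assoc)
      qed
      have c\<xi>: "c * \<xi> n > 0" using c elim by simp
      let ?v = "data n (\<lambda>_. u0)"
      \<comment> \<open>The exceptional event for the noise; off it the posterior mass of the
        complement is at most \<open>\<epsilon>\<close> for every outcome.\<close>
      define N where "N = {w\<in>space M. norm (R.mean ((1 / sqrt (real n)) *\<^sub>R V w)) > c * \<xi> n}"
      have "R.mean \<in> borel_measurable borel"
        by (intro borel_measurable_continuous_onI linear_continuous_on R.mean_bl)
      then have N_sets: "N \<in> sets M" unfolding N_def by measurable
      have small: "measure (P.post (?v w)) {u. norm (u - u0) > 4 * c * \<xi> n} \<le> \<epsilon>"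
        if w: "w \<in> space M" "w \<notin> N" for w
      proof -
        define m where "m = R.mean (?v w)"
        define g where "g = real n *\<^sub>R (?v w - Ta (T m))"
        have "m = R.mean (Ta (T u0)) + R.mean ((1 / sqrt (real n)) *\<^sub>R V w)"
          unfolding m_def data_def by (rule linear_simps(1)[OF R.mean_bl])
        then have "norm (m - u0) \<le> norm (R.mean (Ta (T u0)) - u0) + norm (R.mean ((1 / sqrt (real n)) *\<^sub>R V w))"
          using norm_triangle_ineq[of "R.mean (Ta (T u0)) - u0" "R.mean ((1 / sqrt (real n)) *\<^sub>R V w)"]
          by (simp add: algebra_simps)
        also have "\<dots> \<le> c * \<xi> n + c * \<xi> n" using elim w by (intro add_mono) (auto simp: N_def)
        finally have m: "norm (m - u0) \<le> 2 * c * \<xi> n" by simp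
        have var: "(\<integral>\<^sup>+u. ennreal (((u - m) \<bullet> x)\<^sup>2) \<partial>P.post (?v w)) \<le> ennreal (P.q x)" for x
        proof (rule P.post_variance_le[OF prob_space_axioms V_meas])
          show "(\<integral>w. cos (s * (V w \<bullet> u) + \<theta>) \<partial>M) = exp (- (s\<^sup>2 * (norm (T u))\<^sup>2 / 2)) * cos \<theta>" for u s \<theta>
            by (rule represents_cos[OF V_represents])
          show "g \<bullet> u = real n * (?v w \<bullet> u) - real n * (T m \<bullet> T u)" for u
            by (simp add: g_def inner_diff_left Ta_inner right_diff_distrib)
          show "(1 / \<rho> n) *\<^sub>R C g = m"
            using R.mean_fixpoint[of "?v w"] unfolding SS g_def m_def .
        qed
        have q\<phi>: "P.q (\<phi> j) = l j / \<rho> n" for j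
          by (simp add: C eig_op_basis[OF onb] onb_inner[OF onb])
        have "measure (P.post (?v w)) {u. norm (u - u0) > 4 * c * \<xi> n} \<le>
            measure (P.post (?v w)) {u. norm (u - m) > 2 * c * \<xi> n}"
        proof (rule finite_measure.finite_measure_mono)
          show "finite_measure (P.post (?v w))"
            by (rule prob_space.finite_measure[OF P.post_prob_space])
          show "{u. norm (u - u0) > 4 * c * \<xi> n} \<subseteq> {u. norm (u - m) > 2 * c * \<xi> n}"
          proof
            fix u assume u: "u \<in> {u. norm (u - u0) > 4 * c * \<xi> n}"
            have "norm (u - u0) \<le> norm (u - m) + norm (m - u0)"
              using norm_triangle_ineq[of "u - m" "m - u0"] by simp
            then show "u \<in> {u. norm (u - m) > 2 * c * \<xi> n}" using u m by simp
          qed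
          have "open {u. norm (u - m) > 2 * c * \<xi> n}" by (intro open_Collect_less continuous_intros)
          then show "{u. norm (u - m) > 2 * c * \<xi> n} \<in> sets (P.post (?v w))"
            by (simp add: P.sets_prior)
        qed
        also have "\<dots> \<le> (\<Sum>j. P.q (\<phi> j)) / (2 * c * \<xi> n)\<^sup>2"
        proof (rule P.post_tail_le[OF onb _ _ var])
          show "summable (\<lambda>j. P.q (\<phi> j))" unfolding q\<phi> by (intro summable_divide l)
          show "2 * c * \<xi> n > 0" using c\<xi> by simp
        qed
        also have "\<dots> = tr / (\<rho> n * (2 * c * \<xi> n)\<^sup>2)"
          unfolding q\<phi> by (simp add: tr_def suminf_divide[OF l])
        finally show ?thesis using elim by simp
      qed
      have tail: "measure M N \<le> tr / (\<rho> n * (c * \<xi> n)\<^sup>2)"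
        unfolding N_def tr_def
        by (rule R.mean_noise_tail[OF represents_second_moment[OF V_represents] V_meas prob_space_axioms l c\<xi>])
      let ?E = "{w\<in>space M. measure (posterior (\<mu> n) G \<zeta> n (L n w)) {u. norm (u - u0) > 4 * c * \<xi> n} > \<epsilon>}"
      have "measure M ?E \<le> measure M N"
      \<comment> \<open>An arbitrary realisation does not come with measurability of
        \<open>?E\<close>; outside \<open>sets M\<close> the value of \<open>measure\<close> is 0 by
        convention.\<close>
      proof (cases "?E \<in> sets M")
        case True
        have "AE w in M. posterior (\<mu> n) G \<zeta> n (L n w) = P.post (?v w)"
          using L elim by (intro realisation_posterior[OF prior]) auto
        then have "AE w in M. w \<in> ?E \<longrightarrow> w \<in> N"
        proof eventually_elim
          fix w assume p: "posterior (\<mu> n) G \<zeta> n (L n w) = P.post (?v w)"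
          show "w \<in> ?E \<longrightarrow> w \<in> N"
          proof (rule impI, rule ccontr)
            assume "w \<in> ?E" and N: "w \<notin> N"
            then have "w \<in> space M" "measure (P.post (?v w)) {u. norm (u - u0) > 4 * c * \<xi> n} > \<epsilon>"
              by (simp_all add: p)
            then show False using small[OF _ N] by simp
          qed
        qed
        then show ?thesis using N_sets by (rule finite_measure_mono_AE)
      next
        case False
        then show ?thesis by (simp add: measure_notin_sets)
      qed
      then show ?case using tail by linarith
    qed
  qed simp
  then show ?thesis
    unfolding contraction_rate_def Let_def using ex c by (intro conjI exI[of _ "4 * c"]) auto
qed

end

section \<open>Eigenvalues of the severely ill-posed problem\<close>

lemma index_powr_exp_bound:
  fixes \<beta> k :: real
  assumes "\<beta> > 0"
  shows "\<exists>c>0. \<forall>i\<ge>1. i powr k * exp (- (i powr \<beta>)) \<le> c"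
proof -
  obtain c where c: "c > 0" "\<And>x. x \<ge> 1 \<Longrightarrow> x powr (k / \<beta>) * exp (- 1 * x) \<le> c"
    using powr_exp_bound[of 1 "k / \<beta>"] by auto
  have "i powr k * exp (- (i powr \<beta>)) \<le> c" if "i \<ge> 1" for i
    using c(2)[of "i powr \<beta>"] that assms by (simp add: powr_powr ge_one_powr_ge_zero)
  then show ?thesis using c(1) by blast
qed

lemma summable_index_powr_exp:
  fixes \<beta> k :: real
  assumes "\<beta> > 0"
  shows "summable (\<lambda>j. real (Suc j) powr k / exp (real (Suc j) powr \<beta>))"
proof -
  \<comment> \<open>Two extra powers are spent on the summable majorant
    \<open>1 / i^2\<close>.\<close>
  obtain c where c: "\<And>i. i \<ge> 1 \<Longrightarrow> i powr (k + 2) * exp (- (i powr \<beta>)) \<le> c"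
    using index_powr_exp_bound[OF assms, of "k + 2"] by blast
  show ?thesis
  proof (rule summable_comparison_test')
    show "summable (\<lambda>j. c * (1 / (real (Suc j))\<^sup>2))"
      using inverse_power_summable[of 2, where 'a = real]
      by (intro summable_mult) (subst summable_Suc_iff, simp add: inverse_eq_divide)
    fix j
    let ?i = "real (Suc j)"
    have "?i powr k / exp (?i powr \<beta>) = ?i powr (k + 2) * exp (- (?i powr \<beta>)) * (1 / ?i\<^sup>2)"
      by (simp add: powr_add powr_numeral exp_minus field_simps del: of_nat_Suc)
    also have "\<dots> \<le> c * (1 / ?i\<^sup>2)" by (intro mult_right_mono c) auto
    finally show "norm (?i powr k / exp (?i powr \<beta>)) \<le> c * (1 / ?i\<^sup>2)" by simp
  qed
qed

lemma summable_eigval: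
  assumes "\<delta> > 0"
  shows "summable (eigval \<delta>)"
proof -
  have "summable (\<lambda>j. real j powr (- 1 - 2 * \<delta>))"
    using assms by (subst summable_real_powr_iff) simp
  then show ?thesis unfolding eigval_def[abs_def] by (subst summable_Suc_iff)
qed

lemma eigval_pos: "eigval \<delta> j > 0"
  by (simp add: eigval_def)

lemma eigval_le1: "\<delta> > 0 \<Longrightarrow> eigval \<delta> j \<le> 1"
  unfolding eigval_def using powr_mono[of "- 1 - 2 * \<delta>" 0 "real (Suc j)"] by simp

lemma eigval_powr: "eigval \<delta> j powr (- r) = real (Suc j) powr ((1 + 2 * \<delta>) * r)"
  by (simp add: eigval_def powr_powr algebra_simps)

text \<open>Of the decay \<open>n powr (- 2 * a)\<close>, with \<open>a = 1 / 2 - \<sigma>\<close>,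
  one half absorbs the power of the logarithm and the other half tends to 0.\<close>

lemma log_rate_vanishes:
  fixes \<sigma> k :: real
  assumes \<sigma>: "\<sigma> < 1 / 2"
  shows "(\<lambda>n. 1 / ((real n powr (1 / 2 - \<sigma>))\<^sup>2 * (ln (real n) powr k)\<^sup>2)) \<longlonglongrightarrow> 0"
proof -
  define a where "a = 1 / 2 - \<sigma>"
  have a: "a > 0" using \<sigma> by (simp add: a_def)
  obtain c where c: "c > 0" "\<And>x. x \<ge> 1 \<Longrightarrow> x powr (- 2 * k) * exp (- a * x) \<le> c"
    using powr_exp_bound[OF a, of "- 2 * k"] by blast
  show ?thesis
  proof (rule Lim_null_comparison)
    have "(\<lambda>n. c * real n powr (- a)) \<longlonglongrightarrow> c * 0"
      using a by (intro tendsto_intros tendsto_neg_powr filterlim_real_sequentially) simp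
    then show "(\<lambda>n. c * real n powr (- a)) \<longlonglongrightarrow> 0" by simp
    have "\<forall>\<^sub>F n in sequentially. ln (real n) \<ge> 1"
      using filterlim_compose[OF ln_at_top filterlim_real_sequentially] by (simp add: filterlim_at_top)
    then show "\<forall>\<^sub>F n in sequentially. norm (1 / ((real n powr (1 / 2 - \<sigma>))\<^sup>2 * (ln (real n) powr k)\<^sup>2)) \<le> c * real n powr (- a)"
      using eventually_ge_at_top[of 1]
    proof eventually_elim
      case (elim n)
      have n: "real n > 0" using elim by simp
      have "1 / ((real n powr (1 / 2 - \<sigma>))\<^sup>2 * (ln (real n) powr k)\<^sup>2) =
          ln (real n) powr (- 2 * k) * exp (- a * ln (real n)) * real n powr (- a)"
        using n elim
        by (simp add: power2_eq_square powr_minus powr_add[symmetric] a_def[symmetric] exp_minus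
            powr_def[of "real n"] field_simps flip: exp_add)
      also have "\<dots> \<le> c * real n powr (- a)"
        using c(2)[OF elim(1)] by (rule mult_right_mono) simp
      finally show ?case by simp
    qed
  qed
qed

theorem theorem4p9:
  fixes \<phi> :: "nat \<Rightarrow> 'h::{real_inner,banach,second_countable_topology}"
    and C K1 K2 G \<zeta> :: "'h \<Rightarrow> 'h"
    and \<delta> \<beta> \<beta>' r :: real
    and R :: "nat \<Rightarrow> real"
    and \<mu> :: "nat \<Rightarrow> 'h measure"
    and M :: "'w measure"
    and \<eta> :: "'h \<Rightarrow> 'w \<Rightarrow> real"
    and U :: "nat \<Rightarrow> 'w \<Rightarrow> 'h"
  assumes "orthonormal_basis \<phi>"
    and "\<delta> > 0"
    and "bounded_linear C" and "self_adjoint C" and "positive_definite_op C"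
    and "\<And>j. C (\<phi> j) = eigval \<delta> j *\<^sub>R \<phi> j"
    and "\<beta>' > 0" and "\<beta> > 0"
    and "\<And>j. eigval \<delta> j powr (- \<beta>') = real (Suc j) powr \<beta>"
    and "bounded_linear K1" and "self_adjoint K1" and "positive_op K1"
    and "bounded_linear K2" and "self_adjoint K2" and "positive_op K2"
    and "r \<ge> 0" and "r = 0 \<Longrightarrow> K1 = (\<lambda>_. 0)"
    and "G = forward_op \<phi> \<delta> \<beta>' K2"
    and "\<zeta> = noise_cov \<phi> \<delta> r K1"
    and "\<And>n. n \<ge> 1 \<Longrightarrow> R n > 0"
    and "\<And>n. n \<ge> 1 \<Longrightarrow> centered_gaussian (\<mu> n) (\<lambda>x. (1 / (R n)\<^sup>2) *\<^sub>R C x)"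
    and "prob_space M"
    and "gaussian_noise M \<eta> \<zeta>"
    and "\<And>n. n \<ge> 1 \<Longrightarrow> U n \<in> measurable M borel"
    and "\<And>n. n \<ge> 1 \<Longrightarrow> distr M borel (U n) = \<mu> n"
    and "\<And>n. n \<ge> 1 \<Longrightarrow> independent_of_noise M \<eta> (U n)"
  shows "(\<forall>n\<ge>1. well_posed M \<eta> \<zeta> G (\<mu> n) (U n) n) \<and>
    (\<forall>\<sigma> \<gamma> u0. 0 < \<sigma> \<and> \<sigma> < 1 / 2 \<and> (\<forall>n\<ge>1. R n = real n powr (1 / 2 - \<sigma>)) \<and>
        \<gamma> > 0 \<and> u0 \<in> smooth_space \<phi> \<gamma> \<longrightarrow>
      contraction_rate M \<eta> \<zeta> G \<mu> u0 (\<lambda>n. ln (real n) powr (- \<gamma> / \<beta>)))"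
proof -
  note onb = assms(1) and \<delta> = assms(2) and \<beta> = assms(8)
  define p where "p = 1 + 2 * \<delta>"
  define a where "a j = exp (real (Suc j) powr \<beta>)" for j
  define b where "b j = real (Suc j) powr (p * r)" for j
  have p: "p > 0" using \<delta> by (simp add: p_def)
  have a_eq: "(\<lambda>j. exp (eigval \<delta> j powr (- \<beta>'))) = a"
    by (rule ext) (simp add: assms(9) a_def)
  have b_eq: "(\<lambda>j. eigval \<delta> j powr (- r)) = b"
    by (rule ext) (simp only: eigval_powr b_def p_def)
  obtain kmax where kmax: "\<And>i. i \<ge> 1 \<Longrightarrow> i powr (p * r) * exp (- (i powr \<beta>)) \<le> kmax"
    using index_powr_exp_bound[OF \<beta>, of "p * r"] by blast
  have pertA: "perturbed_diagonal \<phi> a K2"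
    by (rule perturbed_diagonal.intro[OF onb _ assms(13-15)]) (simp add: a_def)
  have pertB: "perturbed_diagonal \<phi> b K1"
    by (rule perturbed_diagonal.intro[OF onb _ assms(10-12)])
      (use assms(16) p in \<open>auto simp: b_def intro!: ge_one_powr_ge_zero\<close>)
  have smoothing: "smoothing \<phi> a b K1 K2 kmax"
  proof (intro smoothing.intro smoothing_axioms.intro pertA pertB)
    show "b j \<le> kmax * a j" for j
      using kmax[of "real (Suc j)"] by (simp add: a_def b_def exp_minus field_simps)
  qed
  interpret S: smoothing \<phi> a b K1 K2 kmax by (rule smoothing)
  have G: "G = S.G"
    by (simp add: assms(18) forward_op_def Let_def a_eq S.A.J_def S.A.Op_def[abs_def])
  have \<zeta>: "\<zeta> = S.B \<circ> S.B"
    by (simp add: assms(19) noise_cov_def Let_def b_eq S.Bp.J_def S.Bp.Op_def[abs_def])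
  have \<kappa>: "S.\<kappa> j = real (Suc j) powr (p * r) / exp (real (Suc j) powr \<beta>)" for j
    by (simp add: S.\<kappa>_def a_def b_def)
  interpret gaussian_model \<phi> a b K1 K2 kmax M \<eta>
  proof (intro gaussian_model.intro smoothing gaussian_model_axioms.intro)
    show "noise M S.B \<eta>"
      using assms(23) \<zeta> S.Bp.J_bl S.Bp.J_sa S.B_dense
      by (intro noise.intro noise_axioms.intro assms(22)) auto
    show "summable S.\<kappa>" unfolding \<kappa>[abs_def] by (rule summable_index_powr_exp[OF \<beta>])
  qed
  have C_pos: "C x \<bullet> x \<ge> 0" for x
    using assms(5) by (cases "x = 0") (auto simp: positive_definite_op_def less_imp_le)
  have C_eig: "C x = eig_op \<phi> (eigval \<delta>) x" for x
  proof (rule onb_eqI[OF onb])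
    fix j
    have "\<bar>eigval \<delta> j\<bar> \<le> 1" for j using eigval_pos[of \<delta> j] eigval_le1[OF \<delta>, of j] by simp
    then have "eig_op \<phi> (eigval \<delta>) x \<bullet> \<phi> j = eigval \<delta> j * (x \<bullet> \<phi> j)"
      by (rule eig_op_bounded_inner[OF onb])
    then show "C x \<bullet> \<phi> j = eig_op \<phi> (eigval \<delta>) x \<bullet> \<phi> j"
      by (simp add: self_adjointD[OF assms(4)] assms(6))
  qed
  have prior: "gaussian_prior (\<mu> n) (\<lambda>x. (1 / (R n)\<^sup>2) *\<^sub>R C x)" if "n \<ge> 1" for n
  proof (intro gaussian_prior.intro gaussian_prior_axioms.intro)
    show "prob_space (\<mu> n)" "sets (\<mu> n) = sets borel"
      "\<And>x. distr (\<mu> n) borel (\<lambda>u. u \<bullet> x) = gauss_law ((1 / (R n)\<^sup>2) *\<^sub>R C x \<bullet> x)"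
      using assms(21)[OF that] by (auto simp: centered_gaussian_def)
    show "bounded_linear (\<lambda>x. (1 / (R n)\<^sup>2) *\<^sub>R C x)"
      by (intro bounded_linear_const_scaleR assms(3))
    show "self_adjoint (\<lambda>x. (1 / (R n)\<^sup>2) *\<^sub>R C x)"
      using assms(4) by (simp add: self_adjoint_def)
    show "positive_op (\<lambda>x. (1 / (R n)\<^sup>2) *\<^sub>R C x)"
      using C_pos by (simp add: positive_op_def)
  qed
  have "well_posed M \<eta> \<zeta> G (\<mu> n) (U n) n" if "n \<ge> 1" for n
    unfolding \<zeta> G by (rule model_well_posed[OF prior[OF that] that assms(24)[OF that]])
  moreover have "contraction_rate M \<eta> \<zeta> G \<mu> u0 (\<lambda>n. ln (real n) powr (- \<gamma> / \<beta>))"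
    if \<sigma>: "0 < \<sigma>" "\<sigma> < 1 / 2" and R: "\<forall>n\<ge>1. R n = real n powr (1 / 2 - \<sigma>)"
      and \<gamma>: "\<gamma> > 0" and u0: "u0 \<in> smooth_space \<phi> \<gamma>" for \<sigma> \<gamma> u0
  proof -
    let ?\<xi> = "\<lambda>n. ln (real n) powr (- \<gamma> / \<beta>)"
    let ?\<rho> = "\<lambda>n. (R n)\<^sup>2"
    have ridge: "ridge \<phi> (eigval \<delta>) 1 S.T (?\<rho> n) (real n)" if "n \<ge> 1" for n
      by (rule ridge.intro[OF onb eigval_pos eigval_le1[OF \<delta>] S.T_bl T\<phi>_summable])
        (use that assms(20)[OF that] in auto)
    \<comment> \<open>The power of the index in \<open>\<kappa>^2\<close> times the eigenvalue:
      \<open>2 * p * r\<close> from the noise covariance and \<open>- p\<close> from the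
      prior.\<close>
    define q where "q = p * (2 * r - 1)"
    interpret F: filter_asymptotics \<sigma> \<beta> q by unfold_locales (use \<sigma> \<beta> in auto)
    \<comment> \<open>The next three constants feed the hypotheses \<open>P\<close>,
      \<open>A\<close> and \<open>A'\<close> of \<open>bias_bound\<close> with weights
      \<open>i powr (2 * \<gamma>)\<close>; the third bound is squared before use.\<close>
    obtain cP where cP: "cP > 0" "\<And>L i. L \<ge> 1 \<Longrightarrow> i \<ge> 1 \<Longrightarrow> i powr (- p) / (1 + F.filt L i) \<le> cP * F.J L powr (- p)"
      using F.filter_bias[of "- p"] p by auto
    obtain cA where cA: "cA > 0" "\<And>L i. L \<ge> 1 \<Longrightarrow> i \<ge> 1 \<Longrightarrow>
        i powr (p - 2 * \<gamma>) * F.filt L i / (1 + F.filt L i)\<^sup>2 \<le> cA * F.J L powr (p - 2 * \<gamma>)"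
      using F.filter_transition[of "p - 2 * \<gamma>"] by blast
    obtain cB where cB: "cB > 0" "\<And>L i. L \<ge> 1 \<Longrightarrow> i \<ge> 1 \<Longrightarrow> i powr (- \<gamma>) / (1 + F.filt L i) \<le> cB * F.J L powr (- \<gamma>)"
      using F.filter_bias[of "- \<gamma>"] \<gamma> by auto
    obtain c1 c2 where c1: "c1 > 0" "\<And>u. c1 * norm (eig_op \<phi> S.\<kappa> u) \<le> norm (S.T u)"
      and c2: "\<And>u. norm (S.T u) \<le> c2 * norm (eig_op \<phi> S.\<kappa> u)"
      using S.T_bounds by blast
    define w where "w j = real (Suc j) powr (2 * \<gamma>)" for j
    define D where "D = (\<Sum>j. w j * (u0 \<bullet> \<phi> j)\<^sup>2)"
    define c where "c = (c2\<^sup>2 + 1)\<^sup>2 / (2 * c1\<^sup>2) / min 1 (c1\<^sup>2 / 2)"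
    \<comment> \<open>The summand 1 keeps \<open>c0\<close> positive when
      \<open>u0 = 0\<close>.\<close>
    define c0 where "c0 = sqrt (c * cP * cA * D) + sqrt (cB\<^sup>2 * D) + 1"
    have w: "summable (\<lambda>j. w j * (u0 \<bullet> \<phi> j)\<^sup>2)"
      using u0 by (simp add: smooth_space_def w_def)
    have D: "D \<ge> 0" unfolding D_def by (rule suminf_nonneg[OF w]) (simp add: w_def)
    have c: "c \<ge> 0" using c1 by (simp add: c_def)
    have c0: "c0 > 0" unfolding c0_def using c cP cA D by (intro add_nonneg_pos add_nonneg_nonneg) auto
    have ln1: "\<forall>\<^sub>F n in sequentially. ln (real n) \<ge> 1"
      using filterlim_compose[OF ln_at_top filterlim_real_sequentially] by (simp add: filterlim_at_top)
    have bias: "\<forall>\<^sub>F n in sequentially. norm (ridge.mean \<phi> (eigval \<delta>) S.T (?\<rho> n) (real n) (Ta (S.T u0)) - u0) \<le> c0 * ?\<xi> n"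
      using ln1 eventually_ge_at_top[of 1]
    proof eventually_elim
      case (elim n)
      interpret N: ridge \<phi> "eigval \<delta>" 1 S.T "?\<rho> n" "real n" by (rule ridge) (use elim in simp)
      define L where "L = ln (real n)"
      have L: "L \<ge> 1" using elim by (simp add: L_def)
      have n: "real n > 0" using elim by simp
      define J where "J = F.J L"
      have J: "J > 0" using F.J_ge1[OF L] by (simp add: J_def)
      define f where "f j = F.filt L (real (Suc j))" for j
      have f: "real n * (S.\<kappa> j)\<^sup>2 * eigval \<delta> j / ?\<rho> n = f j" for j
      proof -
        let ?i = "real (Suc j)"
        \<comment> \<open>The scaling of the prior turns \<open>n / R_n^2\<close> into
          \<open>n^(2 sigma)\<close>, the factor \<open>exp (2 * \<sigma> * L)\<close> of
          \<open>filt\<close>.\<close>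
        have h1: "real n / ?\<rho> n = exp (2 * \<sigma> * L)"
        proof -
          have "?\<rho> n = real n powr (1 - 2 * \<sigma>)"
            using R elim n by (simp add: power2_eq_square flip: powr_add)
          then have "real n / ?\<rho> n = real n powr 1 / real n powr (1 - 2 * \<sigma>)" using n by simp
          also have "\<dots> = real n powr (2 * \<sigma>)" unfolding powr_diff[symmetric] by simp
          finally show ?thesis using n by (simp add: powr_def L_def)
        qed
        have h2: "(S.\<kappa> j)\<^sup>2 * eigval \<delta> j = ?i powr q * exp (- 2 * ?i powr \<beta>)"
        proof -
          have "(S.\<kappa> j)\<^sup>2 = ?i powr (2 * (p * r)) * exp (- 2 * ?i powr \<beta>)"
            unfolding \<kappa> power_divide
            by (simp add: power2_eq_square exp_minus field_simps del: of_nat_Suc flip: powr_add exp_add)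
          moreover have "eigval \<delta> j = ?i powr (- p)" by (simp add: eigval_def p_def)
          moreover have "?i powr (2 * (p * r)) * ?i powr (- p) = ?i powr q"
            by (simp add: q_def right_diff_distrib mult_ac flip: powr_add)
          ultimately show ?thesis by (simp add: mult_ac)
        qed
        have "real n * (S.\<kappa> j)\<^sup>2 * eigval \<delta> j / ?\<rho> n = (real n / ?\<rho> n) * ((S.\<kappa> j)\<^sup>2 * eigval \<delta> j)" by simp
        then show ?thesis unfolding h1 h2 f_def F.filt_def by (simp only: mult.assoc)
      qed
      have "norm (N.mean (N.Ta (S.T u0)) - u0) \<le>
          sqrt (c * (cP * J powr (- p)) * (cA * J powr (p - 2 * \<gamma>)) * D) + sqrt (cB\<^sup>2 * J powr (- 2 * \<gamma>) * D)"
        unfolding c_def D_def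
      proof (rule N.bias_bound[OF S.\<kappa>_le c1 c2, unfolded f])
        fix j
        let ?i = "real (Suc j)"
        have i: "?i \<ge> 1" by simp
        have ev: "eigval \<delta> j = ?i powr (- p)" by (simp add: eigval_def p_def)
        have fj: "f j = F.filt L ?i" by (simp add: f_def)
        show "eigval \<delta> j / (1 + f j) \<le> cP * J powr (- p)"
          unfolding ev fj J_def by (rule cP(2)[OF L i])
        have "f j / (eigval \<delta> j * (1 + f j)\<^sup>2) = ?i powr (p - 2 * \<gamma>) * f j / (1 + f j)\<^sup>2 * w j"
          unfolding ev w_def by (simp add: powr_diff powr_minus field_simps del: of_nat_Suc)
        also have "\<dots> \<le> cA * J powr (p - 2 * \<gamma>) * w j"
          unfolding fj J_def by (rule mult_right_mono[OF cA(2)[OF L i]]) (simp add: w_def)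
        finally show "f j / (eigval \<delta> j * (1 + f j)\<^sup>2) \<le> cA * J powr (p - 2 * \<gamma>) * w j" .
        have "(?i powr (- \<gamma>) / (1 + f j))\<^sup>2 \<le> (cB * J powr (- \<gamma>))\<^sup>2"
          unfolding J_def fj
          by (rule power_mono[OF cB(2)[OF L i]]) (simp add: less_imp_le add_pos_pos F.filt_pos)
        then have "(?i powr (- \<gamma>) / (1 + f j))\<^sup>2 * w j \<le> (cB * J powr (- \<gamma>))\<^sup>2 * w j"
          by (rule mult_right_mono) (simp add: w_def)
        moreover have "(?i powr (- \<gamma>) / (1 + f j))\<^sup>2 * w j = 1 / (1 + f j)\<^sup>2"
        proof -
          have "(?i powr (- \<gamma>))\<^sup>2 * w j = 1"
            unfolding w_def power2_eq_square by (simp flip: powr_add)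
          then show ?thesis by (simp add: power_divide)
        qed
        moreover have "(J powr (- \<gamma>))\<^sup>2 = J powr (- 2 * \<gamma>)"
          by (simp add: power2_eq_square flip: powr_add)
        ultimately show "1 / (1 + f j)\<^sup>2 \<le> cB\<^sup>2 * J powr (- 2 * \<gamma>) * w j"
          by (simp add: power_mult_distrib)
      qed (rule w)
      also have "\<dots> = (sqrt (c * cP * cA * D) + sqrt (cB\<^sup>2 * D)) * J powr (- \<gamma>)"
      proof -
        have sq: "J powr (- 2 * \<gamma>) = (J powr (- \<gamma>))\<^sup>2"
          by (simp add: power2_eq_square flip: powr_add)
        \<comment> \<open>The exponent \<open>p\<close> cancels between the prior bound and the
          transition bound, so only the smoothness of \<open>u0\<close> is left in the rate.\<close>
        have JJ: "J powr (- p) * J powr (p - 2 * \<gamma>) = (J powr (- \<gamma>))\<^sup>2"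
          unfolding sq[symmetric] by (simp flip: powr_add)
        have "c * (cP * J powr (- p)) * (cA * J powr (p - 2 * \<gamma>)) * D = c * cP * cA * D * (J powr (- p) * J powr (p - 2 * \<gamma>))"
          by (simp only: mult_ac)
        then have "c * (cP * J powr (- p)) * (cA * J powr (p - 2 * \<gamma>)) * D = c * cP * cA * D * (J powr (- \<gamma>))\<^sup>2"
          unfolding JJ .
        moreover have "cB\<^sup>2 * J powr (- 2 * \<gamma>) * D = cB\<^sup>2 * D * (J powr (- \<gamma>))\<^sup>2"
          unfolding sq by simp
        moreover have "sqrt (x * (J powr (- \<gamma>))\<^sup>2) = sqrt x * J powr (- \<gamma>)" for x
          by (simp add: real_sqrt_mult)
        ultimately show ?thesis by (simp only: distrib_right)
      qed
      also have "\<dots> \<le> c0 * J powr (- \<gamma>)" by (rule mult_right_mono) (simp_all add: c0_def)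
      also have "J powr (- \<gamma>) = ?\<xi> n" using L by (simp add: J_def F.J_def L_def powr_powr)
      finally show ?case .
    qed
    show ?thesis
      unfolding \<zeta> G
    proof (rule model_contraction[OF prior ridge summable_eigval[OF \<delta>] C_eig bias c0])
      show "\<forall>\<^sub>F n in sequentially. ?\<xi> n > 0" using ln1 by eventually_elim auto
      have "\<forall>\<^sub>F n in sequentially. 1 / ((real n powr (1 / 2 - \<sigma>))\<^sup>2 * (?\<xi> n)\<^sup>2) = 1 / (?\<rho> n * (?\<xi> n)\<^sup>2)"
        using eventually_ge_at_top[of 1] by eventually_elim (simp add: R)
      then show "(\<lambda>n. 1 / (?\<rho> n * (?\<xi> n)\<^sup>2)) \<longlonglongrightarrow> 0"
        by (rule Lim_transform_eventually[OF log_rate_vanishes[OF \<sigma>(2)]])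
    qed
  qed
  ultimately show ?thesis by blast
qed

end
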